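(* Consider the Poisson system of $\alpha$-stable particle clusters in $\mathbb{R}^d$ described in the context, and let $\rho_r$ be the law of $Z_r[\psi]=\sigma_r^{-1}(A_r[\psi]-\mathbb{E}[A_r[\psi]])$. If $d=1$, $\psi\ge0$ and $d/\alpha<1$, then there is a constant $C>0$, independent of $r$, such that for all $r>0$ $$d_W(\rho_r,\gamma)\le C\,r^{-1/(2\alpha)},$$ where $\gamma$ is the standard Gaussian law.
   Context: Poisson input: $\nu$ is a Radon measure on $\mathbb{R}^d$, absolutely continuous with respect to Lebesgue measure, with density bounded from above and bounded away from zero; $\eta$ is a Poisson random measure on $\mathbb{R}^d$ with intensity $\nu$. Particles: fix $0<\alpha\le2$, $m\in\mathbb{N}$ and $a_1,\dots,a_m>0$. For each $x\in\mathbb{R}^d$ let $X^{1,x},\dots,X^{m,x}$ be independent symmetric $\alpha$-stable processes in $\mathbb{R}^d$ started from $x$ (so that $X^{i,x}$ is distributed as $x+X^{i,0}$); the families for different $x$ are independent of one another and of $\eta$. Put $\mu_t^x:=\sum_{i=1}^m a_i\delta_{X_t^{i,x}}$ and $\mu_t^\eta:=\int_{\mathbb{R}^d}\mu_t^x\,\eta(dx)$. Functional: for a bounded test function $\psi:\mathbb{R}^d\to\mathbb{R}$ with compact support, $A_r[\psi]:=\int_0^r\int_{\mathbb{R}^d}\psi\,d\mu_t^\eta\,dt$, and $\sigma_r$ is the standard deviation of $A_r[\psi]$, assumed to satisfy $0<\sigma_r<\infty$. Wasserstein distance: $d_W(\rho_1,\rho_2):=\sup\{|\int h\,d\rho_1-\int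 h\,d\rho_2| : h:\mathbb{R}\to\mathbb{R}\ 1\text{-Lipschitz}\}$. *)

theory Defs
  imports "HOL-Probability.Probability"
begin

section \<open>Poisson input\<close>

text \<open>Such a measure is finite on compact sets, hence Radon.\<close>

definition bounded_density_intensity :: "'a::euclidean_space measure \<Rightarrow> bool" where
  "bounded_density_intensity \<nu> \<longleftrightarrow>
     (\<exists>f l u. f \<in> borel_measurable borel \<and> 0 < l \<and> (\<forall>x. l \<le> f x \<and> f x \<le> (u::real))
        \<and> \<nu> = density lborel (\<lambda>x. ennreal (f x)))"

text \<open>Finite families of disjoint sets are covered by the infinite ones, padding with
  the empty set.\<close>

definition poisson_random_measure ::
  "'w measure \<Rightarrow> 'a::topological_space measure \<Rightarrow> ('w \<Rightarrow> 'a measure) \<Rightarrow> bool" where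
  "poisson_random_measure M \<nu> \<eta> \<longleftrightarrow>
     (\<forall>\<omega>\<in>space M. sets (\<eta> \<omega>) = sets borel)
   \<and> (\<forall>A\<in>sets borel. (\<lambda>\<omega>. emeasure (\<eta> \<omega>) A) \<in> borel_measurable M)
   \<and> (\<forall>A\<in>sets borel. emeasure \<nu> A < \<infinity> \<longrightarrow>
        (\<forall>n::nat. measure M {\<omega>\<in>space M. emeasure (\<eta> \<omega>) A = of_nat n}
           = measure \<nu> A ^ n / fact n * exp (- measure \<nu> A)))
   \<and> (\<forall>A\<in>sets borel. emeasure \<nu> A = \<infinity> \<longrightarrow> (AE \<omega> in M. emeasure (\<eta> \<omega>) A = \<infinity>))
   \<and> (\<forall>B :: nat \<Rightarrow> 'a set. range B \<subseteq> sets borel \<longrightarrow> disjoint_family B \<longrightarrow>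
        prob_space.indep_vars M (\<lambda>_. borel) (\<lambda>j \<omega>. emeasure (\<eta> \<omega>) (B j)) UNIV)"

section \<open>Stable processes\<close>

definition cadlag :: "(real \<Rightarrow> 'a::topological_space) \<Rightarrow> bool" where
  "cadlag p \<longleftrightarrow> (\<forall>t\<ge>0. continuous (at_right t) p) \<and> (\<forall>t>0. \<exists>l. (p \<longlongrightarrow> l) (at_left t))"

text \<open>Processes are maps on all of the reals; only the times \<open>t \<ge> 0\<close> matter.\<close>

definition levy_process :: "'w measure \<Rightarrow> (real \<Rightarrow> 'w \<Rightarrow> 'a::euclidean_space) \<Rightarrow> bool" where
  "levy_process M Y \<longleftrightarrow>
     (\<forall>t\<ge>0. Y t \<in> borel_measurable M)
   \<and> (AE \<omega> in M. Y 0 \<omega> = 0)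
   \<and> (\<forall>\<tau> :: nat \<Rightarrow> real. mono \<tau> \<longrightarrow> 0 \<le> \<tau> 0 \<longrightarrow>
        prob_space.indep_vars M (\<lambda>_. borel) (\<lambda>j \<omega>. Y (\<tau> (Suc j)) \<omega> - Y (\<tau> j) \<omega>) UNIV)
   \<and> (\<forall>s\<ge>0. \<forall>t\<ge>s. distr M borel (\<lambda>\<omega>. Y t \<omega> - Y s \<omega>) = distr M borel (Y (t - s)))
   \<and> (\<forall>\<omega>\<in>space M. cadlag (\<lambda>t. Y t \<omega>))"

text \<open>The symmetric \<open>\<alpha>\<close>-stable process started from 0, with scale \<open>c > 0\<close> (\<open>c = 1/2\<close>, \<open>\<alpha> = 2\<close> is
  standard Brownian motion). Symmetric means rotation invariant in dimension at least 2.\<close>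

definition symmetric_stable_process ::
  "'w measure \<Rightarrow> real \<Rightarrow> real \<Rightarrow> (real \<Rightarrow> 'w \<Rightarrow> 'a::euclidean_space) \<Rightarrow> bool" where
  "symmetric_stable_process M \<alpha> c Y \<longleftrightarrow>
     0 < c \<and> levy_process M Y
   \<and> (\<forall>t\<ge>0. \<forall>u. (CLINT \<omega>|M. iexp (u \<bullet> Y t \<omega>)) = exp (- complex_of_real (c * t * norm u powr \<alpha>)))"

section \<open>Particle clusters attached to the Poisson points\<close>

text \<open>\<open>X i x\<close> is the \<open>i\<close>-th particle of the cluster started from \<open>x\<close>. Only the clusters at the atoms
  of \<open>\<eta>\<close> enter the particle system, and conditions on \<open>X i x\<close> for deterministic \<open>x\<close> say nothing
  about them, since such an \<open>x\<close> is almost surely not an atom. So the standing assumption is stated,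
  in the usual sense of independent marking, along a measurable enumeration \<open>\<xi>\<close> of the atoms (with
  multiplicity): the displacements \<open>X i (\<xi> k) - \<xi> k\<close> are symmetric stable processes started
  from 0, independent of one another and of the points. The scale \<open>c i\<close> depends on the particle
  label only, so that the law of \<open>X i x\<close> is that of \<open>x + X i 0\<close>.\<close>

definition stable_clusters ::
  "'w measure \<Rightarrow> real \<Rightarrow> nat \<Rightarrow> (nat \<Rightarrow> real) \<Rightarrow> ('w \<Rightarrow> 'a::euclidean_space measure)
     \<Rightarrow> (nat \<Rightarrow> 'a \<Rightarrow> real \<Rightarrow> 'w \<Rightarrow> 'a) \<Rightarrow> bool" where
  "stable_clusters M \<alpha> m c \<eta> X \<longleftrightarrow>
     (\<exists>\<xi> :: nat \<Rightarrow> 'w \<Rightarrow> 'a. let D = (\<lambda>i k t \<omega>. X i (\<xi> k \<omega>) t \<omega> - \<xi> k \<omega>) in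
        (\<forall>k. \<xi> k \<in> borel_measurable M)
      \<and> (\<forall>\<omega>\<in>space M. \<eta> \<omega> = distr (count_space UNIV) borel (\<lambda>k. \<xi> k \<omega>))
      \<and> (\<forall>i\<in>{1..m}. \<forall>k. symmetric_stable_process M \<alpha> (c i) (D i k))
      \<and> prob_space.indep_vars M (\<lambda>_. PiM {0..} (\<lambda>_. borel))
          (\<lambda>(i, k) \<omega>. \<lambda>t\<in>{0..}. D i k t \<omega>) ({1..m} \<times> UNIV)
      \<and> prob_space.indep_set M
          (sets (vimage_algebra (space M) (\<lambda>\<omega>. \<lambda>k. \<xi> k \<omega>) (PiM UNIV (\<lambda>_. borel))))
          (sets (vimage_algebra (space M)
             (\<lambda>\<omega>. restrict (\<lambda>(i, k, t). D i k t \<omega>) ({1..m} \<times> UNIV \<times> {0..}))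
             (PiM ({1..m} \<times> UNIV \<times> {0..}) (\<lambda>_. borel)))))"

text \<open>The measure \<open>a 1 \<delta>(X 1 x t) + \<dots> + a m \<delta>(X m x t)\<close>.\<close>

definition cluster_measure ::
  "(nat \<Rightarrow> real) \<Rightarrow> nat \<Rightarrow> (nat \<Rightarrow> 'a::euclidean_space \<Rightarrow> real \<Rightarrow> 'w \<Rightarrow> 'a)
     \<Rightarrow> real \<Rightarrow> 'a \<Rightarrow> 'w \<Rightarrow> 'a measure" where
  "cluster_measure a m X t x \<omega> =
     distr (point_measure {1..m} (\<lambda>i. ennreal (a i))) borel (\<lambda>i. X i x t \<omega>)"

definition particle_measure ::
  "(nat \<Rightarrow> real) \<Rightarrow> nat \<Rightarrow> (nat \<Rightarrow> 'a::euclidean_space \<Rightarrow> real \<Rightarrow> 'w \<Rightarrow> 'a)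
     \<Rightarrow> ('w \<Rightarrow> 'a measure) \<Rightarrow> real \<Rightarrow> 'w \<Rightarrow> 'a measure" where
  "particle_measure a m X \<eta> t \<omega> =
     measure_of UNIV (sets borel) (\<lambda>B. \<integral>\<^sup>+x. emeasure (cluster_measure a m X t x \<omega>) B \<partial>\<eta> \<omega>)"

section \<open>The functional and its normalization\<close>

definition occupation ::
  "(nat \<Rightarrow> real) \<Rightarrow> nat \<Rightarrow> (nat \<Rightarrow> 'a::euclidean_space \<Rightarrow> real \<Rightarrow> 'w \<Rightarrow> 'a)
     \<Rightarrow> ('w \<Rightarrow> 'a measure) \<Rightarrow> ('a \<Rightarrow> real) \<Rightarrow> real \<Rightarrow> 'w \<Rightarrow> real" where
  "occupation a m X \<eta> \<psi> r \<omega> =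
     (LINT t:{0..r}|lborel. (LINT y|particle_measure a m X \<eta> t \<omega>. \<psi> y))"

text \<open>This is the standard deviation when \<open>A\<close> is square integrable.\<close>

definition std_dev :: "'w measure \<Rightarrow> ('w \<Rightarrow> real) \<Rightarrow> real" where
  "std_dev M A = sqrt (LINT \<omega>|M. (A \<omega> - (LINT \<omega>'|M. A \<omega>'))\<^sup>2)"

definition standardize :: "'w measure \<Rightarrow> ('w \<Rightarrow> real) \<Rightarrow> 'w \<Rightarrow> real" where
  "standardize M A \<omega> = (A \<omega> - (LINT \<omega>'|M. A \<omega>')) / std_dev M A"

text \<open>Intended for probability measures with finite first moment, for which all the integrals
  exist.\<close>

definition wasserstein :: "real measure \<Rightarrow> real measure \<Rightarrow> ennreal" where
  "wasserstein \<rho>1 \<rho>2 =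
     (SUP h\<in>{h :: real \<Rightarrow> real. 1-lipschitz_on UNIV h}. ennreal \<bar>(LINT x|\<rho>1. h x) - (LINT x|\<rho>2. h x)\<bar>)"

end

theory Submission
  imports Defs
begin

text \<open>
The occupation functional is a sum over the points of a Poisson process: the point \<open>\<xi> k\<close>, together
with the displacements of its cluster, contributes the nonnegative amount \<open>Y\<close>. Clusters are
independent marks, so that the sum is the integral of \<open>Y\<close> against a Poisson random measure whose
intensity \<open>N\<close> is the product of \<open>\<nu>\<close> and the law of the displacements. For such integrals the
distance of the standardized law from the Gaussian law is at most a constant times the integral of
\<open>Y ^ 3\<close> over \<open>N\<close>, divided by the third power of the standard deviation \<open>\<sigma>\<close>; and \<open>\<sigma>\<^sup>2\<close> is the
integral of \<open>Y\<^sup>2\<close>. It remains to compare two moments of the occupation time of a single particle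
whose starting point is spread out over the line. The particle returns to a bounded set after time
\<open>t\<close> with probability of order \<open>t powr (- 1 / \<alpha>)\<close>, and \<open>\<alpha> > 1\<close> makes this integrable at 0. So each
further power of the occupation time brings a factor of order \<open>r powr (1 - 1 / \<alpha>)\<close>: the second moment
is of order \<open>r powr (2 - 1 / \<alpha>)\<close> and the third of order \<open>r powr (3 - 2 / \<alpha>)\<close>. The ratio of the third
moment to \<open>\<sigma> ^ 3\<close> is of order \<open>r powr (- 1 / (2 * \<alpha>))\<close>.

The bound by the third moment (\<open>wasserstein_normal_bound\<close>) is Stein's method. It rests on the Mecke
formula for functions of the Poisson integral \<open>A\<close>: the mean of \<open>A * f A\<close> is the integral over \<open>N\<close> of
\<open>Y\<close> times the mean of \<open>f (A + Y)\<close>. For \<open>f x = exp (- s * x)\<close> this formula is the derivative of the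
Laplace transform of \<open>A\<close>, and by the Weierstrass theorem the exponentials suffice. So the particle
system enters through the Laplace transform of the occupation functional, which is computed by
averaging the marks first (\<open>laplace_marked_points\<close>); what remains is the Laplace functional of the
unmarked Poisson process (\<open>laplace_functional\<close>). The average does not depend on the index of the
point because a Levy process is determined in law by its one-dimensional marginals
(\<open>levy_path_law_unique\<close>).

Of the two moment estimates, the upper one (\<open>third_moment_occ\<close>) splits the path at three times into
independent increments and uses the concentration bound for stable laws. The lower one
(\<open>second_moment_occ\<close>) rests on the size of the path: the mean occupation time is proportional to
\<open>r\<close>, half of it comes from starting points in an interval of length of order \<open>r powr (1 / \<alpha>)\<close>, and
the Cauchy-Schwarz inequality on this interval gives the claim.
\<close>

section \<open>Bounds for Stein's equation\<close>

text \<open>Both \<open>v - w\<close> and \<open>v + w\<close> decrease, and their limit is 0.\<close>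

lemma tail_comparison:
  fixes w v :: "real \<Rightarrow> real"
  assumes w: "\<And>x. l \<le> x \<Longrightarrow> (w has_real_derivative w' x) (at x)"
    and v: "\<And>x. l \<le> x \<Longrightarrow> (v has_real_derivative v' x) (at x)"
    and le: "\<And>x. l \<le> x \<Longrightarrow> \<bar>w' x\<bar> \<le> - v' x"
    and lim: "(w \<longlongrightarrow> 0) at_top" "(v \<longlongrightarrow> 0) at_top"
    and x: "l \<le> x"
  shows "\<bar>w x\<bar> \<le> v x"
proof -
  have *: "0 \<le> v x - s * w x" if s: "\<bar>s\<bar> = 1" for s
  proof -
    have lim0: "((\<lambda>y. v y - s * w y) \<longlongrightarrow> 0 - s * 0) at_top"
      by (intro tendsto_intros lim)
    have mono: "v y - s * w y \<le> v x - s * w x" if "x \<le> y" for y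
    proof (rule DERIV_nonpos_imp_nonincreasing[OF that])
      fix z assume "x \<le> z" "z \<le> y"
      then have z: "l \<le> z" using x by simp
      have "((\<lambda>y. v y - s * w y) has_real_derivative v' z - s * w' z) (at z)"
        by (auto intro!: derivative_eq_intros v w z)
      moreover have "v' z - s * w' z \<le> 0"
        using le[OF z] s by (auto simp: abs_if split: if_splits)
      ultimately show "\<exists>d. DERIV (\<lambda>y. v y - s * w y) z :> d \<and> d \<le> 0" by blast
    qed
    have "0 - s * 0 \<le> v x - s * w x"
      by (rule tendsto_upperbound[OF lim0]) (auto intro!: eventually_at_top_linorderI[of x] mono)
    then show ?thesis by simp
  qed
  from *[of 1] *[of "-1"] show ?thesis by auto
qed

text \<open>Multiplied by the Gaussian weight, the equation becomes \<open>(g e)' = p e\<close> with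
  \<open>e = exp (- x\<^sup>2 / 2)\<close>. The function \<open>K e / x\<close> of Mills' ratio decreases at least as fast as
  \<open>g e\<close> can change, so that \<open>g e\<close>, which vanishes at infinity, stays below it.\<close>

lemma stein_ode_bounded_tail:
  fixes g p :: "real \<Rightarrow> real"
  assumes g: "\<And>x. (g has_real_derivative x * g x + p x) (at x)"
    and p: "\<And>x. \<bar>p x\<bar> \<le> K"
    and lim: "((\<lambda>x. g x * exp (- x\<^sup>2 / 2)) \<longlongrightarrow> 0) at_top"
    and x: "0 < x"
  shows "\<bar>x * g x\<bar> \<le> K"
proof -
  have K: "0 \<le> K" using p[of 0] by linarith
  have "\<bar>g x * exp (- x\<^sup>2 / 2)\<bar> \<le> K * (exp (- x\<^sup>2 / 2) / x)"
  proof (rule tail_comparison[where l = x and w = "\<lambda>x. g x * exp (- x\<^sup>2 / 2)"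
        and v = "\<lambda>x. K * (exp (- x\<^sup>2 / 2) / x)" and w' = "\<lambda>x. p x * exp (- x\<^sup>2 / 2)"
        and v' = "\<lambda>x. - K * (exp (- x\<^sup>2 / 2) * (1 + 1 / x\<^sup>2))"])
    fix y assume "x \<le> y"
    then have y: "0 < y" using x by simp
    show "((\<lambda>x. g x * exp (- x\<^sup>2 / 2)) has_real_derivative p y * exp (- y\<^sup>2 / 2)) (at y)"
      by (auto intro!: derivative_eq_intros g simp: algebra_simps)
    show "((\<lambda>x. K * (exp (- x\<^sup>2 / 2) / x)) has_real_derivative - K * (exp (- y\<^sup>2 / 2) * (1 + 1 / y\<^sup>2))) (at y)"
      using y by (auto intro!: derivative_eq_intros simp: field_simps power2_eq_square)
    have "\<bar>p y * exp (- y\<^sup>2 / 2)\<bar> \<le> K * exp (- y\<^sup>2 / 2)"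
      using p[of y] by (simp add: abs_mult)
    also have "\<dots> \<le> K * (exp (- y\<^sup>2 / 2) * (1 + 1 / y\<^sup>2))"
      using K y by (intro mult_left_mono) (auto simp: field_simps)
    finally show "\<bar>p y * exp (- y\<^sup>2 / 2)\<bar> \<le> - (- K * (exp (- y\<^sup>2 / 2) * (1 + 1 / y\<^sup>2)))" by simp
  next
    show "((\<lambda>x. K * (exp (- x\<^sup>2 / 2) / x)) \<longlongrightarrow> 0) at_top" by real_asymp
  qed (use lim in auto)
  then have "\<bar>g x\<bar> * exp (- x\<^sup>2 / 2) \<le> (K / x) * exp (- x\<^sup>2 / 2)"
    by (simp add: abs_mult)
  then have "\<bar>g x\<bar> \<le> K / x"
    by (rule mult_right_le_imp_le) simp
  then show ?thesis using x by (simp add: abs_mult field_simps)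
qed

text \<open>The reflection of \<open>g\<close> into \<open>- g (- x)\<close> solves an equation of the same type, which transfers
  the bound to the negative half line.\<close>

lemma stein_ode_bounded:
  fixes g p :: "real \<Rightarrow> real"
  assumes g: "\<And>x. (g has_real_derivative x * g x + p x) (at x)"
    and p: "\<And>x. \<bar>p x\<bar> \<le> K"
    and lim: "((\<lambda>x. g x * exp (- x\<^sup>2 / 2)) \<longlongrightarrow> 0) at_top"
      "((\<lambda>x. g x * exp (- x\<^sup>2 / 2)) \<longlongrightarrow> 0) at_bot"
  shows "\<bar>x * g x\<bar> \<le> K"
proof (cases x "0::real" rule: linorder_cases)
  case greater
  show ?thesis by (rule stein_ode_bounded_tail[OF g p lim(1) greater])
next
  case equal
  then show ?thesis using p[of 0] by auto
next
  case less
  have "\<bar>(- x) * (- g (- (- x)))\<bar> \<le> K"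
  proof (rule stein_ode_bounded_tail[where g = "\<lambda>x. - g (- x)" and p = "\<lambda>x. p (- x)"])
    fix y
    have "((\<lambda>x. g (- x)) has_real_derivative ((- y) * g (- y) + p (- y)) * (- 1)) (at y)"
      by (rule DERIV_chain'[where f = uminus and g = g], (auto intro!: derivative_eq_intros)[1], rule g)
    from DERIV_minus[OF this]
    show "((\<lambda>x. - g (- x)) has_real_derivative y * (- g (- y)) + p (- y)) (at y)" by simp
    show "((\<lambda>x. - g (- x) * exp (- x\<^sup>2 / 2)) \<longlongrightarrow> 0) at_top"
      using tendsto_minus[OF lim(2)[unfolded filterlim_at_bot_mirror]] by simp
  qed (use p less in auto)
  then show ?thesis by simp
qed

text \<open>Beyond 1 the comparison function is twice the weight itself, because \<open>\<bar>x\<bar> + 1 \<le> 2 * x\<close>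
  there. On the unit interval the weighted solution changes by at most 2 more.\<close>

lemma stein_ode_linear_growth_half_line:
  fixes f k :: "real \<Rightarrow> real"
  assumes f: "\<And>x. (f has_real_derivative x * f x + k x) (at x)"
    and k: "\<And>x. \<bar>k x\<bar> \<le> \<bar>x\<bar> + 1"
    and lim: "((\<lambda>x. f x * exp (- x\<^sup>2 / 2)) \<longlongrightarrow> 0) at_top"
    and x: "0 \<le> x"
  shows "\<bar>f x\<bar> \<le> 8"
proof -
  define w where "w = (\<lambda>x. f x * exp (- x\<^sup>2 / 2))"
  have w: "(w has_real_derivative k y * exp (- y\<^sup>2 / 2)) (at y)" for y
    unfolding w_def by (auto intro!: derivative_eq_intros f simp: algebra_simps)
  have far: "\<bar>w y\<bar> \<le> 2 * exp (- y\<^sup>2 / 2)" if "1 \<le> y" for y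
  proof (rule tail_comparison[where l = 1 and w = w and v = "\<lambda>x. 2 * exp (- x\<^sup>2 / 2)"
        and w' = "\<lambda>x. k x * exp (- x\<^sup>2 / 2)"
        and v' = "\<lambda>x. - 2 * x * exp (- x\<^sup>2 / 2)"])
    fix z :: real assume z: "1 \<le> z"
    show "((\<lambda>x. 2 * exp (- x\<^sup>2 / 2)) has_real_derivative - 2 * z * exp (- z\<^sup>2 / 2)) (at z)"
      by (auto intro!: derivative_eq_intros simp: field_simps)
    have "\<bar>k z * exp (- z\<^sup>2 / 2)\<bar> \<le> (2 * z) * exp (- z\<^sup>2 / 2)"
      unfolding abs_mult using k[of z] z by (intro mult_mono) auto
    then show "\<bar>k z * exp (- z\<^sup>2 / 2)\<bar> \<le> - (- 2 * z * exp (- z\<^sup>2 / 2))" by simp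
  next
    show "((\<lambda>x. 2 * exp (- x\<^sup>2 / 2)) \<longlongrightarrow> (0::real)) at_top" by real_asymp
  qed (use w that lim in \<open>auto simp: w_def\<close>)
  show ?thesis
  proof (cases "1 \<le> x")
    case True
    from far[OF True] have "\<bar>f x\<bar> * exp (- x\<^sup>2 / 2) \<le> 2 * exp (- x\<^sup>2 / 2)"
      by (simp add: w_def abs_mult)
    then show ?thesis by simp
  next
    case False
    then have x1: "x < 1" by simp
    obtain z where z: "x < z" "z < 1" "w 1 - w x = (1 - x) * (k z * exp (- z\<^sup>2 / 2))"
      using MVT2[OF x1, of w "\<lambda>y. k y * exp (- y\<^sup>2 / 2)"] w by blast
    have "\<bar>k z * exp (- z\<^sup>2 / 2)\<bar> \<le> 2 * 1"
      unfolding abs_mult using k[of z] z x by (intro mult_mono) auto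
    then have "\<bar>w 1 - w x\<bar> \<le> 1 * 2"
      unfolding z(3) abs_mult[of "1 - x"] using x x1 by (intro mult_mono) auto
    moreover have "\<bar>w 1\<bar> \<le> 2 * 1"
      using far[of 1] by (rule order_trans[OF _ mult_left_mono]) auto
    ultimately have w4: "\<bar>w x\<bar> \<le> 4" by linarith
    have "exp (x\<^sup>2 / 2) \<le> exp (1 / 2)"
      using x x1 by (simp add: power_le_one)
    also have "\<dots> \<le> (2::real)"
      using exp_half_le2 by simp
    finally have e: "exp (x\<^sup>2 / 2) \<le> 2" .
    have "f x = w x * exp (x\<^sup>2 / 2)"
      by (simp add: w_def flip: exp_add)
    then have "\<bar>f x\<bar> \<le> 4 * 2"
      unfolding abs_mult using w4 e
      by (metis abs_exp_cancel abs_ge_zero abs_mult mult_mono' exp_ge_zero)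
    then show ?thesis by simp
  qed
qed

lemma stein_ode_linear_growth:
  fixes f k :: "real \<Rightarrow> real"
  assumes f: "\<And>x. (f has_real_derivative x * f x + k x) (at x)"
    and k: "\<And>x. \<bar>k x\<bar> \<le> \<bar>x\<bar> + 1"
    and lim: "((\<lambda>x. f x * exp (- x\<^sup>2 / 2)) \<longlongrightarrow> 0) at_top"
      "((\<lambda>x. f x * exp (- x\<^sup>2 / 2)) \<longlongrightarrow> 0) at_bot"
  shows "\<bar>f x\<bar> \<le> 8"
proof (cases "0 \<le> x")
  case True
  show ?thesis by (rule stein_ode_linear_growth_half_line[OF f k lim(1) True])
next
  case False
  have "\<bar>- f (- (- x))\<bar> \<le> 8"
  proof (rule stein_ode_linear_growth_half_line[where f = "\<lambda>x. - f (- x)" and k = "\<lambda>x. k (- x)"])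
    fix y
    have "((\<lambda>x. f (- x)) has_real_derivative ((- y) * f (- y) + k (- y)) * (- 1)) (at y)"
      by (rule DERIV_chain'[where f = uminus and g = f], (auto intro!: derivative_eq_intros)[1], rule f)
    from DERIV_minus[OF this]
    show "((\<lambda>x. - f (- x)) has_real_derivative y * (- f (- y)) + k (- y)) (at y)" by simp
    show "((\<lambda>x. - f (- x) * exp (- x\<^sup>2 / 2)) \<longlongrightarrow> 0) at_top"
      using tendsto_minus[OF lim(2)[unfolded filterlim_at_bot_mirror]] by simp
    show "\<bar>k (- y)\<bar> \<le> \<bar>y\<bar> + 1" using k[of "- y"] by simp
  qed (use False in auto)
  then show ?thesis by simp
qed

text \<open>The integral of \<open>K\<close> over \<open>{..x}\<close> tends to 0 on the left in any case, and on the right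
  because the total integral is 0.\<close>

lemma antiderivative_vanishing_at_infinity:
  fixes K :: "real \<Rightarrow> real"
  assumes int: "integrable lborel K" and zero: "(LINT x|lborel. K x) = 0"
    and cont: "\<And>x. isCont K x"
  obtains W where "\<And>x. (W has_real_derivative K x) (at x)"
    and "(W \<longlongrightarrow> 0) at_top" "(W \<longlongrightarrow> 0) at_bot"
proof
  define W where "W = (\<lambda>y. LINT x|lborel. indicator {..y} x *\<^sub>R K x)"
  show "(W \<longlongrightarrow> 0) at_top"
    using tendsto_integral_at_top[OF _ int] zero by (simp add: W_def)
  show "(W \<longlongrightarrow> 0) at_bot"
  proof (rule tendsto_at_botI_sequentially)
    fix X :: "nat \<Rightarrow> real" assume X: "filterlim X at_bot sequentially"
    have "(\<lambda>n. W (X n)) \<longlonglongrightarrow> (LINT x::real|lborel. 0::real)"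
      unfolding W_def
    proof (rule integral_dominated_convergence[where w = "\<lambda>x. \<bar>K x\<bar>" and f = "\<lambda>x. 0"])
      show "AE x in lborel. (\<lambda>n. indicator {..X n} x *\<^sub>R K x) \<longlonglongrightarrow> 0"
      proof (rule AE_I2, rule tendsto_eventually)
        fix x
        from filterlim_at_bot_dense[THEN iffD1, OF X]
        have "eventually (\<lambda>n. X n < x) sequentially" by blast
        then show "eventually (\<lambda>n. indicator {..X n} x *\<^sub>R K x = 0) sequentially"
          by eventually_elim auto
      qed
    qed (use int in \<open>auto simp: indicator_def\<close>)
    then show "(\<lambda>n. W (X n)) \<longlonglongrightarrow> 0" by simp
  qed
  fix x :: real
  let ?a = "x - 1" and ?b = "x + 1"
  have W_eq: "W y = W ?a + integral {?a..y} K" if "?a \<le> y" for y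
  proof -
    have "W y - W ?a = (LINT x|lborel. indicator {..y} x *\<^sub>R K x - indicator {..?a} x *\<^sub>R K x)"
      unfolding W_def
      by (intro Bochner_Integration.integral_diff[symmetric] integrable_mult_indicator int) auto
    also have "\<dots> = (LINT x:{?a<..y}|lborel. K x)"
      unfolding set_lebesgue_integral_def using that
      by (intro Bochner_Integration.integral_cong) (auto simp: indicator_def)
    also have "\<dots> = (LINT x:{?a..y}|lborel. K x)"
      using AE_lborel_singleton[of ?a]
      by (intro set_integral_cong_set)
         (use int in \<open>auto simp: set_borel_measurable_def intro!: borel_measurable_integrable\<close>)
    also have "\<dots> = integral {?a..y} K"
      by (intro set_borel_integral_eq_integral(2))
         (use int in \<open>auto simp: set_integrable_def intro!: integrable_mult_indicator[where 'b=real, simplified]\<close>)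
    finally show ?thesis by simp
  qed
  have "((\<lambda>y. integral {?a..y} K) has_real_derivative K x) (at x within {?a..?b})"
    by (rule integral_has_real_derivative)
       (auto intro!: continuous_at_imp_continuous_on cont)
  then have "((\<lambda>y. integral {?a..y} K) has_real_derivative K x) (at x)"
    by (subst (asm) at_within_interior) (auto simp: interior_atLeastAtMost_real)
  then have "((\<lambda>y. W ?a + integral {?a..y} K) has_real_derivative K x) (at x)"
    by (auto intro!: derivative_eq_intros)
  then show "(W has_real_derivative K x) (at x)"
  proof (rule has_field_derivative_transform_within[where d = 1])
    fix y assume "dist y x < 1"
    then show "W ?a + integral {?a..y} K = W y"
      by (intro W_eq[symmetric]) (auto simp: dist_real_def)
  qed auto
qed

lemma std_normal_total: "measure std_normal_distribution UNIV = 1"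
  using prob_space.prob_space[OF prob_space_normal_density[of 1 0]] by simp

lemma integrable_std_normal_abs: "integrable std_normal_distribution (\<lambda>x. \<bar>x\<bar>)"
  using integrable_std_normal_moment_abs[of 1] by (subst integrable_density) auto

lemma std_normal_abs_le_one: "(LINT x|std_normal_distribution. \<bar>x\<bar>) \<le> 1"
proof -
  have "(LINT x|std_normal_distribution. \<bar>x\<bar>) = sqrt (2 / pi)"
    using integral_std_normal_moment_abs_odd[of 0] by (subst integral_density) auto
  also have "\<dots> \<le> 1" using pi_gt3 by (simp add: real_sqrt_le_1_iff)
  finally show ?thesis .
qed

text \<open>The solution \<open>f\<close> of Stein's equation is the primitive of \<open>(h - \<gamma>h) e\<close> divided by the Gaussian
  weight \<open>e\<close>, and the primitive vanishes at both ends because \<open>h - \<gamma>h\<close> is centred. Its right-hand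
  side grows linearly, which bounds \<open>f\<close> by 8. Differentiation shows that \<open>f'\<close> solves the same
  equation with the right-hand side \<open>f + h'\<close>, which is bounded by 9. Hence \<open>x * f' x\<close> is bounded
  by 9, and \<open>f''\<close>, the sum of the two, by 18.\<close>

lemma stein_solution:
  fixes h h' :: "real \<Rightarrow> real"
  defines "\<gamma>h \<equiv> (LINT x|std_normal_distribution. h x)"
  assumes h: "\<And>x. (h has_real_derivative h' x) (at x)" and h': "\<And>x. \<bar>h' x\<bar> \<le> 1"
  obtains f f' f'' where
    "\<And>x. (f has_real_derivative f' x) (at x)" "\<And>x. (f' has_real_derivative f'' x) (at x)"
    "\<And>x. f' x - x * f x = h x - \<gamma>h" "\<And>x. \<bar>f x\<bar> \<le> 8" "\<And>x. \<bar>f'' x\<bar> \<le> 18"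
proof -
  interpret N: prob_space std_normal_distribution
    by (rule prob_space_normal_density) simp
  note total = std_normal_total and int_abs = integrable_std_normal_abs
  have cont_h: "isCont h x" for x
    using h by (rule DERIV_isCont)
  have [measurable]: "h \<in> borel_measurable borel"
    by (intro borel_measurable_continuous_onI) (auto simp: continuous_on_eq_continuous_at cont_h)
  have lip: "\<bar>h x - h y\<bar> \<le> \<bar>x - y\<bar>" for x y
    using field_differentiable_bound[of UNIV h h' 1 x y] h h' by auto
  have int_h: "integrable std_normal_distribution h"
  proof (rule Bochner_Integration.integrable_bound)
    show "integrable std_normal_distribution (\<lambda>x. \<bar>h 0\<bar> + \<bar>x\<bar>)" using int_abs by simp
    show "AE x in std_normal_distribution. norm (h x) \<le> norm (\<bar>h 0\<bar> + \<bar>x\<bar>)"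
    proof (rule AE_I2)
      fix x show "norm (h x) \<le> norm (\<bar>h 0\<bar> + \<bar>x\<bar>)"
        using lip[of x 0] by (simp add: abs_if split: if_splits)
    qed
  qed simp
  define k where "k = (\<lambda>x. h x - \<gamma>h)"
  have k: "\<bar>k x\<bar> \<le> \<bar>x\<bar> + 1" for x
  proof -
    have "k x = (LINT y|std_normal_distribution. h x - h y)"
      using int_h by (simp add: k_def \<gamma>h_def total)
    also have "\<bar>\<dots>\<bar> \<le> (LINT y|std_normal_distribution. \<bar>x\<bar> + \<bar>y\<bar>)"
      by (rule order_trans[OF integral_abs_bound integral_mono])
         (use int_h int_abs lip[of x] in \<open>auto intro: order_trans[OF _ abs_triangle_ineq4]\<close>)
    also have "\<dots> \<le> \<bar>x\<bar> + 1"
      using int_abs std_normal_abs_le_one by (simp add: total)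
    finally show ?thesis .
  qed
  have "integrable std_normal_distribution k"
    using int_h by (simp add: k_def)
  then have int: "integrable lborel (\<lambda>x. std_normal_density x * k x)"
    by (subst (asm) integrable_density) (auto simp: k_def)
  have "(LINT x|std_normal_distribution. k x) = 0"
    using int_h by (simp add: k_def \<gamma>h_def total)
  then have zero: "(LINT x|lborel. std_normal_density x * k x) = 0"
    by (subst (asm) integral_density) (auto simp: k_def)
  obtain W where W: "\<And>x. (W has_real_derivative std_normal_density x * k x) (at x)"
    "(W \<longlongrightarrow> 0) at_top" "(W \<longlongrightarrow> 0) at_bot"
    by (rule antiderivative_vanishing_at_infinity[OF int zero])
       (auto simp: k_def normal_density_def cont_h intro!: continuous_intros)
  let ?c = "sqrt (2 * pi)"
  define f where "f = (\<lambda>x. ?c * (W x * exp (x\<^sup>2 / 2)))"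
  define f' where "f' = (\<lambda>x. x * f x + k x)"
  define f'' where "f'' = (\<lambda>x. x * f' x + (f x + h' x))"
  have cancel: "exp (x\<^sup>2 / 2) * exp (- x\<^sup>2 / 2) = (1::real)" for x :: real
    by (simp flip: exp_add)
  have f: "(f has_real_derivative f' x) (at x)" for x
  proof -
    have one: "?c * (std_normal_density x * exp (x\<^sup>2 / 2)) = 1"
      using cancel[of x] by (simp add: normal_density_def mult.commute)
    have "((\<lambda>x. ?c * (W x * exp (x\<^sup>2 / 2))) has_real_derivative
        ?c * (W x * (exp (x\<^sup>2 / 2) * x) + (std_normal_density x * k x) * exp (x\<^sup>2 / 2))) (at x)"
      by (auto intro!: derivative_eq_intros W)
    also have "?c * (W x * (exp (x\<^sup>2 / 2) * x) + (std_normal_density x * k x) * exp (x\<^sup>2 / 2))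
        = x * f x + (?c * (std_normal_density x * exp (x\<^sup>2 / 2))) * k x"
      by (simp only: f_def ring_distribs ac_simps)
    finally show ?thesis
      by (simp only: one f'_def f_def mult_1)
  qed
  have weight: "f x * exp (- x\<^sup>2 / 2) = ?c * W x" for x
    using cancel[of x] by (simp add: f_def)
  have lim_f: "((\<lambda>x. f x * exp (- x\<^sup>2 / 2)) \<longlongrightarrow> 0) at_top" "((\<lambda>x. f x * exp (- x\<^sup>2 / 2)) \<longlongrightarrow> 0) at_bot"
    unfolding weight using tendsto_mult[OF tendsto_const W(2)] tendsto_mult[OF tendsto_const W(3)] by auto
  have f8: "\<bar>f x\<bar> \<le> 8" for x
    by (rule stein_ode_linear_growth[OF _ k lim_f]) (use f f'_def in auto)
  have f'_deriv: "(f' has_real_derivative f'' x) (at x)" for x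
  proof -
    have "((\<lambda>x. x * f x + (h x - \<gamma>h)) has_real_derivative x * f' x + f x + h' x) (at x)"
      by (auto intro!: derivative_eq_intros f h)
    then show ?thesis
      by (simp only: f'_def f''_def k_def[abs_def] add.assoc)
  qed
  have dom: "\<bar>f' x * exp (- x\<^sup>2 / 2)\<bar> \<le> (9 * \<bar>x\<bar> + 1) * exp (- x\<^sup>2 / 2)" for x
  proof -
    have "\<bar>f' x\<bar> \<le> \<bar>x\<bar> * \<bar>f x\<bar> + \<bar>k x\<bar>"
      unfolding f'_def by (simp flip: abs_mult)
    also have "\<dots> \<le> \<bar>x\<bar> * 8 + (\<bar>x\<bar> + 1)"
      by (intro add_mono mult_left_mono f8 k) auto
    finally show ?thesis by (simp add: abs_mult)
  qed
  have lim_f': "((\<lambda>x. f' x * exp (- x\<^sup>2 / 2)) \<longlongrightarrow> 0) at_top"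
    by (rule Lim_null_comparison[OF always_eventually, where g = "\<lambda>x. (9 * \<bar>x\<bar> + 1) * exp (- x\<^sup>2 / 2)"])
       (use dom in simp, real_asymp)
  have lim_f'_bot: "((\<lambda>x. f' x * exp (- x\<^sup>2 / 2)) \<longlongrightarrow> 0) at_bot"
    by (rule Lim_null_comparison[OF always_eventually, where g = "\<lambda>x. (9 * \<bar>x\<bar> + 1) * exp (- x\<^sup>2 / 2)"])
       (use dom in simp, real_asymp)
  have xf': "\<bar>x * f' x\<bar> \<le> 9" for x
  proof (rule stein_ode_bounded[OF _ _ lim_f' lim_f'_bot])
    show "(f' has_real_derivative x * f' x + (f x + h' x)) (at x)" for x
      using f'_deriv[of x] by (simp add: f''_def)
    show "\<bar>f x + h' x\<bar> \<le> 9" for x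
      using f8[of x] h'[of x] by linarith
  qed
  have f''18: "\<bar>f'' x\<bar> \<le> 18" for x
    unfolding f''_def using xf'[of x] f8[of x] h'[of x] abs_triangle_ineq[of "x * f' x" "f x + h' x"]
      abs_triangle_ineq[of "f x" "h' x"] by linarith
  show ?thesis
    by (rule that[OF f f'_deriv _ f8 f''18]) (simp add: f'_def k_def)
qed

text \<open>The averages of \<open>h\<close> over the intervals from \<open>x\<close> to \<open>x + \<epsilon>\<close> have the difference quotients of
  \<open>h\<close> as derivative and are values of \<open>h\<close> at points within distance \<open>\<epsilon>\<close> of \<open>x\<close>.\<close>

lemma lipschitz_smooth_approximation:
  fixes h :: "real \<Rightarrow> real"
  assumes h: "1-lipschitz_on UNIV h" and "0 < \<epsilon>"
  obtains g g' where "\<And>x. (g has_real_derivative g' x) (at x)" "\<And>x. \<bar>g' x\<bar> \<le> 1"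
    "\<And>x. \<bar>g x - h x\<bar> \<le> \<epsilon>"
proof -
  have lip: "\<bar>h x - h y\<bar> \<le> \<bar>x - y\<bar>" for x y
    using lipschitz_onD[OF h, of x y] by (simp add: dist_real_def)
  have cont: "continuous_on A h" for A
    using lipschitz_on_continuous_on[OF h] continuous_on_subset by blast
  define H where "H = (\<lambda>x::real. LBINT t=0..x. h t)"
  have H: "(H has_real_derivative h x) (at x)" for x
  proof -
    define R where "R = \<bar>x\<bar> + 1"
    have "(H has_vector_derivative h x) (at x within {-R..R})"
      unfolding H_def zero_ereal_def
      by (rule interval_integral_FTC2) (auto simp: R_def intro: cont)
    moreover have "x \<in> interior {-R..R}"
      by (auto simp: interior_atLeastAtMost_real R_def)
    ultimately show ?thesis
      by (simp only: at_within_interior has_real_derivative_iff_has_vector_derivative)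
  qed
  define g where "g = (\<lambda>x. (H (x + \<epsilon>) - H x) / \<epsilon>)"
  show ?thesis
  proof (rule that[of g "\<lambda>x. (h (x + \<epsilon>) - h x) / \<epsilon>"])
    fix x
    show "(g has_real_derivative (h (x + \<epsilon>) - h x) / \<epsilon>) (at x)"
    proof -
      have "((\<lambda>x. H (x + \<epsilon>)) has_real_derivative h (x + \<epsilon>)) (at x)"
        by (rule DERIV_shift[THEN iffD1, OF H])
      from DERIV_cdivide[OF DERIV_diff[OF this H]] show ?thesis
        unfolding g_def .
    qed
    show "\<bar>(h (x + \<epsilon>) - h x) / \<epsilon>\<bar> \<le> 1"
      using lip[of "x + \<epsilon>" x] \<open>0 < \<epsilon>\<close> by (simp add: abs_divide)
    obtain z where "x < z" "z < x + \<epsilon>" "H (x + \<epsilon>) - H x = (x + \<epsilon> - x) * h z"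
      using MVT2[of x "x + \<epsilon>" H h] H \<open>0 < \<epsilon>\<close> by auto
    then show "\<bar>g x - h x\<bar> \<le> \<epsilon>"
      using lip[of z x] \<open>0 < \<epsilon>\<close> by (simp add: g_def)
  qed
qed

section \<open>Stein's method for Poisson integrals\<close>

lemma exp_neg_diff_le:
  fixes y :: real
  assumes "0 \<le> y" "0 \<le> s" "0 \<le> t"
  shows "\<bar>exp (- s * y) - exp (- t * y)\<bar> \<le> \<bar>s - t\<bar> * y"
proof -
  have *: "exp (- s * y) - exp (- t * y) \<le> (t - s) * y \<and> 0 \<le> exp (- s * y) - exp (- t * y)"
    if "0 \<le> s" "s \<le> t" for s t
  proof -
    have "exp (- s * y) - exp (- t * y) = exp (- s * y) * (1 - exp (- ((t - s) * y)))"
      by (simp add: algebra_simps flip: exp_add)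
    also have "\<dots> \<le> 1 * ((t - s) * y)"
      using that assms exp_ge_add_one_self[of "- ((t - s) * y)"] by (intro mult_mono) auto
    finally show ?thesis
      using that assms by (auto intro!: mult_right_mono)
  qed
  show ?thesis
    using *[of s t] *[of t s] assms by (cases "s \<le> t") auto
qed

text \<open>The difference quotients in \<open>s\<close> of \<open>1 - exp (- s * y)\<close> lie between 0 and \<open>y\<close>, so that
  dominated convergence applies. The derivative is one-sided in order to include \<open>s = 0\<close>, where it
  gives the mean.\<close>

lemma laplace_exponent_derivative:
  fixes Y :: "'b \<Rightarrow> real"
  assumes Y: "integrable N Y" "\<And>x. 0 \<le> Y x" and s: "0 \<le> s"
  shows "((\<lambda>s. LINT x|N. 1 - exp (- s * Y x)) has_real_derivative (LINT x|N. Y x * exp (- s * Y x)))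
    (at s within {0..})"
  unfolding has_field_derivative_iff tendsto_at_iff_sequentially
proof (intro allI impI)
  have [measurable]: "Y \<in> borel_measurable N" using Y by auto
  have int: "integrable N (\<lambda>x. 1 - exp (- t * Y x))" if "0 \<le> t" for t
  proof (rule Bochner_Integration.integrable_bound)
    show "integrable N (\<lambda>x. t * Y x)" using Y by simp
    show "AE x in N. norm (1 - exp (- t * Y x)) \<le> norm (t * Y x)"
      using exp_neg_diff_le[of "Y _" 0 t] Y that by (intro AE_I2) auto
  qed simp
  fix X :: "nat \<Rightarrow> real" assume X: "\<forall>i. X i \<in> {0..} - {s}" "X \<longlonglongrightarrow> s"
  let ?q = "\<lambda>i x. ((1 - exp (- X i * Y x)) - (1 - exp (- s * Y x))) / (X i - s)"
  have "(\<lambda>i. LINT x|N. ?q i x) \<longlonglongrightarrow> (LINT x|N. Y x * exp (- s * Y x))"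
  proof (rule integral_dominated_convergence[where w = Y])
    show "AE x in N. (\<lambda>i. ?q i x) \<longlonglongrightarrow> Y x * exp (- s * Y x)"
    proof (rule AE_I2)
      fix x
      have "((\<lambda>t. 1 - exp (- t * Y x)) has_real_derivative Y x * exp (- s * Y x)) (at s within {0..})"
        by (auto intro!: derivative_eq_intros)
      then show "(\<lambda>i. ?q i x) \<longlonglongrightarrow> Y x * exp (- s * Y x)"
        unfolding has_field_derivative_iff tendsto_at_iff_sequentially o_def using X by blast
    qed
    show "AE x in N. norm (?q i x) \<le> Y x" for i
    proof (rule AE_I2)
      fix x
      have "X i \<noteq> s" "0 \<le> X i" using X by auto
      then show "norm (?q i x) \<le> Y x"
        using exp_neg_diff_le[of "Y x" s "X i"] Y s
        by (simp add: abs_divide divide_le_eq abs_minus_commute mult.commute)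
    qed
  qed (use Y in auto)
  moreover have "(LINT x|N. ?q i x)
      = ((LINT x|N. 1 - exp (- X i * Y x)) - (LINT x|N. 1 - exp (- s * Y x))) / (X i - s)" for i
    using X s int[of s] int[of "X i"]
    by (subst integral_divide_zero, subst Bochner_Integration.integral_diff) auto
  ultimately show "((\<lambda>t. ((LINT x|N. 1 - exp (- t * Y x)) - (LINT x|N. 1 - exp (- s * Y x))) / (t - s)) \<circ> X)
      \<longlonglongrightarrow> (LINT x|N. Y x * exp (- s * Y x))"
    by (simp only: o_def)
qed

lemma abs_integral_le:
  fixes f g :: "'b \<Rightarrow> real"
  assumes "integrable N f" "integrable N g" "\<And>x. x \<in> space N \<Longrightarrow> \<bar>f x\<bar> \<le> g x"
  shows "\<bar>LINT x|N. f x\<bar> \<le> (LINT x|N. g x)"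
  by (rule order_trans[OF integral_abs_bound integral_mono[OF integrable_abs]]) (use assms in auto)

text \<open>The assumption on the Laplace transform says that \<open>A\<close> has the law of the integral of \<open>Y\<close>
  against a Poisson random measure with intensity \<open>N\<close>. All that follows sees the random measure
  through this transform.\<close>

locale poisson_integral_law = prob_space M + N: sigma_finite_measure N
  for M :: "'w measure" and N :: "'b measure" +
  fixes A :: "'w \<Rightarrow> real" and Y :: "'b \<Rightarrow> real"
  assumes A_nonneg: "\<And>\<omega>. 0 \<le> A \<omega>" and integrable_A: "integrable M A"
    and Y_nonneg: "\<And>x. 0 \<le> Y x" and integrable_Y: "integrable N Y"
    and laplace: "\<And>s. 0 \<le> s \<Longrightarrow> (LINT \<omega>|M. exp (- s * A \<omega>)) = exp (- (LINT x|N. 1 - exp (- s * Y x)))"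
begin

sublocale P: pair_sigma_finite N M ..

lemma measurable_A [measurable]: "A \<in> borel_measurable M"
  using integrable_A by auto

lemma measurable_Y [measurable]: "Y \<in> borel_measurable N"
  using integrable_Y by auto

lemma integrable_product:
  fixes f :: "'b \<Rightarrow> real" and g :: "'w \<Rightarrow> real"
  assumes f: "integrable N f" and g: "integrable M g"
  shows "integrable (N \<Otimes>\<^sub>M M) (\<lambda>p. f (fst p) * g (snd p))"
    and "(LINT p|(N \<Otimes>\<^sub>M M). f (fst p) * g (snd p)) = (LINT x|N. f x) * (LINT \<omega>|M. g \<omega>)"
proof -
  have [measurable]: "f \<in> borel_measurable N" "g \<in> borel_measurable M"
    using assms by auto
  show int: "integrable (N \<Otimes>\<^sub>M M) (\<lambda>p. f (fst p) * g (snd p))"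
    by (rule P.Fubini_integrable) (use f g in \<open>auto simp: abs_mult\<close>)
  show "(LINT p|(N \<Otimes>\<^sub>M M). f (fst p) * g (snd p)) = (LINT x|N. f x) * (LINT \<omega>|M. g \<omega>)"
    using P.integral_fst'[OF int] by simp
qed

lemma integrable_fst:
  fixes f :: "'b \<Rightarrow> real"
  assumes f: "integrable N f"
  shows "integrable (N \<Otimes>\<^sub>M M) (\<lambda>p. f (fst p))"
    and "(LINT p|(N \<Otimes>\<^sub>M M). f (fst p)) = (LINT x|N. f x)"
  using integrable_product[OF f, of "\<lambda>_. 1"] by (simp_all add: prob_space)

text \<open>Both sides are minus the derivative in \<open>s\<close> of the Laplace transform of \<open>A\<close>. This is the
  Mecke formula for an exponential function of \<open>A\<close>.\<close>

lemma laplace_derivative: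
  assumes s: "0 \<le> s"
  shows "(LINT \<omega>|M. A \<omega> * exp (- s * A \<omega>)) = (LINT x|N. Y x * exp (- s * Y x)) * (LINT \<omega>|M. exp (- s * A \<omega>))"
proof -
  have "((\<lambda>s. LINT \<omega>|M. 1 - exp (- s * A \<omega>)) has_real_derivative
      (LINT x|N. Y x * exp (- s * Y x)) * exp (- (LINT x|N. 1 - exp (- s * Y x)))) (at s within {0..})"
  proof (rule has_field_derivative_transform_within[where d = 1
        and f = "\<lambda>s. 1 - exp (- (LINT x|N. 1 - exp (- s * Y x)))"])
    fix t :: real assume t: "t \<in> {0..}"
    have "integrable M (\<lambda>\<omega>. exp (- t * A \<omega>))"
      by (rule integrable_const_bound[where B = 1]) (use t A_nonneg in auto)
    then show "1 - exp (- (LINT x|N. 1 - exp (- t * Y x))) = (LINT \<omega>|M. 1 - exp (- t * A \<omega>))"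
      using t laplace[of t] by (simp add: prob_space)
  next
    show "((\<lambda>s. 1 - exp (- (LINT x|N. 1 - exp (- s * Y x)))) has_real_derivative
      (LINT x|N. Y x * exp (- s * Y x)) * exp (- (LINT x|N. 1 - exp (- s * Y x)))) (at s within {0..})"
      using laplace_exponent_derivative[OF integrable_Y Y_nonneg s]
      by (auto intro!: derivative_eq_intros)
  qed (use s in auto)
  from has_field_derivative_unique[OF laplace_exponent_derivative[OF integrable_A A_nonneg s] this]
  moreover have "closure {s<..} \<subseteq> closure ({0..} - {s})"
    using s by (intro closure_mono) auto
  then have "s \<in> closure ({0..} - {s})" by auto
  ultimately show ?thesis
    using laplace[OF s] by (simp add: at_within_eq_bot_iff)
qed

text \<open>The gap between the two sides of the Mecke formula for functions of \<open>A\<close>. It is linear in \<open>f\<close>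
  and will be shown to vanish.\<close>

definition size_bias_gap :: "(real \<Rightarrow> real) \<Rightarrow> real" where
  "size_bias_gap f = (LINT \<omega>|M. A \<omega> * f (A \<omega>)) - (LINT p|(N \<Otimes>\<^sub>M M). Y (fst p) * f (Y (fst p) + A (snd p)))"

lemma integrable_times_bounded:
  assumes [measurable]: "f \<in> borel_measurable borel" and f: "\<And>x. 0 \<le> x \<Longrightarrow> \<bar>f x\<bar> \<le> B"
  shows "integrable M (\<lambda>\<omega>. A \<omega> * f (A \<omega>))"
    and "integrable (N \<Otimes>\<^sub>M M) (\<lambda>p. Y (fst p) * f (Y (fst p) + A (snd p)))"
proof -
  show "integrable M (\<lambda>\<omega>. A \<omega> * f (A \<omega>))"
    by (rule Bochner_Integration.integrable_bound[where f = "\<lambda>\<omega>. A \<omega> * B"])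
       (use A_nonneg integrable_A in \<open>auto simp: abs_mult intro!: mult_left_mono order_trans[OF f abs_ge_self]\<close>)
  show "integrable (N \<Otimes>\<^sub>M M) (\<lambda>p. Y (fst p) * f (Y (fst p) + A (snd p)))"
    by (rule Bochner_Integration.integrable_bound[where f = "\<lambda>p. Y (fst p) * B"])
       (use A_nonneg Y_nonneg integrable_fst(1)[OF integrable_Y] in
         \<open>auto simp: abs_mult intro!: mult_left_mono order_trans[OF f abs_ge_self] add_nonneg_nonneg\<close>)
qed

lemma size_bias_gap_exp: "size_bias_gap (\<lambda>x. exp (- x) ^ n) = 0"
proof -
  define s where "s = real n"
  have s: "0 \<le> s" by (simp add: s_def)
  have pow: "exp (- x) ^ n = exp (- s * x)" for x :: real
    by (simp add: s_def flip: exp_of_nat_mult)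
  have "(LINT p|(N \<Otimes>\<^sub>M M). Y (fst p) * exp (- s * (Y (fst p) + A (snd p))))
      = (LINT p|(N \<Otimes>\<^sub>M M). (Y (fst p) * exp (- s * Y (fst p))) * exp (- s * A (snd p)))"
    by (simp add: ring_distribs exp_diff exp_minus field_simps exp_add)
  also have "\<dots> = (LINT x|N. Y x * exp (- s * Y x)) * (LINT \<omega>|M. exp (- s * A \<omega>))"
  proof (rule integrable_product(2))
    show "integrable N (\<lambda>x. Y x * exp (- s * Y x))"
      by (rule Bochner_Integration.integrable_bound[OF integrable_Y])
         (use s Y_nonneg in \<open>auto simp: abs_mult intro!: mult_left_le\<close>)
    show "integrable M (\<lambda>\<omega>. exp (- s * A \<omega>))"
      by (rule integrable_const_bound[where B = 1]) (use s A_nonneg in auto)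
  qed
  finally show ?thesis
    using laplace_derivative[OF s] by (simp add: size_bias_gap_def pow)
qed

lemma size_bias_gap_add:
  assumes [measurable]: "f \<in> borel_measurable borel" "g \<in> borel_measurable borel"
    and f: "\<And>x. 0 \<le> x \<Longrightarrow> \<bar>f x\<bar> \<le> B" and g: "\<And>x. 0 \<le> x \<Longrightarrow> \<bar>g x\<bar> \<le> C"
  shows "size_bias_gap (\<lambda>x. f x + g x) = size_bias_gap f + size_bias_gap g"
  using integrable_times_bounded[OF assms(1) f] integrable_times_bounded[OF assms(2) g]
  by (simp add: size_bias_gap_def ring_distribs)

lemma size_bias_gap_cmult: "size_bias_gap (\<lambda>x. c * f x) = c * size_bias_gap f"
  by (simp add: size_bias_gap_def ring_distribs mult.left_commute)

lemma size_bias_gap_polynomial: "size_bias_gap (\<lambda>x. \<Sum>i\<le>n. a i * exp (- x) ^ i) = 0"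
proof (induction n)
  case 0
  then show ?case using size_bias_gap_cmult[of "a 0" "\<lambda>x. exp (- x) ^ 0"] size_bias_gap_exp[of 0] by simp
next
  case (Suc n)
  have "\<bar>\<Sum>i\<le>n. a i * exp (- x) ^ i\<bar> \<le> (\<Sum>i\<le>n. \<bar>a i\<bar>)" if "0 \<le> x" for x :: real
    by (rule order_trans[OF sum_abs sum_mono])
       (use that in \<open>auto simp: abs_mult power_le_one intro!: mult_left_le\<close>)
  moreover have "\<bar>a (Suc n) * exp (- x) ^ Suc n\<bar> \<le> \<bar>a (Suc n)\<bar>" if "0 \<le> x" for x :: real
    using that power_le_one[of "exp (- x)" "Suc n"] by (auto simp: abs_mult intro!: mult_left_le)
  ultimately have "size_bias_gap (\<lambda>x. (\<Sum>i\<le>n. a i * exp (- x) ^ i) + a (Suc n) * exp (- x) ^ Suc n)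
      = size_bias_gap (\<lambda>x. \<Sum>i\<le>n. a i * exp (- x) ^ i) + size_bias_gap (\<lambda>x. a (Suc n) * exp (- x) ^ Suc n)"
    by (intro size_bias_gap_add) auto
  then show ?case
    using Suc size_bias_gap_cmult[of "a (Suc n)" "\<lambda>x. exp (- x) ^ Suc n"] size_bias_gap_exp[of "Suc n"]
    by simp
qed

lemma size_bias_gap_bound:
  assumes [measurable]: "f \<in> borel_measurable borel" and f: "\<And>x. 0 \<le> x \<Longrightarrow> \<bar>f x\<bar> \<le> B"
  shows "\<bar>size_bias_gap f\<bar> \<le> B * (expectation A + (LINT x|N. Y x))"
proof -
  have "\<bar>LINT \<omega>|M. A \<omega> * f (A \<omega>)\<bar> \<le> (LINT \<omega>|M. A \<omega> * B)"
    by (rule abs_integral_le[OF integrable_times_bounded(1)[OF assms(1) f]])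
       (use A_nonneg integrable_A in \<open>auto simp: abs_mult intro!: mult_left_mono f\<close>)
  moreover have "\<bar>LINT p|(N \<Otimes>\<^sub>M M). Y (fst p) * f (Y (fst p) + A (snd p))\<bar> \<le> (LINT p|(N \<Otimes>\<^sub>M M). Y (fst p) * B)"
    by (rule abs_integral_le[OF integrable_times_bounded(2)[OF assms(1) f]])
       (use Y_nonneg A_nonneg integrable_fst(1)[OF integrable_Y]
         in \<open>auto simp: abs_mult intro!: mult_left_mono f add_nonneg_nonneg\<close>)
  ultimately show ?thesis
    using integrable_fst(2)[OF integrable_Y] by (simp add: size_bias_gap_def ring_distribs mult.commute)
qed

text \<open>The gap vanishes for polynomials in \<open>exp (- x)\<close> and is bounded by a multiple of the supremum
  norm on the positive half line, so that the Weierstrass theorem extends this to all continuous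
  functions of \<open>exp (- x)\<close>.\<close>

lemma size_bias_gap_continuous_exp:
  assumes cont: "continuous_on {0..1} \<phi>"
    and [measurable]: "(\<lambda>x::real. \<phi> (exp (- x)) :: real) \<in> borel_measurable borel"
  shows "size_bias_gap (\<lambda>x. \<phi> (exp (- x))) = 0"
proof -
  let ?K = "expectation A + (LINT x|N. Y x)"
  have K: "0 \<le> ?K"
    using A_nonneg Y_nonneg by (auto intro!: add_nonneg_nonneg Bochner_Integration.integral_nonneg)
  have "\<bar>size_bias_gap (\<lambda>x. \<phi> (exp (- x)))\<bar> \<le> e" if e: "0 < e" for e
  proof -
    define d where "d = e / (?K + 1)"
    have d: "0 < d" "d * ?K \<le> e"
      using e K by (auto simp: d_def field_simps)
    obtain g where "real_polynomial_function g" and g: "\<And>x. x \<in> {0..1} \<Longrightarrow> \<bar>\<phi> x - g x\<bar> < d"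
      using Stone_Weierstrass_real_polynomial_function[OF compact_Icc cont d(1)] by metis
    then obtain a n where g_eq: "g = (\<lambda>x. \<Sum>i\<le>n. a i * x ^ i)"
      using real_polynomial_function_iff_sum by blast
    have bound_g: "\<bar>g (exp (- x))\<bar> \<le> (\<Sum>i\<le>n. \<bar>a i\<bar>)" if "0 \<le> x" for x
      unfolding g_eq by (rule order_trans[OF sum_abs sum_mono])
       (use that in \<open>auto simp: abs_mult power_le_one intro!: mult_left_le\<close>)
    have [measurable]: "(\<lambda>x. g (exp (- x))) \<in> borel_measurable borel"
      unfolding g_eq by measurable
    have close: "\<bar>\<phi> (exp (- x)) - g (exp (- x))\<bar> \<le> d" if "0 \<le> x" for x
      using g[of "exp (- x)"] that by auto
    have "size_bias_gap (\<lambda>x. (\<phi> (exp (- x)) - g (exp (- x))) + g (exp (- x)))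
        = size_bias_gap (\<lambda>x. \<phi> (exp (- x)) - g (exp (- x))) + size_bias_gap (\<lambda>x. g (exp (- x)))"
      by (rule size_bias_gap_add[OF _ _ close bound_g]) auto
    also have "size_bias_gap (\<lambda>x. g (exp (- x))) = 0"
      unfolding g_eq by (rule size_bias_gap_polynomial)
    finally have "\<bar>size_bias_gap (\<lambda>x. \<phi> (exp (- x)))\<bar> \<le> d * ?K"
      using size_bias_gap_bound[OF _ close] by simp
    then show ?thesis using d by linarith
  qed
  then show ?thesis
    by (meson abs_le_zero_iff field_le_epsilon add_0 dense_ge)
qed

lemma size_bias_gap_limit:
  assumes [measurable]: "f \<in> borel_measurable borel" "\<And>n. F n \<in> borel_measurable borel"
    and lim: "\<And>x. 0 \<le> x \<Longrightarrow> (\<lambda>n. F n x) \<longlonglongrightarrow> f x"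
    and bound: "\<And>n x. 0 \<le> x \<Longrightarrow> \<bar>F n x\<bar> \<le> G x"
    and [measurable]: "G \<in> borel_measurable borel"
    and int: "integrable M (\<lambda>\<omega>. A \<omega> * G (A \<omega>))"
      "integrable (N \<Otimes>\<^sub>M M) (\<lambda>p. Y (fst p) * G (Y (fst p) + A (snd p)))"
    and zero: "\<And>n. size_bias_gap (F n) = 0"
  shows "size_bias_gap f = 0"
proof -
  have "(\<lambda>n. LINT \<omega>|M. A \<omega> * F n (A \<omega>)) \<longlonglongrightarrow> (LINT \<omega>|M. A \<omega> * f (A \<omega>))"
    by (rule integral_dominated_convergence[OF _ _ int(1)])
       (use A_nonneg in \<open>auto simp: abs_mult intro!: mult_left_mono bound tendsto_mult lim\<close>)
  moreover have "(\<lambda>n. LINT p|(N \<Otimes>\<^sub>M M). Y (fst p) * F n (Y (fst p) + A (snd p)))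
      \<longlonglongrightarrow> (LINT p|(N \<Otimes>\<^sub>M M). Y (fst p) * f (Y (fst p) + A (snd p)))"
    by (rule integral_dominated_convergence[OF _ _ int(2)])
       (use A_nonneg Y_nonneg in \<open>auto simp: abs_mult intro!: mult_left_mono bound tendsto_mult lim add_nonneg_nonneg\<close>)
  ultimately have "(\<lambda>n. size_bias_gap (F n)) \<longlonglongrightarrow> size_bias_gap f"
    unfolding size_bias_gap_def by (rule tendsto_diff)
  then show ?thesis
    using zero LIMSEQ_unique[of "\<lambda>_. 0 :: real"] by simp
qed

text \<open>Cut off at \<open>n + 1\<close>, a continuous function of \<open>x\<close> is a continuous function of \<open>exp (- x)\<close> on
  the whole unit interval: it vanishes near 0.\<close>

lemma size_bias_gap_bounded_continuous:
  assumes f: "continuous_on UNIV f" and bound: "\<And>x. \<bar>f x\<bar> \<le> B"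
  shows "size_bias_gap f = 0"
proof (rule size_bias_gap_limit)
  have [measurable]: "f \<in> borel_measurable borel"
    using f by (rule borel_measurable_continuous_onI)
  define \<kappa> where "\<kappa> = (\<lambda>(n::nat) (x::real). max 0 (min 1 (real n + 1 - x)))"
  show "f \<in> borel_measurable borel" "(\<lambda>x. f x * \<kappa> n x) \<in> borel_measurable borel" for n
    by (auto simp: \<kappa>_def)
  show "(\<lambda>n. f x * \<kappa> n x) \<longlonglongrightarrow> f x" for x
  proof (rule tendsto_eventually)
    obtain k :: nat where "x \<le> k" using real_arch_simple by blast
    then show "eventually (\<lambda>n. f x * \<kappa> n x = f x) sequentially"
      by (intro eventually_sequentiallyI[of k]) (auto simp: \<kappa>_def)
  qed
  show "\<bar>f x * \<kappa> n x\<bar> \<le> B" for n x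
    using bound[of x] mult_mono[of "\<bar>f x\<bar>" B "\<bar>\<kappa> n x\<bar>" 1] by (auto simp: \<kappa>_def abs_mult)
  have B: "0 \<le> B" using bound[of 0] by linarith
  show "integrable M (\<lambda>\<omega>. A \<omega> * B)" "integrable (N \<Otimes>\<^sub>M M) (\<lambda>p. Y (fst p) * B)"
    using integrable_times_bounded[of "\<lambda>_. B" B] B by auto
  fix n
  define \<phi> where "\<phi> = (\<lambda>u. if u < exp (- (real n + 2)) then 0 else f (- ln u) * \<kappa> n (- ln u))"
  have \<phi>_exp: "\<phi> (exp (- x)) = f x * \<kappa> n x" for x
    by (auto simp: \<phi>_def \<kappa>_def)
  have "size_bias_gap (\<lambda>x. \<phi> (exp (- x))) = 0"
  proof (rule size_bias_gap_continuous_exp)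
    show "(\<lambda>x. \<phi> (exp (- x))) \<in> borel_measurable borel"
      unfolding \<phi>_exp by (auto simp: \<kappa>_def)
    let ?a = "exp (- (real n + 2))" and ?b = "exp (- (real n + 1))"
    have ab: "?a < ?b" by simp
    have "continuous_on ({0..?b} \<union> {?b..1}) \<phi>"
    proof (rule continuous_on_closed_Un)
      have zero: "\<phi> u = 0" if "u \<le> ?b" for u
      proof (cases "u < ?a")
        case False
        then have u: "0 < u" using exp_gt_zero[of "- (real n + 2)"] by linarith
        have "ln u \<le> ln ?b" using that u by (subst ln_le_cancel_iff) auto
        then show ?thesis by (simp add: \<phi>_def \<kappa>_def)
      qed (simp add: \<phi>_def)
      show "continuous_on {0..?b} \<phi>"
        by (rule continuous_on_eq[where f = "\<lambda>_. 0"]) (use zero in auto)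
      have "continuous_on {?b..1} (\<lambda>u. f (- ln u) * \<kappa> n (- ln u))"
      proof -
        have pos: "u \<noteq> 0" if "u \<in> {?b..1}" for u
          using that exp_gt_zero[of "- (real n + 1)"] by auto
        show ?thesis
          unfolding \<kappa>_def
          by (intro continuous_intros continuous_on_compose2[OF f]) (use pos in auto)
      qed
      then show "continuous_on {?b..1} \<phi>"
      proof (rule continuous_on_eq)
        fix u assume "u \<in> {?b..1}"
        then have "\<not> u < ?a" using ab unfolding atLeastAtMost_iff by linarith
        then show "f (- ln u) * \<kappa> n (- ln u) = \<phi> u" by (simp add: \<phi>_def)
      qed
    qed auto
    moreover have "{0..?b} \<union> {?b..1} = {0..1}" by (rule ivl_disj_un_two_touch) auto
    ultimately show "continuous_on {0..1} \<phi>" by simp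
  qed
  then show "size_bias_gap (\<lambda>x. f x * \<kappa> n x) = 0"
    by (simp only: \<phi>_exp)
qed auto

lemma expectation_A: "expectation A = (LINT x|N. Y x)"
  using size_bias_gap_bounded_continuous[of "\<lambda>_. 1" 1] integrable_fst(2)[OF integrable_Y]
  by (simp add: size_bias_gap_def)

text \<open>The Mecke formula for \<open>f x = \<bar>x\<bar>\<close>, the limit of its truncations, gives the second moment of
  \<open>A\<close>. The mean is the case \<open>f x = 1\<close>.\<close>

lemma variance_eq_second_moment:
  assumes A2: "integrable M (\<lambda>\<omega>. (A \<omega>)\<^sup>2)" and Y2: "integrable N (\<lambda>x. (Y x)\<^sup>2)"
  shows "(LINT \<omega>|M. (A \<omega> - expectation A)\<^sup>2) = (LINT x|N. (Y x)\<^sup>2)"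
proof -
  have YA: "integrable (N \<Otimes>\<^sub>M M) (\<lambda>p. Y (fst p) * A (snd p))"
    "(LINT p|(N \<Otimes>\<^sub>M M). Y (fst p) * A (snd p)) = (LINT x|N. Y x) * expectation A"
    using integrable_product[OF integrable_Y integrable_A] by auto
  note YY = integrable_fst[OF Y2]
  have split: "(\<lambda>p. Y (fst p) * \<bar>Y (fst p) + A (snd p)\<bar>) = (\<lambda>p. (Y (fst p))\<^sup>2 + Y (fst p) * A (snd p))"
    using Y_nonneg A_nonneg by (auto simp: power2_eq_square ring_distribs fun_eq_iff)
  have split_A: "(\<lambda>\<omega>. A \<omega> * \<bar>A \<omega>\<bar>) = (\<lambda>\<omega>. (A \<omega>)\<^sup>2)"
    using A_nonneg by (auto simp: power2_eq_square)
  have "size_bias_gap abs = 0"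
  proof (rule size_bias_gap_limit)
    show "size_bias_gap (\<lambda>x. min \<bar>x\<bar> (real n)) = 0" for n
      by (rule size_bias_gap_bounded_continuous[where B = "real n"]) (auto intro!: continuous_intros)
    show "(\<lambda>n. min \<bar>x\<bar> (real n)) \<longlonglongrightarrow> \<bar>x\<bar>" for x
    proof (rule tendsto_eventually)
      obtain k :: nat where "\<bar>x\<bar> \<le> k" using real_arch_simple by blast
      then show "eventually (\<lambda>n. min \<bar>x\<bar> (real n) = \<bar>x\<bar>) sequentially"
        by (intro eventually_sequentiallyI[of k]) auto
    qed
    show "integrable (N \<Otimes>\<^sub>M M) (\<lambda>p. Y (fst p) * \<bar>Y (fst p) + A (snd p)\<bar>)"
      unfolding split using YA YY by simp
    show "integrable M (\<lambda>\<omega>. A \<omega> * \<bar>A \<omega>\<bar>)"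
      unfolding split_A by (rule A2)
  qed auto
  then have "(LINT \<omega>|M. (A \<omega>)\<^sup>2) = (LINT x|N. (Y x)\<^sup>2) + (LINT x|N. Y x) * expectation A"
    unfolding size_bias_gap_def split split_A using YA YY by simp
  moreover have "(LINT \<omega>|M. (A \<omega> - expectation A)\<^sup>2) = (LINT \<omega>|M. (A \<omega>)\<^sup>2) - (expectation A)\<^sup>2"
    by (rule variance_eq[OF integrable_A A2])
  ultimately show ?thesis
    by (simp add: expectation_A power2_eq_square)
qed

text \<open>By the Mecke formula the mean of \<open>Z * f Z\<close> is the integral over \<open>N\<close> of \<open>Y / \<sigma>\<close> times the
  mean of \<open>f (Z + Y / \<sigma>) - f Z\<close>. The first-order term of the Taylor expansion integrates to the
  mean of \<open>f' Z\<close>, because the squares of \<open>Y / \<sigma>\<close> have integral 1. What is left of the mean of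
  \<open>f' Z - Z * f Z\<close>, which is the difference to estimate, is the remainder, of third order in
  \<open>Y / \<sigma>\<close>.\<close>

lemma stein_bound_smooth:
  fixes h h' :: "real \<Rightarrow> real"
  assumes A2: "integrable M (\<lambda>\<omega>. (A \<omega>)\<^sup>2)" and Y2: "integrable N (\<lambda>x. (Y x)\<^sup>2)" and Y3: "integrable N (\<lambda>x. (Y x) ^ 3)"
    and pos: "0 < \<sigma>" and \<sigma>: "\<sigma>\<^sup>2 = (LINT x|N. (Y x)\<^sup>2)"
    and h: "\<And>x. (h has_real_derivative h' x) (at x)" and h': "\<And>x. \<bar>h' x\<bar> \<le> 1"
  shows "\<bar>(LINT \<omega>|M. h ((A \<omega> - expectation A) / \<sigma>)) - (LINT x|std_normal_distribution. h x)\<bar>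
    \<le> 9 * (LINT x|N. (Y x) ^ 3) / \<sigma> ^ 3"
proof -
  obtain f f' f'' where f: "\<And>x. (f has_real_derivative f' x) (at x)"
    and f': "\<And>x. (f' has_real_derivative f'' x) (at x)"
    and stein: "\<And>x. f' x - x * f x = h x - (LINT x|std_normal_distribution. h x)"
    and f8: "\<And>x. \<bar>f x\<bar> \<le> 8" and f''18: "\<And>x. \<bar>f'' x\<bar> \<le> 18"
    using stein_solution[OF h h'] by metis
  have cont_f: "continuous_on UNIV f"
    using f by (meson DERIV_isCont continuous_at_imp_continuous_on)
  have cont_f': "continuous_on UNIV f'"
    using f' by (meson DERIV_isCont continuous_at_imp_continuous_on)
  have [measurable]: "f \<in> borel_measurable borel" "f' \<in> borel_measurable borel"
    using cont_f cont_f' by (auto intro: borel_measurable_continuous_onI)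
  have [measurable]: "h \<in> borel_measurable borel"
    using h by (intro borel_measurable_continuous_onI) (meson DERIV_isCont continuous_at_imp_continuous_on)
  have f'_growth: "\<bar>f' x\<bar> \<le> \<bar>f' 0\<bar> + 18 * \<bar>x\<bar>" for x
    using field_differentiable_bound[of UNIV f' f'' 18 x 0] f' f''18 by auto
  have remainder: "\<bar>f (z + y) - f z - y * f' z\<bar> \<le> 9 * y\<^sup>2" if "0 \<le> y" for z y
  proof (cases "y = 0")
    case False
    then have y: "0 < y" using that by simp
    have "\<exists>t. z < t \<and> t < z + y \<and> f (z + y) = f z + f' z * y + f'' t / 2 * y\<^sup>2"
    proof -
      let ?d = "\<lambda>n::nat. if n = 0 then f else if n = 1 then f' else f''"
      have d: "\<forall>m t. m < 2 \<and> z \<le> t \<and> t \<le> z + y \<longrightarrow> (?d m has_real_derivative ?d (Suc m) t) (at t)"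
        using f f' by (auto simp: less_2_cases_iff)
      show ?thesis
        using Taylor_up[of 2 ?d f z "z + y" z, OF _ _ d] y by (auto simp: numeral_2_eq_2 lessThan_Suc algebra_simps)
    qed
    then obtain t where t: "f (z + y) - f z - y * f' z = f'' t / 2 * y\<^sup>2" by (auto simp: algebra_simps)
    have "\<bar>f'' t / 2 * y\<^sup>2\<bar> \<le> 9 * y\<^sup>2"
      using mult_right_mono[OF f''18[of t], of "y\<^sup>2"] by (simp add: abs_mult)
    then show ?thesis by (simp only: t)
  qed simp
  define \<mu> where "\<mu> = expectation A"
  define Z where "Z = (\<lambda>a. (a - \<mu>) / \<sigma>)"
  have Z_shift: "Z (y + a) = Z a + y / \<sigma>" for y a
    by (simp add: Z_def add_divide_distrib diff_divide_distrib)
  have int_fZ: "integrable M (\<lambda>\<omega>. f (Z (A \<omega>)))"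
    by (rule integrable_const_bound[where B = 8]) (use f8 in \<open>auto simp: Z_def\<close>)
  have int_f'Z: "integrable M (\<lambda>\<omega>. f' (Z (A \<omega>)))"
  proof (rule Bochner_Integration.integrable_bound)
    show "integrable M (\<lambda>\<omega>. \<bar>f' 0\<bar> + 18 * \<bar>Z (A \<omega>)\<bar>)"
      using integrable_A by (simp add: Z_def)
    show "AE \<omega> in M. norm (f' (Z (A \<omega>))) \<le> norm (\<bar>f' 0\<bar> + 18 * \<bar>Z (A \<omega>)\<bar>)"
      using f'_growth by (intro AE_I2) (auto intro: order_trans)
  qed (simp add: Z_def)
  have fZ_cont: "continuous_on UNIV (\<lambda>a. f (Z a))"
    unfolding Z_def by (intro continuous_on_compose2[OF cont_f] continuous_intros) (use pos in auto)
  have [measurable]: "(\<lambda>a. f (Z a)) \<in> borel_measurable borel"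
    using fZ_cont by (rule borel_measurable_continuous_onI)
  note int_bias = integrable_times_bounded[of "\<lambda>a. f (Z a)" 8, OF _ f8, simplified]
  have bias: "(LINT \<omega>|M. A \<omega> * f (Z (A \<omega>))) = (LINT p|(N \<Otimes>\<^sub>M M). Y (fst p) * f (Z (Y (fst p) + A (snd p))))"
    using size_bias_gap_bounded_continuous[OF fZ_cont f8] by (simp add: size_bias_gap_def)
  note int1 = integrable_product[OF integrable_Y int_fZ]
  note int2 = integrable_product[OF Y2 int_f'Z]
  note int3 = integrable_fst[OF Y3]
  let ?R = "\<lambda>p. Y (fst p) * f (Z (Y (fst p) + A (snd p))) / \<sigma> - Y (fst p) * f (Z (A (snd p))) / \<sigma>
    - (Y (fst p))\<^sup>2 * f' (Z (A (snd p))) / \<sigma>\<^sup>2"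
  have "(LINT \<omega>|M. Z (A \<omega>) * f (Z (A \<omega>))) = (LINT \<omega>|M. (A \<omega> * f (Z (A \<omega>)) - \<mu> * f (Z (A \<omega>))) / \<sigma>)"
    by (simp add: Z_def ring_distribs diff_divide_distrib)
  also have "\<dots> = ((LINT \<omega>|M. A \<omega> * f (Z (A \<omega>))) - \<mu> * (LINT \<omega>|M. f (Z (A \<omega>)))) / \<sigma>"
    using int_bias int_fZ by simp
  finally have EZf: "(LINT \<omega>|M. Z (A \<omega>) * f (Z (A \<omega>))) = \<dots>" .
  have intR: "integrable (N \<Otimes>\<^sub>M M) ?R"
    using int_bias int1(1) int2(1) by simp
  have "(LINT p|(N \<Otimes>\<^sub>M M). ?R p) = (LINT \<omega>|M. A \<omega> * f (Z (A \<omega>))) / \<sigma> - \<mu> * (LINT \<omega>|M. f (Z (A \<omega>))) / \<sigma>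
      - (LINT \<omega>|M. f' (Z (A \<omega>)))"
    using int_bias int1 int2 pos by (simp add: bias \<mu>_def expectation_A flip: \<sigma>)
  then have R_eq: "(LINT p|(N \<Otimes>\<^sub>M M). ?R p) = (LINT \<omega>|M. Z (A \<omega>) * f (Z (A \<omega>))) - (LINT \<omega>|M. f' (Z (A \<omega>)))"
    by (simp add: EZf diff_divide_distrib)
  have int_Zf: "integrable M (\<lambda>\<omega>. Z (A \<omega>) * f (Z (A \<omega>)))"
    unfolding Z_def using int_bias int_fZ by (simp add: Z_def ring_distribs left_diff_distrib)
  have "(LINT \<omega>|M. h (Z (A \<omega>))) - (LINT x|std_normal_distribution. h x)
      = (LINT \<omega>|M. f' (Z (A \<omega>)) - Z (A \<omega>) * f (Z (A \<omega>)))"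
  proof -
    have "h (Z (A \<omega>)) = (f' (Z (A \<omega>)) - Z (A \<omega>) * f (Z (A \<omega>))) + (LINT x|std_normal_distribution. h x)" for \<omega>
      using stein[of "Z (A \<omega>)"] by simp
    then show ?thesis
      using int_f'Z int_Zf by (simp add: prob_space)
  qed
  also have "\<dots> = - (LINT p|(N \<Otimes>\<^sub>M M). ?R p)"
    unfolding R_eq using int_f'Z int_Zf by simp
  also have "\<bar>\<dots>\<bar> \<le> (LINT p|(N \<Otimes>\<^sub>M M). 9 * (Y (fst p)) ^ 3 / \<sigma> ^ 3)"
    unfolding abs_minus
  proof (rule abs_integral_le[OF intR])
    show "integrable (N \<Otimes>\<^sub>M M) (\<lambda>p. 9 * Y (fst p) ^ 3 / \<sigma> ^ 3)"
      using int3 by simp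
    fix p
    let ?y = "Y (fst p)" and ?z = "Z (A (snd p))"
    have "?R p = ?y / \<sigma> * (f (?z + ?y / \<sigma>) - f ?z - ?y / \<sigma> * f' ?z)"
      by (simp add: Z_shift ring_distribs power2_eq_square)
    also have "\<bar>\<dots>\<bar> \<le> ?y / \<sigma> * (9 * (?y / \<sigma>)\<^sup>2)"
      using remainder[of "?y / \<sigma>" ?z] pos Y_nonneg by (auto simp: abs_mult intro!: mult_left_mono divide_right_mono)
    also have "\<dots> = 9 * ?y ^ 3 / \<sigma> ^ 3"
      by (simp add: power2_eq_square power3_eq_cube mult_ac)
    finally show "\<bar>?R p\<bar> \<le> 9 * ?y ^ 3 / \<sigma> ^ 3" .
  qed
  also have "\<dots> = 9 * (LINT x|N. (Y x) ^ 3) / \<sigma> ^ 3"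
    using int3 by simp
  finally show ?thesis by (simp add: Z_def \<mu>_def)
qed

text \<open>A Lipschitz function is within \<open>e / 2\<close> of a smooth one, at the cost of \<open>e / 2\<close> in each of the two
  means.\<close>

theorem wasserstein_normal_bound:
  assumes A2: "integrable M (\<lambda>\<omega>. (A \<omega>)\<^sup>2)" and Y2: "integrable N (\<lambda>x. (Y x)\<^sup>2)" and Y3: "integrable N (\<lambda>x. (Y x) ^ 3)"
    and pos: "0 < std_dev M A"
  shows "wasserstein (distr M borel (standardize M A)) std_normal_distribution
    \<le> ennreal (9 * (LINT x|N. (Y x) ^ 3) / std_dev M A ^ 3)"
  unfolding wasserstein_def
proof (rule SUP_least, rule ennreal_leI)
  fix h :: "real \<Rightarrow> real" assume "h \<in> {h. 1-lipschitz_on UNIV h}"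
  then have h: "1-lipschitz_on UNIV h" by simp
  interpret S: prob_space std_normal_distribution
    by (rule prob_space_normal_density) simp
  note total = std_normal_total and int_S = integrable_std_normal_abs
  let ?Z = "standardize M A" and ?\<sigma> = "std_dev M A"
  let ?b = "9 * (LINT x|N. (Y x) ^ 3) / ?\<sigma> ^ 3"
  have \<sigma>: "?\<sigma>\<^sup>2 = (LINT x|N. (Y x)\<^sup>2)"
    unfolding std_dev_def variance_eq_second_moment[OF A2 Y2] by (simp add: real_sqrt_pow2)
  have Z: "?Z = (\<lambda>\<omega>. (A \<omega> - expectation A) / ?\<sigma>)"
    by (simp add: standardize_def fun_eq_iff)
  have [measurable]: "?Z \<in> borel_measurable M" unfolding Z by measurable
  have int_Z: "integrable M (\<lambda>\<omega>. \<bar>?Z \<omega>\<bar>)"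
    unfolding Z using integrable_A by simp
  have cont: "continuous_on UNIV h"
    by (rule lipschitz_on_continuous_on[OF h])
  have [measurable]: "h \<in> borel_measurable borel"
    using cont by (rule borel_measurable_continuous_onI)
  have growth: "\<bar>h x\<bar> \<le> \<bar>h 0\<bar> + \<bar>x\<bar>" for x
    using lipschitz_onD[OF h, of x 0] by (simp add: dist_real_def)
  have hZ: "integrable M (\<lambda>\<omega>. h (?Z \<omega>))"
    by (rule Bochner_Integration.integrable_bound[where f = "\<lambda>\<omega>. \<bar>h 0\<bar> + \<bar>?Z \<omega>\<bar>"])
       (use int_Z growth in \<open>auto intro: order_trans\<close>)
  have hS: "integrable std_normal_distribution h"
    by (rule Bochner_Integration.integrable_bound[where f = "\<lambda>x. \<bar>h 0\<bar> + \<bar>x\<bar>"])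
       (use int_S growth in \<open>auto intro: order_trans\<close>)
  have "\<bar>(LINT \<omega>|M. h (?Z \<omega>)) - (LINT x|std_normal_distribution. h x)\<bar> \<le> ?b + e" if "0 < e" for e
  proof -
    have e2: "0 < e / 2" using that by simp
    obtain g g' where g: "\<And>x. (g has_real_derivative g' x) (at x)" "\<And>x. \<bar>g' x\<bar> \<le> 1"
      and close: "\<And>x. \<bar>g x - h x\<bar> \<le> e / 2"
      using lipschitz_smooth_approximation[OF h e2] by metis
    have [measurable]: "g \<in> borel_measurable borel"
      using g by (intro borel_measurable_continuous_onI) (meson DERIV_isCont continuous_at_imp_continuous_on)
    have gh_Z: "integrable M (\<lambda>\<omega>. g (?Z \<omega>) - h (?Z \<omega>))"
      by (rule integrable_const_bound[where B = "e / 2"]) (use close in auto)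
    have gh_S: "integrable std_normal_distribution (\<lambda>x. g x - h x)"
      by (rule S.integrable_const_bound[where B = "e / 2"]) (use close in auto)
    have "\<bar>LINT \<omega>|M. g (?Z \<omega>) - h (?Z \<omega>)\<bar> \<le> (LINT \<omega>|M. e / 2)"
      by (rule abs_integral_le[OF gh_Z]) (use close in auto)
    moreover have "\<bar>LINT x|std_normal_distribution. g x - h x\<bar> \<le> (LINT x|std_normal_distribution. e / 2)"
      by (rule abs_integral_le[OF gh_S]) (use close in auto)
    moreover have "(LINT \<omega>|M. g (?Z \<omega>)) = (LINT \<omega>|M. g (?Z \<omega>) - h (?Z \<omega>)) + (LINT \<omega>|M. h (?Z \<omega>))"
      using Bochner_Integration.integral_add[OF gh_Z hZ] by simp
    moreover have "(LINT x|std_normal_distribution. g x)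
        = (LINT x|std_normal_distribution. g x - h x) + (LINT x|std_normal_distribution. h x)"
      using Bochner_Integration.integral_add[OF gh_S hS] by simp
    moreover have "\<bar>(LINT \<omega>|M. g (?Z \<omega>)) - (LINT x|std_normal_distribution. g x)\<bar> \<le> ?b"
      unfolding Z by (rule stein_bound_smooth[OF A2 Y2 Y3 pos \<sigma> g])
    ultimately show ?thesis
      by (simp add: prob_space total)
  qed
  then have "\<bar>(LINT \<omega>|M. h (?Z \<omega>)) - (LINT x|std_normal_distribution. h x)\<bar> \<le> ?b"
    by (rule field_le_epsilon)
  then show "\<bar>(LINT x|distr M borel ?Z. h x) - (LINT x|std_normal_distribution. h x)\<bar> \<le> ?b"
    by (simp add: integral_distr)
qed

end

text \<open>A Lipschitz function moves by at most \<open>\<bar>x\<bar>\<close> from its value at 0, and both laws have first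
  absolute moment at most 1.\<close>

lemma wasserstein_standardized_le_two:
  assumes "prob_space M" and A: "integrable M A" and A2: "integrable M (\<lambda>\<omega>. (A \<omega>)\<^sup>2)"
    and pos: "0 < std_dev M A"
  shows "wasserstein (distr M borel (standardize M A)) std_normal_distribution \<le> 2"
proof -
  interpret prob_space M by fact
  interpret S: prob_space std_normal_distribution
    by (rule prob_space_normal_density) simp
  note total = std_normal_total and int_S = integrable_std_normal_abs and E_S = std_normal_abs_le_one
  let ?Z = "standardize M A" and ?\<sigma> = "std_dev M A"
  have Z: "?Z = (\<lambda>\<omega>. (A \<omega> - expectation A) / ?\<sigma>)"
    by (simp add: standardize_def fun_eq_iff)
  have meas_A [measurable]: "A \<in> borel_measurable M" using A by simp
  have [measurable]: "?Z \<in> borel_measurable M" unfolding Z by measurable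
  have int_Z: "integrable M (\<lambda>\<omega>. \<bar>?Z \<omega>\<bar>)"
    unfolding Z using A by simp
  have int_A2: "integrable M (\<lambda>\<omega>. (A \<omega> - expectation A)\<^sup>2)"
    using A A2 by (simp add: power2_diff)
  then have int_Z2: "integrable M (\<lambda>\<omega>. (?Z \<omega>)\<^sup>2)"
    unfolding Z by (simp add: power_divide)
  have sq: "?\<sigma>\<^sup>2 = (LINT \<omega>|M. (A \<omega> - expectation A)\<^sup>2)"
    unfolding std_dev_def by (simp add: real_sqrt_pow2)
  have Z2: "(LINT \<omega>|M. (?Z \<omega>)\<^sup>2) = 1"
    unfolding Z using pos by (simp add: power_divide flip: sq)
  have "(LINT \<omega>|M. \<bar>?Z \<omega>\<bar>) \<le> (LINT \<omega>|M. (1 + (?Z \<omega>)\<^sup>2) / 2)"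
  proof (rule integral_mono)
    fix \<omega>
    show "\<bar>?Z \<omega>\<bar> \<le> (1 + (?Z \<omega>)\<^sup>2) / 2"
      using zero_le_power2[of "\<bar>?Z \<omega>\<bar> - 1"] by (simp add: power2_diff)
  qed (use int_Z int_Z2 in auto)
  then have E_Z: "(LINT \<omega>|M. \<bar>?Z \<omega>\<bar>) \<le> 1"
    using int_Z2 Z2 by (simp add: prob_space)
  have "ennreal \<bar>(LINT x|distr M borel ?Z. h x) - (LINT x|std_normal_distribution. h x)\<bar> \<le> ennreal 2"
    if h: "1-lipschitz_on UNIV h" for h :: "real \<Rightarrow> real"
  proof (rule ennreal_leI)
    have [measurable]: "h \<in> borel_measurable borel"
      using lipschitz_on_continuous_on[OF h] by (rule borel_measurable_continuous_onI)
    have lip: "\<bar>h x - h 0\<bar> \<le> \<bar>x\<bar>" for x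
      using lipschitz_onD[OF h, of x 0] by (simp add: dist_real_def)
    have int1: "integrable M (\<lambda>\<omega>. h (?Z \<omega>) - h 0)"
      by (rule Bochner_Integration.integrable_bound[OF int_Z]) (use lip in auto)
    have int2: "integrable std_normal_distribution (\<lambda>x. h x - h 0)"
      by (rule Bochner_Integration.integrable_bound[OF int_S]) (use lip in auto)
    have "\<bar>LINT \<omega>|M. h (?Z \<omega>) - h 0\<bar> \<le> (LINT \<omega>|M. \<bar>?Z \<omega>\<bar>)"
      by (rule abs_integral_le[OF int1 int_Z]) (rule lip)
    moreover have "\<bar>LINT x|std_normal_distribution. h x - h 0\<bar> \<le> (LINT x|std_normal_distribution. \<bar>x\<bar>)"
      by (rule abs_integral_le[OF int2 int_S]) (rule lip)
    moreover have "(LINT \<omega>|M. h (?Z \<omega>)) = (LINT \<omega>|M. h (?Z \<omega>) - h 0) + h 0"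
      using Bochner_Integration.integral_add[OF int1, of "\<lambda>_. h 0"] by (simp add: prob_space)
    moreover have "(LINT x|std_normal_distribution. h x) = (LINT x|std_normal_distribution. h x - h 0) + h 0"
      using Bochner_Integration.integral_add[OF int2, of "\<lambda>_. h 0"] by (simp add: total)
    ultimately have "\<bar>(LINT \<omega>|M. h (?Z \<omega>)) - (LINT x|std_normal_distribution. h x)\<bar> \<le> 2"
      using E_Z E_S by linarith
    then show "\<bar>(LINT x|distr M borel ?Z. h x) - (LINT x|std_normal_distribution. h x)\<bar> \<le> 2"
      by (simp add: integral_distr)
  qed
  then show ?thesis
    unfolding wasserstein_def by (intro SUP_least) auto
qed

section \<open>The Laplace functional of a Poisson random measure\<close>

text \<open>Exponentials of possibly infinite sums: with the value 0 at infinity, Laplace transforms can be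
  computed before anything is known about finiteness.\<close>

definition lexp :: "ennreal \<Rightarrow> real" where
  "lexp x = (if x = \<top> then 0 else exp (- enn2real x))"

lemma lexp_ennreal: "0 \<le> r \<Longrightarrow> lexp (ennreal r) = exp (- r)"
  by (simp add: lexp_def)

lemma lexp_top [simp]: "lexp \<top> = 0" and lexp_zero [simp]: "lexp 0 = 1"
  by (simp_all add: lexp_def)

lemma lexp_nonneg [simp]: "0 \<le> lexp x"
  by (simp add: lexp_def)

lemma lexp_le_one [simp]: "lexp x \<le> 1"
  by (simp add: lexp_def)

lemma lexp_add: "lexp (x + y) = lexp x * lexp y"
  by (cases x; cases y) (simp_all add: lexp_ennreal mult_exp_exp flip: ennreal_plus)

lemma lexp_sum: "lexp (\<Sum>i\<in>I. f i) = (\<Prod>i\<in>I. lexp (f i))"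
  by (induction I rule: infinite_finite_induct) (simp_all add: lexp_add)

lemma lexp_antimono: "x \<le> y \<Longrightarrow> lexp y \<le> lexp x"
  by (auto simp: lexp_def top_unique less_top intro: enn2real_mono)

lemma measurable_lexp [measurable]: "lexp \<in> borel_measurable borel"
  unfolding lexp_def[abs_def] by measurable

lemma tendsto_lexp:
  assumes "(X \<longlongrightarrow> L) F"
  shows "((\<lambda>n. lexp (X n)) \<longlongrightarrow> lexp L) F"
proof (cases L)
  case (real l)
  have "eventually (\<lambda>n. X n < \<top>) F"
    using real by (intro order_tendstoD(2)[OF assms]) auto
  then have eq: "eventually (\<lambda>n. exp (- enn2real (X n)) = lexp (X n)) F"
    by eventually_elim (simp add: lexp_def)
  have "((\<lambda>n. exp (- enn2real (X n))) \<longlongrightarrow> exp (- l)) F"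
    using assms real by (intro tendsto_exp tendsto_minus tendsto_enn2real) auto
  then show ?thesis
    using Lim_transform_eventually[OF _ eq] real by (simp add: lexp_ennreal)
next
  case top
  have "((\<lambda>n. lexp (X n)) \<longlongrightarrow> 0) F"
  proof (rule order_tendstoI)
    fix e :: real assume e: "0 < e"
    have "eventually (\<lambda>n. ennreal (max 0 (1 - ln e)) < X n) F"
      using top by (intro order_tendstoD(1)[OF assms]) auto
    then show "eventually (\<lambda>n. lexp (X n) < e) F"
    proof eventually_elim
      case (elim n)
      have "lexp (X n) \<le> lexp (ennreal (max 0 (1 - ln e)))"
        using elim by (intro lexp_antimono) simp
      also have "\<dots> \<le> exp (ln e - 1)"
        by (subst lexp_ennreal) auto
      also have "\<dots> < e"
        using e by (simp add: exp_diff field_simps)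
      finally show ?case .
    qed
  next
    fix e :: real assume "e < 0"
    then show "eventually (\<lambda>n. e < lexp (X n)) F"
      by (intro always_eventually allI less_le_trans[OF _ lexp_nonneg])
  qed
  then show ?thesis using top by simp
qed

lemma one_minus_lexp_le: "ennreal (1 - lexp x) \<le> x"
proof (cases x)
  case (real r)
  then show ?thesis
    using exp_ge_add_one_self[of "- r"] by (simp add: lexp_ennreal ennreal_leI)
qed simp

locale poisson_point_process = prob_space M
  for M :: "'w measure" and \<nu> :: "'a::topological_space measure" and \<eta> :: "'w \<Rightarrow> 'a measure" +
  assumes prm: "poisson_random_measure M \<nu> \<eta>" and sets_\<nu>: "sets \<nu> = sets borel"
begin

lemma sets_\<eta>: "\<omega> \<in> space M \<Longrightarrow> sets (\<eta> \<omega>) = sets borel"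
  using prm unfolding poisson_random_measure_def by blast

lemma measurable_count [measurable]: "A \<in> sets borel \<Longrightarrow> (\<lambda>\<omega>. emeasure (\<eta> \<omega>) A) \<in> borel_measurable M"
  using prm unfolding poisson_random_measure_def by blast

lemma count_law:
  assumes [measurable]: "A \<in> sets borel" and fin: "emeasure \<nu> A < \<infinity>"
    and [measurable]: "\<phi> \<in> borel_measurable borel"
  shows "(\<integral>\<^sup>+\<omega>. \<phi> (emeasure (\<eta> \<omega>) A) \<partial>M)
    = (\<Sum>n. \<phi> (of_nat n) * ennreal (measure \<nu> A ^ n / fact n * exp (- measure \<nu> A)))"
proof -
  define E where "E n = {\<omega> \<in> space M. emeasure (\<eta> \<omega>) A = of_nat n}" for n :: nat
  have E [measurable]: "E n \<in> sets M" for n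
    unfolding E_def by measurable
  have prob_E: "prob (E n) = measure \<nu> A ^ n / fact n * exp (- measure \<nu> A)" for n
    using prm fin assms(1) unfolding poisson_random_measure_def E_def by blast
  have "disjoint_family E"
    by (auto simp: disjoint_family_on_def E_def)
  then have "(\<lambda>n. prob (E n)) sums prob (\<Union>n. E n)"
    by (intro finite_measure_UNION) (use E in auto)
  moreover have "(\<lambda>n. prob (E n)) sums (exp (measure \<nu> A) * exp (- measure \<nu> A))"
    unfolding prob_E using exp_converges[of "measure \<nu> A"]
    by (intro sums_mult2) (simp add: divide_inverse mult.commute)
  ultimately have "prob (\<Union>n. E n) = 1"
    using sums_unique2 by (fastforce simp flip: exp_add)
  then have "AE \<omega> in M. \<omega> \<in> (\<Union>n. E n)"
    by (rule AE_prob_1)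
  then have "AE \<omega> in M. \<phi> (emeasure (\<eta> \<omega>) A) = (\<Sum>n. \<phi> (of_nat n) * indicator (E n) \<omega>)"
  proof eventually_elim
    case (elim \<omega>)
    then obtain k where k: "\<omega> \<in> E k" by blast
    have other: "\<omega> \<notin> E n" if "n \<noteq> k" for n using k that by (auto simp: E_def)
    have sum: "(\<Sum>n. \<phi> (of_nat n) * indicator (E n) \<omega>) = (\<Sum>n\<in>{k}. \<phi> (of_nat n) * indicator (E n) \<omega>)"
      by (rule suminf_finite) (use other in auto)
    have "emeasure (\<eta> \<omega>) A = of_nat k" using k by (simp add: E_def)
    then show ?case unfolding sum using k by simp
  qed
  then have "(\<integral>\<^sup>+\<omega>. \<phi> (emeasure (\<eta> \<omega>) A) \<partial>M) = (\<integral>\<^sup>+\<omega>. (\<Sum>n. \<phi> (of_nat n) * indicator (E n) \<omega>) \<partial>M)"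
    by (rule nn_integral_cong_AE)
  also have "\<dots> = (\<Sum>n. \<phi> (of_nat n) * emeasure M (E n))"
    by (subst nn_integral_suminf) (simp_all add: nn_integral_cmult_indicator)
  finally show ?thesis
    by (simp add: emeasure_eq_measure prob_E)
qed

lemma count_infinite:
  assumes "A \<in> sets borel" "emeasure \<nu> A = \<infinity>"
  shows "AE \<omega> in M. emeasure (\<eta> \<omega>) A = \<infinity>"
  using assms prm unfolding poisson_random_measure_def by blast

lemma laplace_count:
  assumes A [measurable]: "A \<in> sets borel" and c: "c < \<top>"
  shows "(LINT \<omega>|M. lexp (c * emeasure (\<eta> \<omega>) A)) = lexp (ennreal (1 - lexp c) * emeasure \<nu> A)"
proof (cases "emeasure \<nu> A = \<infinity>")
  case True
  have AE: "AE \<omega> in M. emeasure (\<eta> \<omega>) A = \<infinity>"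
    by (rule count_infinite[OF A True])
  show ?thesis
  proof (cases "c = 0")
    case False
    then have "lexp c < 1"
      using c by (cases c) (auto simp: lexp_ennreal)
    then have "ennreal (1 - lexp c) * emeasure \<nu> A = \<top>"
      using True by (simp add: ennreal_mult_top)
    moreover have "(LINT \<omega>|M. lexp (c * emeasure (\<eta> \<omega>) A)) = (LINT \<omega>|M. 0)"
      by (rule integral_cong_AE) (use AE False in \<open>auto simp: ennreal_mult_top\<close>)
    ultimately show ?thesis by simp
  qed (simp add: prob_space)
next
  case False
  then have fin: "emeasure \<nu> A < \<infinity>" by (simp add: less_top)
  obtain r where r: "c = ennreal r" "0 \<le> r" using c by (cases c) auto
  let ?\<mu> = "measure \<nu> A"
  let ?p = "\<lambda>n. ?\<mu> ^ n / fact n * exp (- ?\<mu>)"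
  have lexp_n: "lexp (c * of_nat n) = exp (- r) ^ n" for n
    using r by (simp add: lexp_ennreal ennreal_of_nat_eq_real_of_nat mult.commute flip: ennreal_mult exp_of_nat_mult)
  have "(\<lambda>n. exp (- r) ^ n * ?p n) sums (exp (?\<mu> * exp (- r)) * exp (- ?\<mu>))"
  proof -
    have "(\<lambda>n. (?\<mu> * exp (- r)) ^ n / fact n * exp (- ?\<mu>)) sums (exp (?\<mu> * exp (- r)) * exp (- ?\<mu>))"
      using exp_converges[of "?\<mu> * exp (- r)"]
      by (intro sums_mult2) (simp add: divide_inverse mult.commute)
    then show ?thesis by (simp add: power_mult_distrib mult_ac)
  qed
  then have "(\<Sum>n. ennreal (exp (- r) ^ n * ?p n)) = ennreal (exp (?\<mu> * exp (- r)) * exp (- ?\<mu>))"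
    by (intro suminf_ennreal_eq) auto
  moreover have "ennreal (lexp (c * of_nat n)) * ennreal (?p n) = ennreal (exp (- r) ^ n * ?p n)" for n
    unfolding lexp_n by (rule ennreal_mult[symmetric]) auto
  ultimately have "(\<Sum>n. ennreal (lexp (c * of_nat n)) * ennreal (?p n)) = ennreal (exp (?\<mu> * exp (- r)) * exp (- ?\<mu>))"
    by (simp only:)
  with count_law[OF A fin, of "\<lambda>x. ennreal (lexp (c * x))"]
  have "(\<integral>\<^sup>+\<omega>. ennreal (lexp (c * emeasure (\<eta> \<omega>) A)) \<partial>M) = ennreal (exp (?\<mu> * exp (- r)) * exp (- ?\<mu>))"
    by simp
  then have "(LINT \<omega>|M. lexp (c * emeasure (\<eta> \<omega>) A)) = exp (?\<mu> * exp (- r)) * exp (- ?\<mu>)"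
    by (subst integral_eq_nn_integral) auto
  also have "\<dots> = exp (- ((1 - exp (- r)) * ?\<mu>))"
    by (simp add: algebra_simps flip: exp_add)
  also have "\<dots> = lexp (ennreal (1 - lexp c) * emeasure \<nu> A)"
    using r fin by (simp add: lexp_ennreal emeasure_eq_ennreal_measure less_top flip: ennreal_mult)
  finally show ?thesis .
qed

text \<open>The level sets of \<open>u\<close> are disjoint, so that the counts of points in them are independent. They
  are enumerated by the natural numbers, with the empty set from some index on, because this is the
  form in which independence is given.\<close>

lemma
  assumes u: "simple_function borel u" and fin: "\<And>x. u x < \<top>"
  shows simple_measurable: "(\<lambda>\<omega>. \<integral>\<^sup>+x. u x \<partial>\<eta> \<omega>) \<in> borel_measurable M"
    and laplace_simple: "(LINT \<omega>|M. lexp (\<integral>\<^sup>+x. u x \<partial>\<eta> \<omega>)) = lexp (\<integral>\<^sup>+x. ennreal (1 - lexp (u x)) \<partial>\<nu>)"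
proof -
  have fin_range: "finite (range u)"
    using simple_functionD(1)[OF u] by simp
  obtain e n where e: "bij_betw e {..<n::nat} (range u)"
    using ex_bij_betw_nat_finite[OF fin_range] by (auto simp: atLeast0LessThan)
  define B where "B j = (if j < n then u -` {e j} else {})" for j
  have B [measurable]: "B j \<in> sets borel" for j
    using simple_functionD(2)[OF u, of "{e j}"] by (auto simp: B_def)
  have disj: "disjoint_family B"
    using e by (auto simp: disjoint_family_on_def B_def bij_betw_def inj_on_def)
  have integral: "(\<integral>\<^sup>+x. f (u x) \<partial>\<mu>) = (\<Sum>j<n. f (e j) * emeasure \<mu> (B j))"
    if \<mu>: "sets \<mu> = sets borel" for \<mu> :: "'a measure" and f
  proof -
    have space: "space \<mu> = UNIV" using sets_eq_imp_space_eq[OF \<mu>] by simp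
    have "f (u x) = (\<Sum>j<n. f (e j) * indicator (B j) x)" for x
    proof -
      have "u x \<in> e ` {..<n}" using e by (auto simp: bij_betw_def)
      then obtain i where i: "i < n" "u x = e i" by auto
      have "(\<Sum>j<n. f (e j) * indicator (B j) x) = (\<Sum>j<n. if j = i then f (e j) else 0)"
        using i e by (intro sum.cong refl) (auto simp: B_def indicator_def bij_betw_def inj_on_def)
      then show ?thesis using i by simp
    qed
    then have "(\<integral>\<^sup>+x. f (u x) \<partial>\<mu>) = (\<integral>\<^sup>+x. (\<Sum>j<n. f (e j) * indicator (B j) x) \<partial>\<mu>)"
      by (simp only:)
    also have "\<dots> = (\<Sum>j<n. \<integral>\<^sup>+x. f (e j) * indicator (B j) x \<partial>\<mu>)"
      by (rule nn_integral_sum) (unfold measurable_cong_sets[OF \<mu> refl], measurable)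
    also have "\<dots> = (\<Sum>j<n. f (e j) * emeasure \<mu> (B j))"
      using B \<mu> by (simp add: nn_integral_cmult_indicator)
    finally show ?thesis .
  qed
  have sum_eq: "(\<integral>\<^sup>+x. u x \<partial>\<eta> \<omega>) = (\<Sum>j<n. e j * emeasure (\<eta> \<omega>) (B j))" if "\<omega> \<in> space M" for \<omega>
    using integral[OF sets_\<eta>[OF that], of "\<lambda>x. x"] .
  show "(\<lambda>\<omega>. \<integral>\<^sup>+x. u x \<partial>\<eta> \<omega>) \<in> borel_measurable M"
    by (subst measurable_cong[OF sum_eq]) measurable
  have "indep_vars (\<lambda>_. borel) (\<lambda>j \<omega>. emeasure (\<eta> \<omega>) (B j)) UNIV"
    using prm B disj unfolding poisson_random_measure_def by blast
  then have "indep_vars (\<lambda>_. borel) (\<lambda>j \<omega>. emeasure (\<eta> \<omega>) (B j)) {..<n}"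
    by (rule indep_vars_subset) simp
  then have indep: "indep_vars (\<lambda>_. borel) (\<lambda>j \<omega>. lexp (e j * emeasure (\<eta> \<omega>) (B j))) {..<n}"
    by (rule indep_vars_compose2[where Y = "\<lambda>j x. lexp (e j * x)"]) measurable
  have e_fin: "e j < \<top>" if "j < n" for j
  proof -
    have "e j \<in> range u" using e that unfolding bij_betw_def by blast
    then show ?thesis using fin by auto
  qed
  have "(LINT \<omega>|M. lexp (\<integral>\<^sup>+x. u x \<partial>\<eta> \<omega>)) = (LINT \<omega>|M. (\<Prod>j<n. lexp (e j * emeasure (\<eta> \<omega>) (B j))))"
    by (intro Bochner_Integration.integral_cong) (auto simp: sum_eq lexp_sum)
  also have "\<dots> = (\<Prod>j<n. LINT \<omega>|M. lexp (e j * emeasure (\<eta> \<omega>) (B j)))"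
    by (rule indep_vars_lebesgue_integral[OF _ indep])
       (auto intro!: integrable_const_bound[where B = 1])
  also have "\<dots> = (\<Prod>j<n. lexp (ennreal (1 - lexp (e j)) * emeasure \<nu> (B j)))"
    by (intro prod.cong refl laplace_count e_fin) auto
  also have "\<dots> = lexp (\<integral>\<^sup>+x. ennreal (1 - lexp (u x)) \<partial>\<nu>)"
    using integral[OF sets_\<nu>, of "\<lambda>x. ennreal (1 - lexp x)"] by (simp add: lexp_sum)
  finally show "(LINT \<omega>|M. lexp (\<integral>\<^sup>+x. u x \<partial>\<eta> \<omega>)) = lexp (\<integral>\<^sup>+x. ennreal (1 - lexp (u x)) \<partial>\<nu>)" .
qed

theorem laplace_functional:
  assumes g: "g \<in> borel_measurable borel"
  shows "(LINT \<omega>|M. lexp (\<integral>\<^sup>+x. g x \<partial>\<eta> \<omega>)) = lexp (\<integral>\<^sup>+x. ennreal (1 - lexp (g x)) \<partial>\<nu>)"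
proof -
  obtain u where u: "\<And>i. simple_function borel (u i)" "incseq u" "\<And>i x. u i x < \<top>" "\<And>x. (SUP i. u i x) = g x"
    using borel_measurable_implies_simple_function_sequence'[OF g] by blast
  have u_meas [measurable]: "u i \<in> borel_measurable borel" for i
    using u(1) by (rule borel_measurable_simple_function)
  have lim: "(\<lambda>i. u i x) \<longlonglongrightarrow> g x" for x
    using LIMSEQ_SUP[of "\<lambda>i. u i x"] u(2,4) by (auto simp: incseq_def le_fun_def)
  have lim_\<eta>: "(\<lambda>i. \<integral>\<^sup>+x. u i x \<partial>\<eta> \<omega>) \<longlonglongrightarrow> (\<integral>\<^sup>+x. g x \<partial>\<eta> \<omega>)" if "\<omega> \<in> space M" for \<omega>
    by (rule nn_integral_LIMSEQ[OF u(2) _ lim])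
       (use u_meas sets_\<eta>[OF that] in \<open>simp cong: measurable_cong_sets\<close>)
  have meas_i [measurable]: "(\<lambda>\<omega>. \<integral>\<^sup>+x. u i x \<partial>\<eta> \<omega>) \<in> borel_measurable M" for i
    by (rule simple_measurable[OF u(1,3)])
  have [measurable]: "(\<lambda>\<omega>. \<integral>\<^sup>+x. g x \<partial>\<eta> \<omega>) \<in> borel_measurable M"
    by (rule borel_measurable_LIMSEQ_order[OF _ meas_i]) (rule lim_\<eta>)
  have "(\<lambda>i. LINT \<omega>|M. lexp (\<integral>\<^sup>+x. u i x \<partial>\<eta> \<omega>)) \<longlonglongrightarrow> (LINT \<omega>|M. lexp (\<integral>\<^sup>+x. g x \<partial>\<eta> \<omega>))"
    by (rule integral_dominated_convergence[where w = "\<lambda>_. 1"]) (auto intro!: tendsto_lexp lim_\<eta>)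
  moreover have "(\<lambda>i. lexp (\<integral>\<^sup>+x. ennreal (1 - lexp (u i x)) \<partial>\<nu>)) \<longlonglongrightarrow> lexp (\<integral>\<^sup>+x. ennreal (1 - lexp (g x)) \<partial>\<nu>)"
  proof (intro tendsto_lexp nn_integral_LIMSEQ)
    show "incseq (\<lambda>i x. ennreal (1 - lexp (u i x)))"
      using u(2) by (auto simp: incseq_def le_fun_def intro!: ennreal_leI diff_left_mono lexp_antimono)
    show "(\<lambda>x. ennreal (1 - lexp (u i x))) \<in> borel_measurable \<nu>" for i
      unfolding measurable_cong_sets[OF sets_\<nu> refl] by measurable
  qed (intro tendsto_ennrealI tendsto_diff tendsto_const tendsto_lexp lim)
  ultimately show ?thesis
    using laplace_simple[OF u(1,3)] by (simp add: LIMSEQ_unique)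
qed

end

section \<open>Laws of paths\<close>

abbreviation path_space :: "(real \<Rightarrow> 'a::euclidean_space) measure" where
  "path_space \<equiv> PiM {0..} (\<lambda>_. borel)"

abbreviation path_of :: "(real \<Rightarrow> 'w \<Rightarrow> 'a) \<Rightarrow> 'w \<Rightarrow> real \<Rightarrow> 'a" where
  "path_of Y \<omega> \<equiv> (\<lambda>t\<in>{0..}. Y t \<omega>)"

lemma measurable_path_of:
  assumes "\<And>t. 0 \<le> t \<Longrightarrow> Y t \<in> borel_measurable M"
  shows "path_of Y \<in> measurable M path_space"
  using assms by (intro measurable_restrict) auto

lemma levy_process_telescope:
  fixes Y :: "real \<Rightarrow> 'w \<Rightarrow> 'a::euclidean_space"
  shows "Y (\<tau> j) \<omega> - Y (\<tau> 0) \<omega> = (\<Sum>l<j. Y (\<tau> (Suc l)) \<omega> - Y (\<tau> l) \<omega>)"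
  by (simp add: sum_lessThan_telescope[of "\<lambda>l. Y (\<tau> l) \<omega>"])

lemma levy_increments_law:
  fixes Y :: "real \<Rightarrow> 'w \<Rightarrow> 'a::euclidean_space"
  assumes "prob_space M" and Y: "levy_process M Y" and \<tau>: "mono \<tau>" "\<tau> 0 = 0"
  shows "(\<lambda>\<omega>. \<lambda>j\<in>UNIV. Y (\<tau> (Suc j)) \<omega> - Y (\<tau> j) \<omega>) \<in> measurable M (PiM (UNIV :: nat set) (\<lambda>_. borel))"
    and "distr M (PiM UNIV (\<lambda>_. borel)) (\<lambda>\<omega>. \<lambda>j\<in>UNIV. Y (\<tau> (Suc j)) \<omega> - Y (\<tau> j) \<omega>)
      = PiM UNIV (\<lambda>j. distr M borel (Y (\<tau> (Suc j) - \<tau> j)))"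
proof -
  interpret prob_space M by fact
  have nonneg: "0 \<le> \<tau> j" for j
    using monoD[OF \<tau>(1), of 0 j] \<tau>(2) by simp
  have [measurable]: "Y (\<tau> j) \<in> borel_measurable M" for j
    using Y nonneg by (auto simp: levy_process_def)
  show "(\<lambda>\<omega>. \<lambda>j\<in>UNIV. Y (\<tau> (Suc j)) \<omega> - Y (\<tau> j) \<omega>) \<in> measurable M (PiM (UNIV :: nat set) (\<lambda>_. borel))"
    by (intro measurable_restrict) measurable
  have "indep_vars (\<lambda>_. borel) (\<lambda>j \<omega>. Y (\<tau> (Suc j)) \<omega> - Y (\<tau> j) \<omega>) UNIV"
    using Y \<tau> by (auto simp: levy_process_def)
  then have "distr M (PiM UNIV (\<lambda>_. borel)) (\<lambda>\<omega>. \<lambda>j\<in>UNIV. Y (\<tau> (Suc j)) \<omega> - Y (\<tau> j) \<omega>)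
      = PiM UNIV (\<lambda>j. distr M borel (\<lambda>\<omega>. Y (\<tau> (Suc j)) \<omega> - Y (\<tau> j) \<omega>))"
    by (subst (asm) indep_vars_iff_distr_eq_PiM) auto
  also have "(\<lambda>j. distr M borel (\<lambda>\<omega>. Y (\<tau> (Suc j)) \<omega> - Y (\<tau> j) \<omega>))
      = (\<lambda>j. distr M borel (Y (\<tau> (Suc j) - \<tau> j)))"
    using Y nonneg monoD[OF \<tau>(1), of "j" "Suc j" for j] by (auto simp: levy_process_def)
  finally show "distr M (PiM UNIV (\<lambda>_. borel)) (\<lambda>\<omega>. \<lambda>j\<in>UNIV. Y (\<tau> (Suc j)) \<omega> - Y (\<tau> j) \<omega>)
      = PiM UNIV (\<lambda>j. distr M borel (Y (\<tau> (Suc j) - \<tau> j)))" .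
qed

text \<open>The values at the times \<open>\<tau> j\<close> are the partial sums of the increments, and the increments are
  independent with laws given by the one-dimensional marginals.\<close>

lemma levy_cylinder_probability:
  fixes Y :: "real \<Rightarrow> 'w \<Rightarrow> 'a::euclidean_space"
  assumes "prob_space M" and Y: "levy_process M Y" and \<tau>: "mono \<tau>" "\<tau> 0 = 0"
    and A [measurable]: "\<And>j. A j \<in> sets borel"
  shows "emeasure M {\<omega> \<in> space M. \<forall>j\<le>n. Y (\<tau> j) \<omega> \<in> A j}
    = emeasure (PiM UNIV (\<lambda>j. distr M borel (Y (\<tau> (Suc j) - \<tau> j))))
        {z \<in> space (PiM UNIV (\<lambda>_. borel)). \<forall>j\<le>n. (\<Sum>l<j. z l) \<in> A j}"
proof -
  interpret prob_space M by fact
  let ?X = "\<lambda>\<omega>. \<lambda>j\<in>UNIV. Y (\<tau> (Suc j)) \<omega> - Y (\<tau> j) \<omega>"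
  let ?B = "{z \<in> space (PiM UNIV (\<lambda>_. borel)). \<forall>j\<le>n. (\<Sum>l<j. z l) \<in> A j}"
  have X: "?X \<in> measurable M (PiM (UNIV :: nat set) (\<lambda>_. borel))"
    using levy_increments_law(1)[OF assms(1) Y \<tau>] .
  have nonneg: "0 \<le> \<tau> j" for j
    using monoD[OF \<tau>(1), of 0 j] \<tau>(2) by simp
  have [measurable]: "Y (\<tau> j) \<in> borel_measurable M" for j
    using Y nonneg by (auto simp: levy_process_def)
  have B: "?B \<in> sets (PiM UNIV (\<lambda>_. borel))" by measurable
  have "AE \<omega> in M. Y (\<tau> 0) \<omega> = 0"
    using Y \<tau>(2) by (simp add: levy_process_def)
  then have "AE \<omega> in M. (\<forall>j\<le>n. Y (\<tau> j) \<omega> \<in> A j) \<longleftrightarrow> ?X \<omega> \<in> ?B"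
  proof eventually_elim
    case (elim \<omega>)
    then have "(\<Sum>l<j. Y (\<tau> (Suc l)) \<omega> - Y (\<tau> l) \<omega>) = Y (\<tau> j) \<omega>" for j
      using levy_process_telescope[of Y \<tau> j \<omega>] by simp
    then show ?case by (simp add: space_PiM)
  qed
  then have "emeasure M {\<omega> \<in> space M. \<forall>j\<le>n. Y (\<tau> j) \<omega> \<in> A j} = emeasure M (?X -` ?B \<inter> space M)"
    by (intro emeasure_eq_AE) (use measurable_sets[OF X B] in auto)
  also have "\<dots> = emeasure (distr M (PiM UNIV (\<lambda>_. borel)) ?X) ?B"
    by (rule emeasure_distr[OF X B, symmetric])
  finally show ?thesis
    unfolding levy_increments_law(2)[OF assms(1) Y \<tau>] .
qed

lemma finite_times_mono_enumeration:
  fixes J :: "real set"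
  assumes J: "finite J" "J \<subseteq> {0..}"
  obtains \<tau> n where "mono \<tau>" "\<tau> (0::nat) = 0" "J \<subseteq> \<tau> ` {..n}" "range \<tau> \<subseteq> {0..}"
proof -
  define xs where "xs = sorted_list_of_set (insert 0 J)"
  have set_xs: "set xs = insert 0 J" and sorted: "sorted xs"
    using J by (simp_all add: xs_def del: sorted_list_of_set_insert_remove)
  have len: "0 < length xs" using set_xs by (cases xs) auto
  define \<tau> where "\<tau> j = xs ! min j (length xs - 1)" for j
  have in_xs: "\<tau> j \<in> set xs" for j
  proof -
    have "min j (length xs - 1) < length xs" using len by linarith
    then show ?thesis unfolding \<tau>_def by (rule nth_mem)
  qed
  show ?thesis
  proof (rule that[of \<tau> "length xs"])
    show mono: "mono \<tau>"
    proof (rule monoI)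
      fix i j :: nat assume "i \<le> j"
      then have "min i (length xs - 1) \<le> min j (length xs - 1)" by (rule min.mono) simp
      moreover have "min j (length xs - 1) < length xs" using len by linarith
      ultimately show "\<tau> i \<le> \<tau> j" unfolding \<tau>_def by (rule sorted_nth_mono[OF sorted])
    qed
    show range: "range \<tau> \<subseteq> {0..}"
    proof (rule image_subsetI)
      fix j
      have "\<tau> j \<in> insert 0 J" using in_xs[of j] set_xs by simp
      then show "\<tau> j \<in> {0..}" using J by auto
    qed
    have cover: "insert 0 J \<subseteq> \<tau> ` {..length xs}"
    proof
      fix t assume "t \<in> insert 0 J"
      then obtain j where j: "j < length xs" "xs ! j = t"
        using set_xs by (metis in_set_conv_nth)
      then have "t = \<tau> j" by (auto simp: \<tau>_def min_def)
      then show "t \<in> \<tau> ` {..length xs}" using j by auto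
    qed
    then show "J \<subseteq> \<tau> ` {..length xs}" by simp
    from cover obtain j where "\<tau> j = 0" by (metis imageE insert_subset)
    then have "\<tau> 0 \<le> 0" using monoD[OF mono, of 0 j] by simp
    then show "\<tau> 0 = 0" using range by (metis atLeast_iff antisym rangeI subsetD)
  qed
qed

text \<open>A measure on path space is determined by its finite-dimensional cylinders.\<close>

theorem levy_path_law_unique:
  fixes Y Y' :: "real \<Rightarrow> 'w \<Rightarrow> 'a::euclidean_space"
  assumes M: "prob_space M" and Y: "levy_process M Y" and Y': "levy_process M Y'"
    and marginals: "\<And>t. 0 \<le> t \<Longrightarrow> distr M borel (Y t) = distr M borel (Y' t)"
  shows "distr M path_space (path_of Y) = distr M path_space (path_of Y')"
proof (rule measure_eqI_PiM_infinite)
  interpret prob_space M by fact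
  have path_Y: "path_of Y \<in> measurable M path_space" and path_Y': "path_of Y' \<in> measurable M path_space"
    using Y Y' by (auto intro!: measurable_path_of simp: levy_process_def)
  show "finite_measure (distr M path_space (path_of Y))"
    by (rule prob_space.finite_measure[OF prob_space_distr[OF path_Y]])
  fix A :: "real \<Rightarrow> 'a set" and J :: "real set"
  assume J: "finite J" "J \<subseteq> {0..}" and A: "\<And>i. i \<in> J \<Longrightarrow> A i \<in> sets borel"
  obtain \<tau> n where \<tau>: "mono \<tau>" "\<tau> (0::nat) = 0" and cover: "J \<subseteq> \<tau> ` {..n}" and range: "range \<tau> \<subseteq> {0..}"
    using finite_times_mono_enumeration[OF J] by metis
  define B where "B j = (if \<tau> j \<in> J then A (\<tau> j) else UNIV)" for j
  have B: "B j \<in> sets borel" for j using A by (simp add: B_def)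
  let ?C = "prod_emb {0..} (\<lambda>_. borel) J (Pi\<^sub>E J A)"
  have C: "?C \<in> sets path_space"
    using A J by (intro sets_PiM_I) auto
  have cylinder: "emeasure (distr M path_space (path_of Z)) ?C = emeasure M {\<omega> \<in> space M. \<forall>j\<le>n. Z (\<tau> j) \<omega> \<in> B j}"
    if Z: "path_of Z \<in> measurable M path_space" for Z :: "real \<Rightarrow> 'w \<Rightarrow> 'a"
  proof -
    have "path_of Z -` ?C \<inter> space M = {\<omega> \<in> space M. \<forall>t\<in>J. Z t \<omega> \<in> A t}"
    proof -
      have "0 \<le> t" if "t \<in> J" for t using J that by auto
      then show ?thesis by (auto simp: prod_emb_def PiE_iff space_PiM extensional_def)
    qed
    also have "\<dots> = {\<omega> \<in> space M. \<forall>j\<le>n. Z (\<tau> j) \<omega> \<in> B j}"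
    proof (intro Collect_cong conj_cong refl iffI ballI allI impI)
      fix \<omega> t assume "\<forall>j\<le>n. Z (\<tau> j) \<omega> \<in> B j" and t: "t \<in> J"
      moreover obtain j where "j \<le> n" "t = \<tau> j" using cover t by auto
      ultimately show "Z t \<omega> \<in> A t" using t by (auto simp: B_def)
    qed (simp add: B_def)
    finally show ?thesis
      using emeasure_distr[OF Z C] by simp
  qed
  have "distr M borel (Y (\<tau> (Suc j) - \<tau> j)) = distr M borel (Y' (\<tau> (Suc j) - \<tau> j))" for j
    using monoD[OF \<tau>(1), of j "Suc j"] by (intro marginals) simp
  then show "emeasure (distr M path_space (path_of Y)) ?C = emeasure (distr M path_space (path_of Y')) ?C"
    unfolding cylinder[OF path_Y] cylinder[OF path_Y']
      levy_cylinder_probability[OF M Y \<tau> B] levy_cylinder_probability[OF M Y' \<tau> B] by simp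
qed simp_all

text \<open>Evaluation at \<open>t\<close> is not jointly measurable in path and time on the full product space. The
  limit along grid times just above \<open>t\<close> is, because each grid time takes countably many values, and
  it agrees with the evaluation on right-continuous paths. The summand 1 makes the grid times larger
  than \<open>t\<close>; the maximum with 0 keeps them in the index set of the product.\<close>

definition path_eval :: "(real \<Rightarrow> 'a::euclidean_space) \<Rightarrow> real \<Rightarrow> 'a" where
  "path_eval w t = lim (\<lambda>n::nat. w (max 0 ((real_of_int \<lfloor>real (Suc n) * t\<rfloor> + 1) / real (Suc n))))"

lemma path_eval_cadlag:
  assumes p: "cadlag p" and t: "0 \<le> t"
  shows "path_eval (restrict p {0..}) t = p t"
proof -
  let ?q = "\<lambda>n. (real_of_int \<lfloor>real (Suc n) * t\<rfloor> + 1) / real (Suc n)"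
  have gt: "t < ?q n" for n
  proof -
    have "t * real (Suc n) < real_of_int \<lfloor>real (Suc n) * t\<rfloor> + 1"
      using floor_correct[of "real (Suc n) * t"] by (simp add: mult.commute)
    then show ?thesis by (simp only: pos_less_divide_eq of_nat_0_less_iff zero_less_Suc)
  qed
  have le: "?q n \<le> t + 1 / real (Suc n)" for n
  proof -
    have "(t + 1 / real (Suc n)) * real (Suc n) = real (Suc n) * t + 1"
      by (simp only: distrib_right) (simp add: mult.commute del: of_nat_Suc)
    then have "real_of_int \<lfloor>real (Suc n) * t\<rfloor> + 1 \<le> (t + 1 / real (Suc n)) * real (Suc n)"
      using of_int_floor_le[of "real (Suc n) * t"] by linarith
    then show ?thesis by (simp only: pos_divide_le_eq of_nat_0_less_iff zero_less_Suc)
  qed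
  have "(\<lambda>n. t + 1 / real (Suc n)) \<longlonglongrightarrow> t + 0"
    by (intro tendsto_add tendsto_const LIMSEQ_Suc[OF lim_1_over_n])
  then have upper: "(\<lambda>n. t + 1 / real (Suc n)) \<longlonglongrightarrow> t" by (simp only: add_0_right)
  have "?q \<longlonglongrightarrow> t"
    by (rule tendsto_sandwich[OF always_eventually always_eventually tendsto_const upper])
       (rule allI, rule less_imp_le, rule gt, rule allI, rule le)
  moreover have "eventually (\<lambda>n. ?q n \<in> {t<..} \<and> ?q n \<noteq> t) sequentially"
    by (intro always_eventually allI conjI) (unfold greaterThan_iff, rule gt, rule not_sym, rule less_imp_neq, rule gt)
  ultimately have "filterlim ?q (at_right t) sequentially"
    by (simp only: filterlim_at)
  moreover have "(p \<longlongrightarrow> p t) (at_right t)"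
    using p t by (auto simp: cadlag_def continuous_within)
  ultimately have "(\<lambda>n. p (?q n)) \<longlonglongrightarrow> p t"
    by (rule filterlim_compose[rotated])
  moreover have "restrict p {0..} (max 0 (?q n)) = p (?q n)" for n
    using gt[of n] t by (simp add: max_def)
  ultimately show ?thesis
    unfolding path_eval_def by (simp only: limI)
qed

lemma measurable_path_eval:
  "(\<lambda>(w, t). path_eval w t) \<in> borel_measurable (path_space \<Otimes>\<^sub>M borel)"
proof -
  have "(\<lambda>p. fst p (max 0 ((real_of_int \<lfloor>real (Suc n) * snd p\<rfloor> + 1) / real (Suc n)))) \<in> borel_measurable (path_space \<Otimes>\<^sub>M borel)"
    for n :: nat
  proof (rule measurable_compose_countable[where g = "\<lambda>p. \<lfloor>real (Suc n) * snd p\<rfloor>"])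
    fix k :: int
    show "(\<lambda>p. fst p (max 0 ((real_of_int k + 1) / real (Suc n)))) \<in> borel_measurable (path_space \<Otimes>\<^sub>M borel)"
      by (rule measurable_compose[OF measurable_fst measurable_component_singleton]) simp
  qed measurable
  then show ?thesis
    unfolding path_eval_def case_prod_beta by (intro borel_measurable_lim_metric)
qed

section \<open>Marked Poisson points\<close>

lemma (in prob_space) indep_expectation_iterated:
  fixes H :: "'b \<times> 'c \<Rightarrow> real"
  assumes X [measurable]: "X \<in> measurable M S" and Y [measurable]: "Y \<in> measurable M T"
    and indep: "indep_set (sets (vimage_algebra (space M) X S)) (sets (vimage_algebra (space M) Y T))"
    and H [measurable]: "H \<in> borel_measurable (S \<Otimes>\<^sub>M T)" and bound: "\<And>z. \<bar>H z\<bar> \<le> B"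
  shows "(LINT \<omega>|M. H (X \<omega>, Y \<omega>)) = (LINT \<omega>|M. LINT \<omega>'|M. H (X \<omega>, Y \<omega>'))"
proof -
  interpret X: prob_space "distr M S X" by (rule prob_space_distr) fact
  interpret Y: prob_space "distr M T Y" by (rule prob_space_distr) fact
  have product: "distr M S X \<Otimes>\<^sub>M distr M T Y = distr M (S \<Otimes>\<^sub>M T) (\<lambda>\<omega>. (X \<omega>, Y \<omega>))"
  proof (rule pair_measure_eqI)
    fix A B assume "A \<in> sets (distr M S X)" "B \<in> sets (distr M T Y)"
    then have [measurable]: "A \<in> sets S" "B \<in> sets T" by auto
    have "prob ((X -` A \<inter> space M) \<inter> (Y -` B \<inter> space M)) = prob (X -` A \<inter> space M) * prob (Y -` B \<inter> space M)"
      by (intro indep_setD[OF indep] in_vimage_algebra) measurable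
    moreover have "(X -` A \<inter> space M) \<inter> (Y -` B \<inter> space M) = (\<lambda>\<omega>. (X \<omega>, Y \<omega>)) -` (A \<times> B) \<inter> space M"
      by auto
    ultimately show "emeasure (distr M S X) A * emeasure (distr M T Y) B
        = emeasure (distr M (S \<Otimes>\<^sub>M T) (\<lambda>\<omega>. (X \<omega>, Y \<omega>))) (A \<times> B)"
      by (simp add: emeasure_distr emeasure_eq_measure flip: ennreal_mult)
  qed (auto simp: X.sigma_finite_measure_axioms Y.sigma_finite_measure_axioms cong: sets_pair_measure_cong)
  interpret XY: pair_prob_space "distr M S X" "distr M T Y" ..
  have "integrable (distr M S X \<Otimes>\<^sub>M distr M T Y) H"
    by (rule XY.integrable_const_bound[where B = B])
       (use bound H in \<open>auto simp: measurable_cong_sets[OF sets_pair_measure_cong[OF sets_distr sets_distr] refl]\<close>)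
  then have "(LINT z|(distr M S X \<Otimes>\<^sub>M distr M T Y). H z) = (LINT x|distr M S X. LINT y|distr M T Y. H (x, y))"
    by (rule XY.integral_fst'[symmetric])
  also have "\<dots> = (LINT \<omega>|M. LINT y|distr M T Y. H (X \<omega>, y))"
    by (rule integral_distr) measurable
  also have "\<dots> = (LINT \<omega>|M. LINT \<omega>'|M. H (X \<omega>, Y \<omega>'))"
    by (intro Bochner_Integration.integral_cong refl integral_distr)
       (use X in \<open>auto intro!: measurable_compose[OF measurable_Pair1'] dest: measurable_space\<close>)
  finally show ?thesis
    unfolding product by (simp add: integral_distr)
qed

text \<open>Almost everywhere with respect to an atomic measure, \<open>h\<close> agrees with its restriction to the
  countable set of atoms, and this restriction is measurable. In the application \<open>h y\<close> describes the
  cluster attached to \<open>y\<close>, which may depend on \<open>y\<close> in an arbitrary way.\<close>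

lemma nn_integral_atoms:
  fixes x :: "nat \<Rightarrow> 'a::t1_space" and h :: "'a \<Rightarrow> ennreal"
  shows "(\<integral>\<^sup>+y. h y \<partial>distr (count_space UNIV) borel x) = (\<Sum>k. h (x k))"
proof -
  let ?h = "\<lambda>y. h y * indicator (range x) y"
  have S: "range x \<in> sets borel"
    by (rule sets.countable) auto
  have h: "?h \<in> borel_measurable borel"
    by (rule measurable_discrete_difference[where f = "\<lambda>_. 0" and X = "range x"]) auto
  have "AE y in distr (count_space UNIV) borel x. y \<in> range x"
    using S by (subst AE_distr_iff) (auto simp: AE_count_space)
  then have "AE y in distr (count_space UNIV) borel x. h y = ?h y"
    by eventually_elim simp
  then have "(\<integral>\<^sup>+y. h y \<partial>distr (count_space UNIV) borel x) = (\<integral>\<^sup>+y. ?h y \<partial>distr (count_space UNIV) borel x)"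
    by (rule nn_integral_cong_AE)
  also have "\<dots> = (\<Sum>k. h (x k))"
    using h by (subst nn_integral_distr) (simp_all add: nn_integral_count_space_nat)
  finally show ?thesis .
qed

text \<open>The points \<open>\<xi> k\<close> enumerate the atoms of a Poisson random measure; the paths \<open>D i k\<close>, for \<open>i\<close>
  from 1 to \<open>m\<close>, are the mark of the \<open>k\<close>-th point.\<close>

locale marked_points = poisson_point_process M \<nu> \<eta>
  for M :: "'w measure" and \<nu> :: "'a::euclidean_space measure" and \<eta> :: "'w \<Rightarrow> 'a measure" +
  fixes m :: nat and \<xi> :: "nat \<Rightarrow> 'w \<Rightarrow> 'a" and D :: "nat \<Rightarrow> nat \<Rightarrow> real \<Rightarrow> 'w \<Rightarrow> 'a"
  assumes measurable_\<xi> [measurable]: "\<And>k. \<xi> k \<in> borel_measurable M"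
    and enumeration: "\<And>\<omega>. \<omega> \<in> space M \<Longrightarrow> \<eta> \<omega> = distr (count_space UNIV) borel (\<lambda>k. \<xi> k \<omega>)"
    and measurable_D: "\<And>i k t. i \<in> {1..m} \<Longrightarrow> 0 \<le> t \<Longrightarrow> D i k t \<in> borel_measurable M"
    and indep_D: "indep_vars (\<lambda>_. path_space) (\<lambda>(i, k). path_of (D i k)) ({1..m} \<times> UNIV)"
    and indep_\<xi>_D: "indep_set
          (sets (vimage_algebra (space M) (\<lambda>\<omega>. \<lambda>k. \<xi> k \<omega>) (PiM UNIV (\<lambda>_. borel))))
          (sets (vimage_algebra (space M)
             (\<lambda>\<omega>. restrict (\<lambda>(i, k, t). D i k t \<omega>) ({1..m} \<times> UNIV \<times> {0..}))
             (PiM ({1..m} \<times> UNIV \<times> {0..}) (\<lambda>_. borel))))"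
    and same_law: "\<And>i k. i \<in> {1..m} \<Longrightarrow>
      distr M path_space (path_of (D i k)) = distr M path_space (path_of (D i 0))"
begin

lemma measurable_path [measurable]: "i \<in> {1..m} \<Longrightarrow> path_of (D i k) \<in> measurable M path_space"
  by (intro measurable_path_of measurable_D)

definition mark_sum :: "(nat \<Rightarrow> 'a \<times> (real \<Rightarrow> 'a) \<Rightarrow> ennreal) \<Rightarrow> nat \<Rightarrow> 'a \<Rightarrow> 'w \<Rightarrow> ennreal" where
  "mark_sum \<Psi> k x \<omega> = (\<Sum>i\<in>{1..m}. \<Psi> i (x, path_of (D i k) \<omega>))"

text \<open>\<open>\<Psi> i (x, w)\<close> is the contribution of the \<open>i\<close>-th path \<open>w\<close> of the mark of a point at \<open>x\<close>.\<close>

context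
  fixes \<Psi> :: "nat \<Rightarrow> 'a \<times> (real \<Rightarrow> 'a) \<Rightarrow> ennreal"
  assumes \<Psi> [measurable]: "\<And>i. \<Psi> i \<in> borel_measurable (borel \<Otimes>\<^sub>M path_space)"
begin

lemma measurable_mark_sum:
  "(\<lambda>p. mark_sum \<Psi> k (fst p) (snd p)) \<in> borel_measurable (borel \<Otimes>\<^sub>M M)"
  unfolding mark_sum_def
proof (rule borel_measurable_sum)
  fix i assume "i \<in> {1..m}"
  from measurable_path[OF this, of k]
  have "(\<lambda>p. (fst p, path_of (D i k) (snd p))) \<in> measurable (borel \<Otimes>\<^sub>M M) (borel \<Otimes>\<^sub>M path_space)"
    by (intro measurable_Pair measurable_fst measurable_compose[OF measurable_snd])
  from measurable_compose[OF this \<Psi>]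
  show "(\<lambda>p. \<Psi> i (fst p, path_of (D i k) (snd p))) \<in> borel_measurable (borel \<Otimes>\<^sub>M M)" .
qed

lemma measurable_mark:
  "i \<in> {1..m} \<Longrightarrow> (\<lambda>\<omega>. \<Psi> i (x, path_of (D i k) \<omega>)) \<in> borel_measurable M"
  by (rule measurable_compose[OF _ \<Psi>]) (intro measurable_Pair measurable_const measurable_path, auto)

lemma laplace_mark_law:
  assumes i: "i \<in> {1..m}"
  shows "(LINT \<omega>|M. lexp (\<Psi> i (x, path_of (D i k) \<omega>))) = (LINT \<omega>|M. lexp (\<Psi> i (x, path_of (D i 0) \<omega>)))"
proof -
  have f: "(\<lambda>w. lexp (\<Psi> i (x, w))) \<in> borel_measurable path_space"
    by (intro measurable_compose[OF _ measurable_lexp] measurable_compose[OF _ \<Psi>] measurable_Pair1') simp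
  have "(LINT w|distr M path_space (path_of (D i l)). lexp (\<Psi> i (x, w)))
      = (LINT \<omega>|M. lexp (\<Psi> i (x, path_of (D i l) \<omega>)))" for l
    by (rule integral_distr[OF measurable_path[OF i] f])
  with same_law[OF i, of k] show ?thesis by metis
qed

text \<open>The factor that a point at \<open>x\<close> contributes to the Laplace transform once its mark has been
  averaged out. The paths with index \<open>k = 0\<close> stand for their common law.\<close>

definition mark_laplace :: "'a \<Rightarrow> real" where
  "mark_laplace x = (\<Prod>i\<in>{1..m}. LINT \<omega>|M. lexp (\<Psi> i (x, path_of (D i 0) \<omega>)))"

lemma laplace_marks_fixed_points:
  "(LINT \<omega>|M. (\<Prod>k<n. \<Prod>i\<in>{1..m}. lexp (\<Psi> i (x k, path_of (D i k) \<omega>)))) = (\<Prod>k<n. mark_laplace (x k))"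
proof -
  let ?I = "{1..m} \<times> {..<n}"
  let ?L = "\<lambda>p \<omega>. lexp (\<Psi> (fst p) (x (snd p), (case p of (i, k) \<Rightarrow> path_of (D i k)) \<omega>))"
  have "indep_vars (\<lambda>_. path_space) (\<lambda>(i, k). path_of (D i k)) ?I"
    by (rule indep_vars_subset[OF indep_D]) auto
  then have "indep_vars (\<lambda>_. borel) (\<lambda>p \<omega>. ?L p \<omega>) ?I"
    by (rule indep_vars_compose2[where Y = "\<lambda>p w. lexp (\<Psi> (fst p) (x (snd p), w))"])
       (intro measurable_compose[OF _ measurable_lexp] measurable_compose[OF _ \<Psi>] measurable_Pair1', simp)
  then have "(LINT \<omega>|M. (\<Prod>p\<in>?I. ?L p \<omega>))
     = (\<Prod>p\<in>?I. LINT \<omega>|M. ?L p \<omega>)"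
    by (intro indep_vars_lebesgue_integral)
       (auto intro!: integrable_const_bound[where B = 1] measurable_compose[OF _ measurable_lexp] measurable_mark)
  also have "\<dots> = (\<Prod>i\<in>{1..m}. \<Prod>k<n. LINT \<omega>|M. lexp (\<Psi> i (x k, path_of (D i k) \<omega>)))"
    by (subst prod.cartesian_product) (simp add: case_prod_beta)
  also have "\<dots> = (\<Prod>i\<in>{1..m}. \<Prod>k<n. LINT \<omega>|M. lexp (\<Psi> i (x k, path_of (D i 0) \<omega>)))"
    by (intro prod.cong refl laplace_mark_law)
  also have "\<dots> = (\<Prod>k<n. mark_laplace (x k))"
    unfolding mark_laplace_def by (rule prod.swap)
  also have "(\<lambda>\<omega>. \<Prod>p\<in>?I. ?L p \<omega>)
      = (\<lambda>\<omega>. \<Prod>k<n. \<Prod>i\<in>{1..m}. lexp (\<Psi> i (x k, path_of (D i k) \<omega>)))"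
    by (subst prod.swap, subst prod.cartesian_product) (simp add: case_prod_beta)
  finally show ?thesis .
qed

text \<open>The points are independent of the marks, hence the marks can be averaged while the points are
  held fixed.\<close>

lemma laplace_finitely_many_marked_points:
  "(LINT \<omega>|M. lexp (\<Sum>k<n. mark_sum \<Psi> k (\<xi> k \<omega>) \<omega>)) = (LINT \<omega>|M. (\<Prod>k<n. mark_laplace (\<xi> k \<omega>)))"
proof -
  let ?J = "{1..m} \<times> UNIV \<times> {0..} :: (nat \<times> nat \<times> real) set"
  let ?\<Xi> = "\<lambda>\<omega>. \<lambda>k. \<xi> k \<omega>" and ?\<Delta> = "\<lambda>\<omega>. restrict (\<lambda>(i, k, t). D i k t \<omega>) ?J"
  let ?S = "PiM UNIV (\<lambda>_. borel) :: (nat \<Rightarrow> 'a) measure" and ?T = "PiM ?J (\<lambda>_. borel) :: (nat \<times> nat \<times> real \<Rightarrow> 'a) measure"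
  let ?path = "\<lambda>d i k. \<lambda>t\<in>{0..}. d (i, k, t)"
  define H where "H = (\<lambda>(x, d). \<Prod>k<n. \<Prod>i\<in>{1..m}. lexp (\<Psi> i (x k, ?path d i k)))"
  have \<Xi>: "?\<Xi> \<in> measurable M ?S"
    by (rule measurable_PiM_single') auto
  have \<Delta>: "?\<Delta> \<in> measurable M ?T"
    by (rule measurable_restrict) (auto intro!: measurable_D)

  have "(\<lambda>z. \<Prod>k<n. \<Prod>i\<in>{1..m}. lexp (\<Psi> i (fst z k, ?path (snd z) i k))) \<in> borel_measurable (?S \<Otimes>\<^sub>M ?T)"
  proof (intro borel_measurable_prod measurable_compose[OF _ measurable_lexp] measurable_compose[OF _ \<Psi>] measurable_Pair)
    fix k i assume i: "i \<in> {1..m}"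
    show "(\<lambda>z. fst z k) \<in> borel_measurable (?S \<Otimes>\<^sub>M ?T)"
      by (rule measurable_compose[OF measurable_fst measurable_component_singleton]) simp
    show "(\<lambda>z. ?path (snd z) i k) \<in> measurable (?S \<Otimes>\<^sub>M ?T) path_space"
      using i by (intro measurable_restrict measurable_compose[OF measurable_snd measurable_component_singleton]) auto
  qed
  then have H: "H \<in> borel_measurable (?S \<Otimes>\<^sub>M ?T)"
    unfolding H_def case_prod_beta .
  have bound: "\<bar>H z\<bar> \<le> 1" for z
    unfolding H_def case_prod_beta by (simp add: abs_prod) (intro prod_le_1 conjI prod_nonneg ballI; simp)
  have H_eq: "H (?\<Xi> \<omega>, ?\<Delta> \<omega>') = (\<Prod>k<n. \<Prod>i\<in>{1..m}. lexp (\<Psi> i (\<xi> k \<omega>, path_of (D i k) \<omega>')))" for \<omega> \<omega>'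
  proof -
    have "?path (?\<Delta> \<omega>') i k = path_of (D i k) \<omega>'" if "i \<in> {1..m}" for i k
      using that by (auto simp: fun_eq_iff)
    then show ?thesis
      unfolding H_def prod.case by (intro prod.cong refl) (simp only:)
  qed
  have "(LINT \<omega>|M. H (?\<Xi> \<omega>, ?\<Delta> \<omega>)) = (LINT \<omega>|M. LINT \<omega>'|M. H (?\<Xi> \<omega>, ?\<Delta> \<omega>'))"
    by (rule indep_expectation_iterated[OF \<Xi> \<Delta> indep_\<xi>_D H bound])
  then show ?thesis
    unfolding H_eq laplace_marks_fixed_points by (simp add: lexp_sum mark_sum_def)
qed

lemma measurable_mark_laplace [measurable]: "mark_laplace \<in> borel_measurable borel"
  unfolding mark_laplace_def[abs_def]
proof (rule borel_measurable_prod)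
  fix i assume "i \<in> {1..m}"
  from measurable_path[OF this, of 0]
  have "(\<lambda>p. (fst p, path_of (D i 0) (snd p))) \<in> measurable (borel \<Otimes>\<^sub>M M) (borel \<Otimes>\<^sub>M path_space)"
    by (intro measurable_Pair measurable_fst measurable_compose[OF measurable_snd])
  from measurable_compose[OF measurable_compose[OF this \<Psi>] measurable_lexp]
  show "(\<lambda>x. LINT \<omega>|M. lexp (\<Psi> i (x, path_of (D i 0) \<omega>))) \<in> borel_measurable borel"
    by (intro borel_measurable_lebesgue_integral) (simp add: case_prod_beta)
qed

lemma mark_laplace_bounds: "0 \<le> mark_laplace x" "mark_laplace x \<le> 1"
proof -
  have "(LINT \<omega>|M. lexp (\<Psi> i (x, path_of (D i 0) \<omega>))) \<le> (LINT \<omega>|M. 1)" if "i \<in> {1..m}" for i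
    by (rule integral_mono)
       (auto intro!: integrable_const_bound[where B = 1] measurable_compose[OF _ measurable_lexp] measurable_mark that)
  then show "mark_laplace x \<le> 1"
    unfolding mark_laplace_def by (intro prod_le_1) (auto simp: prob_space)
qed (simp add: mark_laplace_def prod_nonneg)

lemma mark_laplace_eq: "mark_laplace x = (LINT \<omega>|M. lexp (mark_sum \<Psi> 0 x \<omega>))"
  using laplace_marks_fixed_points[where n = 1 and x = "\<lambda>_. x"] by (simp add: mark_sum_def lexp_sum)

text \<open>With the marks averaged out, the left-hand side is the Laplace functional of the unmarked
  process at \<open>- ln mark_laplace\<close>. Independence applies to the product over finitely many points, whose
  number then tends to infinity.\<close>

theorem laplace_marked_points:
  "(LINT \<omega>|M. lexp (\<Sum>k. mark_sum \<Psi> k (\<xi> k \<omega>) \<omega>))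
    = lexp (\<integral>\<^sup>+x. \<integral>\<^sup>+\<omega>. ennreal (1 - lexp (mark_sum \<Psi> 0 x \<omega>)) \<partial>M \<partial>\<nu>)"
proof -
  define g where "g x = (if mark_laplace x = 0 then \<top> else ennreal (- ln (mark_laplace x)))" for x
  have [measurable]: "g \<in> borel_measurable borel"
    unfolding g_def[abs_def] by measurable
  have lexp_g: "lexp (g x) = mark_laplace x" for x
    using mark_laplace_bounds[of x] by (auto simp: g_def lexp_ennreal)
  have mark_meas [measurable]: "(\<lambda>\<omega>. mark_sum \<Psi> k (\<xi> k \<omega>) \<omega>) \<in> borel_measurable M" for k
    using measurable_compose[OF measurable_Pair[OF measurable_\<xi> measurable_ident] measurable_mark_sum[of k], of k]
    by simp
  have sums: "(\<lambda>n. \<Sum>k<n. f k) \<longlonglongrightarrow> (\<Sum>k. f k)" for f :: "nat \<Rightarrow> ennreal"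
    by (rule summable_LIMSEQ) simp
  have "(\<lambda>n. LINT \<omega>|M. lexp (\<Sum>k<n. mark_sum \<Psi> k (\<xi> k \<omega>) \<omega>)) \<longlonglongrightarrow> (LINT \<omega>|M. lexp (\<Sum>k. mark_sum \<Psi> k (\<xi> k \<omega>) \<omega>))"
    by (rule integral_dominated_convergence[where w = "\<lambda>_. 1"]) (auto intro!: tendsto_lexp sums)
  moreover have "(\<lambda>n. LINT \<omega>|M. lexp (\<Sum>k<n. g (\<xi> k \<omega>))) \<longlonglongrightarrow> (LINT \<omega>|M. lexp (\<Sum>k. g (\<xi> k \<omega>)))"
    by (rule integral_dominated_convergence[where w = "\<lambda>_. 1"]) (auto intro!: tendsto_lexp sums)
  moreover have "(LINT \<omega>|M. lexp (\<Sum>k<n. mark_sum \<Psi> k (\<xi> k \<omega>) \<omega>)) = (LINT \<omega>|M. lexp (\<Sum>k<n. g (\<xi> k \<omega>)))" for n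
    by (simp only: laplace_finitely_many_marked_points) (simp add: lexp_sum lexp_g)
  ultimately have "(LINT \<omega>|M. lexp (\<Sum>k. mark_sum \<Psi> k (\<xi> k \<omega>) \<omega>)) = (LINT \<omega>|M. lexp (\<Sum>k. g (\<xi> k \<omega>)))"
    by (simp add: LIMSEQ_unique)
  also have "\<dots> = (LINT \<omega>|M. lexp (\<integral>\<^sup>+x. g x \<partial>\<eta> \<omega>))"
    by (intro Bochner_Integration.integral_cong refl) (simp add: enumeration nn_integral_atoms)
  also have "\<dots> = lexp (\<integral>\<^sup>+x. ennreal (1 - mark_laplace x) \<partial>\<nu>)"
    by (subst laplace_functional) (simp_all add: lexp_g)
  also have "(\<lambda>x. ennreal (1 - mark_laplace x)) = (\<lambda>x. \<integral>\<^sup>+\<omega>. ennreal (1 - lexp (mark_sum \<Psi> 0 x \<omega>)) \<partial>M)"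
  proof
    fix x
    have [measurable]: "(\<lambda>\<omega>. mark_sum \<Psi> 0 x \<omega>) \<in> borel_measurable M"
      unfolding mark_sum_def by (rule borel_measurable_sum) (rule measurable_mark)
    have "integrable M (\<lambda>\<omega>. lexp (mark_sum \<Psi> 0 x \<omega>))"
      by (rule integrable_const_bound[where B = 1]) auto
    then show "ennreal (1 - mark_laplace x) = (\<integral>\<^sup>+\<omega>. ennreal (1 - lexp (mark_sum \<Psi> 0 x \<omega>)) \<partial>M)"
      unfolding mark_laplace_eq by (subst nn_integral_eq_integral) (auto simp: prob_space)
  qed
  finally show ?thesis .
qed

end

lemma laplace_marked_points_scaled:
  assumes \<Psi>: "\<And>i. \<Psi> i \<in> borel_measurable (borel \<Otimes>\<^sub>M path_space)"
  shows "(LINT \<omega>|M. lexp (s * (\<Sum>k. mark_sum \<Psi> k (\<xi> k \<omega>) \<omega>)))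
    = lexp (\<integral>\<^sup>+x. \<integral>\<^sup>+\<omega>. ennreal (1 - lexp (s * mark_sum \<Psi> 0 x \<omega>)) \<partial>M \<partial>\<nu>)"
proof -
  have scaled: "(\<lambda>z. s * \<Psi> i z) \<in> borel_measurable (borel \<Otimes>\<^sub>M path_space)" for i
    using \<Psi> by simp
  from laplace_marked_points[of "\<lambda>i z. s * \<Psi> i z", OF scaled] show ?thesis
    by (simp add: mark_sum_def
        flip: sum_distrib_left)
qed

end

section \<open>Concentration and tails of stable laws\<close>

lemma one_dimensional_basis:
  assumes "DIM('a::euclidean_space) = 1"
  obtains b :: "'a::euclidean_space" where "b \<in> Basis" "norm b = 1" "\<And>x. x = (x \<bullet> b) *\<^sub>R b" "\<And>x. norm x = \<bar>x \<bullet> b\<bar>"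
proof -
  obtain b :: 'a where b: "Basis = {b}"
    using assms by (rule card_1_singletonE)
  have "b \<in> Basis" unfolding b by (rule singletonI)
  then have "norm b = 1" by (rule norm_Basis)
  have rep: "x = (x \<bullet> b) *\<^sub>R b" for x
    using euclidean_representation[of x] unfolding b by simp
  moreover have "norm x = \<bar>x \<bullet> b\<bar>" for x
    using arg_cong[OF rep[of x], of norm] \<open>norm b = 1\<close> by simp
  ultimately show ?thesis using that \<open>b \<in> Basis\<close> \<open>norm b = 1\<close> by blast
qed

text \<open>The Gaussian function is a mixture of characters with Gaussian weights, so that its mean under
  the law of \<open>Z\<close> is the Gaussian mean of the characteristic function (Parseval). The Gaussian
  function is comparable to the indicator of an interval; this turns estimates of the characteristic
  function into estimates of probabilities.\<close>

lemma (in prob_space) gaussian_smoothing: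
  fixes Z :: "'a \<Rightarrow> real" and \<phi> :: "real \<Rightarrow> real"
  assumes [measurable]: "Z \<in> borel_measurable M" "\<phi> \<in> borel_measurable borel"
    and char: "\<And>u. (CLINT \<omega>|M. iexp (u * Z \<omega>)) = complex_of_real (\<phi> u)"
  shows "(LINT \<omega>|M. exp (- (\<epsilon> * Z \<omega>)\<^sup>2 / 2)) = (LINT u|std_normal_distribution. \<phi> (\<epsilon> * u))"
proof -
  interpret S: prob_space std_normal_distribution
    by (rule prob_space_normal_density) simp
  interpret SM: pair_prob_space std_normal_distribution M ..
  let ?f = "\<lambda>u \<omega>. iexp ((\<epsilon> * u) * Z \<omega>)"
  have int: "integrable (std_normal_distribution \<Otimes>\<^sub>M M) (\<lambda>(u, \<omega>). ?f u \<omega>)"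
    by (rule SM.integrable_const_bound[where B = 1]) auto
  have "complex_of_real (exp (- (\<epsilon> * Z \<omega>)\<^sup>2 / 2)) = (CLINT u|std_normal_distribution. ?f u \<omega>)" for \<omega>
    using fun_cong[OF char_std_normal_distribution, of "\<epsilon> * Z \<omega>"] by (simp add: char_def mult_ac)
  then have "complex_of_real (LINT \<omega>|M. exp (- (\<epsilon> * Z \<omega>)\<^sup>2 / 2)) = (CLINT \<omega>|M. CLINT u|std_normal_distribution. ?f u \<omega>)"
    by (simp flip: integral_complex_of_real)
  also have "\<dots> = (CLINT u|std_normal_distribution. CLINT \<omega>|M. ?f u \<omega>)"
    by (rule SM.Fubini_integral[OF int])
  also have "\<dots> = complex_of_real (LINT u|std_normal_distribution. \<phi> (\<epsilon> * u))"
    unfolding char by (rule integral_complex_of_real)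
  finally show ?thesis by (simp only: of_real_eq_iff)
qed

text \<open>For \<open>\<alpha> \<ge> 1\<close> the integrand is at most \<open>exp c\<close> times a two-sided exponential density, up to
  normalization.\<close>

lemma nn_integral_exp_minus_abs_powr_finite:
  assumes c: "0 < c" and \<alpha>: "1 \<le> \<alpha>"
  shows "(\<integral>\<^sup>+v. ennreal (exp (- c * \<bar>v\<bar> powr \<alpha>)) \<partial>lborel) < \<infinity>"
proof -
  interpret E: prob_space "density lborel (exponential_density c)"
    by (rule prob_space_exponential_density[OF c])
  have one: "(\<integral>\<^sup>+v. ennreal (exponential_density c v) \<partial>lborel) = 1"
    using E.emeasure_space_1 by (subst (asm) emeasure_density) auto
  have one': "(\<integral>\<^sup>+v. ennreal (exponential_density c (- v)) \<partial>lborel) = 1"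
    using nn_integral_real_affine[of "\<lambda>v. ennreal (exponential_density c v)" "- 1" 0] one by simp
  have "exp (- c * \<bar>v\<bar> powr \<alpha>) \<le> exp c / c * (exponential_density c v + exponential_density c (- v))" for v
  proof -
    have "\<bar>v\<bar> - 1 \<le> \<bar>v\<bar> powr \<alpha>"
    proof (cases "1 \<le> \<bar>v\<bar>")
      case True
      then show ?thesis using powr_mono[of 1 \<alpha> "\<bar>v\<bar>"] \<alpha> by simp
    next
      case False
      then have "\<bar>v\<bar> - 1 \<le> 0" by simp
      then show ?thesis by (rule order_trans) simp
    qed
    then have "exp (- c * \<bar>v\<bar> powr \<alpha>) \<le> exp (c - c * \<bar>v\<bar>)"
      using c mult_left_mono[of "\<bar>v\<bar> - 1" "\<bar>v\<bar> powr \<alpha>" c] by (simp add: algebra_simps)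
    also have "\<dots> = exp c / c * (c * exp (- c * \<bar>v\<bar>))"
      using c by (simp add: mult_exp_exp)
    also have "\<dots> \<le> exp c / c * (exponential_density c v + exponential_density c (- v))"
    proof (rule mult_left_mono)
      show "c * exp (- c * \<bar>v\<bar>) \<le> exponential_density c v + exponential_density c (- v)"
        using c by (cases "v = 0"; cases "v < 0") (auto simp: exponential_density_def mult.commute)
    qed (use c in simp)
    finally show ?thesis .
  qed
  then have "(\<integral>\<^sup>+v. ennreal (exp (- c * \<bar>v\<bar> powr \<alpha>)) \<partial>lborel)
      \<le> (\<integral>\<^sup>+v. ennreal (exp c / c) * (ennreal (exponential_density c v) + ennreal (exponential_density c (- v))) \<partial>lborel)"
    using c by (intro nn_integral_mono) (auto intro!: ennreal_leI simp: exponential_density_nonneg simp flip: ennreal_mult ennreal_plus)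
  also have "\<dots> = ennreal (exp c / c) * 2"
    using one one' by (simp add: nn_integral_cmult nn_integral_add)
  also have "\<dots> < \<infinity>"
    by (simp add: ennreal_mult_less_top)
  finally show ?thesis .
qed

lemma stable_characteristic:
  fixes Y :: "real \<Rightarrow> 'w \<Rightarrow> 'a::euclidean_space"
  assumes Y: "symmetric_stable_process M \<alpha> c Y" and t: "0 \<le> t" and b: "norm b = 1"
  shows "(CLINT \<omega>|M. iexp (u * (Y t \<omega> \<bullet> b))) = complex_of_real (exp (- (c * t * \<bar>u\<bar> powr \<alpha>)))"
proof -
  have "(CLINT \<omega>|M. iexp ((u *\<^sub>R b) \<bullet> Y t \<omega>)) = exp (- complex_of_real (c * t * norm (u *\<^sub>R b) powr \<alpha>))"
    using Y t unfolding symmetric_stable_process_def by blast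
  then show ?thesis
    using b by (simp add: inner_commute flip: exp_of_real)
qed

lemma stable_process_measurable:
  "symmetric_stable_process M \<alpha> c Y \<Longrightarrow> 0 \<le> t \<Longrightarrow> Y t \<in> borel_measurable M"
  by (simp add: symmetric_stable_process_def levy_process_def)

lemma stable_smoothing:
  fixes Y :: "real \<Rightarrow> 'w \<Rightarrow> 'a::euclidean_space"
  assumes "prob_space M" and Y: "symmetric_stable_process M \<alpha> c Y" and t: "0 \<le> t" and dim: "DIM('a) = 1"
  shows "(LINT \<omega>|M. exp (- (\<epsilon> * norm (Y t \<omega>))\<^sup>2 / 2))
    = (LINT u|std_normal_distribution. exp (- (c * t * \<bar>\<epsilon> * u\<bar> powr \<alpha>)))"
proof -
  interpret prob_space M by fact
  obtain b :: 'a where b: "norm b = 1" "\<And>x. norm x = \<bar>x \<bullet> b\<bar>"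
    using one_dimensional_basis[OF dim] by metis
  have [measurable]: "Y t \<in> borel_measurable M"
    using Y t by (rule stable_process_measurable)
  have "(LINT \<omega>|M. exp (- (\<epsilon> * (Y t \<omega> \<bullet> b))\<^sup>2 / 2))
    = (LINT u|std_normal_distribution. exp (- (c * t * \<bar>\<epsilon> * u\<bar> powr \<alpha>)))"
    by (rule gaussian_smoothing) (measurable, rule stable_characteristic[OF Y t b(1)])
  then show ?thesis
    by (simp add: b(2) power_mult_distrib)
qed

text \<open>The characteristic function of the law at time \<open>t\<close> has an integral of order
  \<open>t powr (- 1 / \<alpha>)\<close>, and this is the order of the probability of any bounded interval.\<close>

lemma stable_concentration:
  fixes Y :: "real \<Rightarrow> 'w \<Rightarrow> 'a::euclidean_space"
  assumes "prob_space M" and Y: "symmetric_stable_process M \<alpha> c Y" and dim: "DIM('a) = 1"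
    and \<alpha>: "1 \<le> \<alpha>" and K: "0 < K"
  obtains C where "0 < C" and
    "\<And>t. 0 < t \<Longrightarrow> measure M {\<omega> \<in> space M. norm (Y t \<omega>) \<le> K} \<le> C * t powr (- 1 / \<alpha>)"
proof -
  let ?E = "\<lambda>t. {\<omega> \<in> space M. norm (Y t \<omega>) \<le> K}"
  interpret prob_space M by fact
  interpret S: prob_space std_normal_distribution
    by (rule prob_space_normal_density) simp
  have c: "0 < c" using Y by (simp add: symmetric_stable_process_def)
  define J where "J = enn2real (\<integral>\<^sup>+v. ennreal (exp (- c * \<bar>v\<bar> powr \<alpha>)) \<partial>lborel)"
  have J: "(\<integral>\<^sup>+v. ennreal (exp (- c * \<bar>v\<bar> powr \<alpha>)) \<partial>lborel) = ennreal J" "0 \<le> J"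
    using nn_integral_exp_minus_abs_powr_finite[OF c \<alpha>] by (simp_all add: J_def)
  have "measure M (?E t) \<le> (2 * K * J + 1) * t powr (- 1 / \<alpha>)" if t: "0 < t" for t
  proof -
    have [measurable]: "Y t \<in> borel_measurable M"
      using Y t by (intro stable_process_measurable) auto
    let ?\<phi> = "\<lambda>u. exp (- (c * t * \<bar>1 / K * u\<bar> powr \<alpha>))"
    define s where "s = K * t powr (- 1 / \<alpha>)"
    have s: "0 < s" using K t by (simp add: s_def)
    have scale: "c * t * \<bar>1 / K * (s * v)\<bar> powr \<alpha> = c * \<bar>v\<bar> powr \<alpha>" for v
    proof -
      have "\<bar>1 / K * (s * v)\<bar> = t powr (- 1 / \<alpha>) * \<bar>v\<bar>"
        using K by (simp add: s_def abs_mult)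
      then have "\<bar>1 / K * (s * v)\<bar> powr \<alpha> = (t powr (- 1 / \<alpha>)) powr \<alpha> * \<bar>v\<bar> powr \<alpha>"
        by (simp only: powr_mult powr_ge_zero abs_ge_zero)
      also have "(t powr (- 1 / \<alpha>)) powr \<alpha> = t powr (- 1)"
        using \<alpha> by (simp add: powr_powr)
      also have "\<dots> = inverse t"
        using t by (simp add: powr_minus)
      finally show ?thesis
        using t by simp
    qed
    have eq: "(\<integral>\<^sup>+u. ennreal (?\<phi> u) \<partial>lborel) = ennreal (s * J)"
    proof -
      have "(\<integral>\<^sup>+u. ennreal (?\<phi> u) \<partial>lborel)
          = ennreal \<bar>s\<bar> * (\<integral>\<^sup>+v. ennreal (exp (- (c * t * \<bar>1 / K * (0 + s * v)\<bar> powr \<alpha>))) \<partial>lborel)"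
        by (rule nn_integral_real_affine) (use s in auto)
      then show ?thesis
        using J s by (simp only: add_0 scale) (simp add: ennreal_mult)
    qed
    have density_le: "std_normal_density u \<le> 1" for u
    proof -
      have "1 \<le> sqrt (2 * pi)" using pi_gt3 by simp
      then have "1 / sqrt (2 * pi) * exp (- u\<^sup>2 / 2) \<le> 1 * 1"
        by (intro mult_mono) (auto simp: divide_le_eq)
      then show ?thesis
        by (simp add: std_normal_density_def)
    qed
    have low: "1 / 2 * indicator (?E t) \<omega> \<le> exp (- (1 / K * norm (Y t \<omega>))\<^sup>2 / 2)" for \<omega>
    proof (cases "norm (Y t \<omega>) \<le> K")
      case True
      then have "(1 / K * norm (Y t \<omega>))\<^sup>2 \<le> 1"
        using K by (intro power_le_one) auto
      then have "exp (- 1 / 2) \<le> exp (- (1 / K * norm (Y t \<omega>))\<^sup>2 / 2)" by simp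
      moreover have "1 / 2 \<le> exp (- 1 / 2 :: real)"
        using exp_ge_add_one_self[of "- 1 / 2 :: real"] by simp
      ultimately have "1 / 2 \<le> exp (- (1 / K * norm (Y t \<omega>))\<^sup>2 / 2)" by linarith
      then show ?thesis by (simp add: indicator_def)
    qed (simp add: indicator_def)
    have "1 / 2 * prob (?E t)
        = (LINT \<omega>|M. 1 / 2 * indicator (?E t) \<omega>)"
      by simp
    also have "\<dots> \<le> (LINT \<omega>|M. exp (- (1 / K * norm (Y t \<omega>))\<^sup>2 / 2))"
    proof (rule integral_mono)
      show "integrable M (\<lambda>\<omega>. 1 / 2 * indicator (?E t) \<omega> :: real)"
        by (rule integrable_const_bound[where B = 1]) (auto simp: indicator_def)
      show "integrable M (\<lambda>\<omega>. exp (- (1 / K * norm (Y t \<omega>))\<^sup>2 / 2))"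
        by (rule integrable_const_bound[where B = 1]) auto
    qed (rule low)
    also have "\<dots> = (LINT u|std_normal_distribution. ?\<phi> u)"
      using t by (intro stable_smoothing[OF \<open>prob_space M\<close> Y _ dim]) simp
    also have "\<dots> = enn2real (\<integral>\<^sup>+u. ennreal (?\<phi> u) \<partial>std_normal_distribution)"
      by (rule integral_eq_nn_integral) auto
    also have "\<dots> \<le> enn2real (\<integral>\<^sup>+u. ennreal (?\<phi> u) \<partial>lborel)"
    proof (rule enn2real_mono)
      show "(\<integral>\<^sup>+u. ennreal (?\<phi> u) \<partial>std_normal_distribution)
          \<le> (\<integral>\<^sup>+u. ennreal (?\<phi> u) \<partial>lborel)"
        by (subst nn_integral_density)
           (auto intro!: nn_integral_mono ennreal_leI mult_left_le_one_le density_le simp flip: ennreal_mult)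
      show "(\<integral>\<^sup>+u. ennreal (?\<phi> u) \<partial>lborel) < \<top>"
        unfolding eq by simp
    qed
    also have "\<dots> = s * J"
      unfolding eq using J s by simp
    finally have "prob (?E t) \<le> 2 * K * J * t powr (- 1 / \<alpha>)"
      by (simp add: s_def mult_ac)
    then show ?thesis
      by (simp add: distrib_right add_increasing2)
  qed
  moreover have "0 < 2 * K * J + 1" using K J by (intro add_nonneg_pos) auto
  ultimately show ?thesis using that by blast
qed

text \<open>Where \<open>norm (Y t \<omega>)\<close> exceeds \<open>R\<close>, the Gaussian function of width \<open>R\<close> is below 2/3. On the
  other hand its mean differs from 1 by at most the Gaussian mean of the exponent
  \<open>c * t * \<bar>u / R\<bar> powr \<alpha>\<close>, where \<open>\<bar>u\<bar> powr \<alpha> \<le> 1 + u\<^sup>2\<close> as \<open>\<alpha> \<le> 2\<close>.\<close>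

lemma stable_tail:
  fixes Y :: "real \<Rightarrow> 'w \<Rightarrow> 'a::euclidean_space"
  assumes "prob_space M" and Y: "symmetric_stable_process M \<alpha> c Y" and dim: "DIM('a) = 1"
    and \<alpha>: "0 < \<alpha>" "\<alpha> \<le> 2" and t: "0 \<le> t" and R: "0 < R"
  shows "measure M {\<omega> \<in> space M. R < norm (Y t \<omega>)} \<le> 6 * c * t * R powr (- \<alpha>)"
proof -
  interpret prob_space M by fact
  interpret S: prob_space std_normal_distribution
    by (rule prob_space_normal_density) simp
  note total = std_normal_total
  have c: "0 < c" using Y by (simp add: symmetric_stable_process_def)
  have [measurable]: "Y t \<in> borel_measurable M"
    using Y t by (rule stable_process_measurable)
  let ?e = "\<lambda>\<omega>. exp (- (1 / R * norm (Y t \<omega>))\<^sup>2 / 2)"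
  have exp_half: "exp (- 1 / 2 :: real) \<le> 2 / 3"
    using exp_ge_add_one_self[of "1 / 2 :: real"] by (simp add: exp_minus field_simps)
  have low: "1 / 3 * indicator {\<omega> \<in> space M. R < norm (Y t \<omega>)} \<omega> \<le> 1 - ?e \<omega>" for \<omega>
  proof (cases "R < norm (Y t \<omega>)")
    case True
    then have "1 \<le> (1 / R * norm (Y t \<omega>))\<^sup>2"
      using R by (intro one_le_power) auto
    then have "?e \<omega> \<le> exp (- 1 / 2)" by simp
    then have "?e \<omega> \<le> 2 / 3" using exp_half by (rule order_trans)
    then show ?thesis by (simp add: indicator_def)
  qed (simp add: indicator_def)
  have int_e: "integrable M ?e"
    by (rule integrable_const_bound[where B = 1]) auto
  have int_s: "integrable std_normal_distribution (\<lambda>u. exp (- (c * t * \<bar>1 / R * u\<bar> powr \<alpha>)))"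
    by (rule S.integrable_const_bound[where B = 1]) (use c t in auto)
  have int_sq: "integrable std_normal_distribution (\<lambda>u. 1 + u\<^sup>2)"
    using integrable_std_normal_moment[of 2] by (subst integrable_density) (auto simp: ring_distribs)
  have sq: "(LINT u|std_normal_distribution. 1 + u\<^sup>2) = 2"
    using integral_std_normal_moment_even[of 1] integrable_std_normal_moment[of 2] S.prob_space
    by (subst integral_density) (auto simp: ring_distribs)
  have "1 / 3 * prob {\<omega> \<in> space M. R < norm (Y t \<omega>)}
      = (LINT \<omega>|M. 1 / 3 * indicator {\<omega> \<in> space M. R < norm (Y t \<omega>)} \<omega>)"
    by simp
  also have "\<dots> \<le> (LINT \<omega>|M. 1 - ?e \<omega>)"
  proof (rule integral_mono)
    show "integrable M (\<lambda>\<omega>. 1 / 3 * indicator {\<omega> \<in> space M. R < norm (Y t \<omega>)} \<omega> :: real)"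
      by (rule integrable_const_bound[where B = 1]) (auto simp: indicator_def)
    show "integrable M (\<lambda>\<omega>. 1 - ?e \<omega>)"
      by (intro Bochner_Integration.integrable_diff int_e) simp
  qed (rule low)
  also have "\<dots> = (LINT u|std_normal_distribution. 1 - exp (- (c * t * \<bar>1 / R * u\<bar> powr \<alpha>)))"
    using int_e int_s stable_smoothing[OF \<open>prob_space M\<close> Y t dim, of "1 / R"] by (simp add: prob_space total)
  also have "\<dots> \<le> (LINT u|std_normal_distribution. (c * t * R powr (- \<alpha>)) * (1 + u\<^sup>2))"
  proof (rule integral_mono)
    fix u
    have "1 - exp (- (c * t * \<bar>1 / R * u\<bar> powr \<alpha>)) \<le> c * t * \<bar>1 / R * u\<bar> powr \<alpha>"
      using exp_ge_add_one_self[of "- (c * t * \<bar>1 / R * u\<bar> powr \<alpha>)"] by linarith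
    also have "\<dots> \<le> (c * t * R powr (- \<alpha>)) * (1 + u\<^sup>2)"
    proof -
      have scale: "\<bar>1 / R * u\<bar> powr \<alpha> = R powr (- \<alpha>) * \<bar>u\<bar> powr \<alpha>"
        using R by (simp add: abs_mult powr_mult powr_divide powr_minus_divide)
      have "\<bar>u\<bar> powr \<alpha> \<le> 1 + u\<^sup>2"
      proof (cases "\<bar>u\<bar> \<le> 1")
        case True
        then have "\<bar>u\<bar> powr \<alpha> \<le> 1" using \<alpha> by (intro powr_le1) auto
        then show ?thesis by (simp add: add_increasing2)
      next
        case False
        then have "\<bar>u\<bar> powr \<alpha> \<le> \<bar>u\<bar> powr 2" using \<alpha> by (intro powr_mono) auto
        then show ?thesis using False by simp
      qed
      then have "(c * t * R powr (- \<alpha>)) * \<bar>u\<bar> powr \<alpha> \<le> (c * t * R powr (- \<alpha>)) * (1 + u\<^sup>2)"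
        using c t by (intro mult_left_mono) auto
      then show ?thesis by (simp only: scale mult.assoc)
    qed
    finally show "1 - exp (- (c * t * \<bar>1 / R * u\<bar> powr \<alpha>)) \<le> (c * t * R powr (- \<alpha>)) * (1 + u\<^sup>2)" .
  qed (use int_s int_sq in auto)
  also have "\<dots> = (c * t * R powr (- \<alpha>)) * 2"
    using sq by simp
  finally show ?thesis by simp
qed

lemma stable_marginal_law_unique:
  fixes Y Y' :: "real \<Rightarrow> 'w \<Rightarrow> 'a::euclidean_space"
  assumes "prob_space M" and Y: "symmetric_stable_process M \<alpha> c Y" and Y': "symmetric_stable_process M \<alpha> c Y'"
    and t: "0 \<le> t" and dim: "DIM('a) = 1"
  shows "distr M borel (Y t) = distr M borel (Y' t)"
proof -
  interpret prob_space M by fact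
  obtain b :: 'a where b: "norm b = 1" "\<And>x. x = (x \<bullet> b) *\<^sub>R b"
    using one_dimensional_basis[OF dim] by metis
  have [measurable]: "Y t \<in> borel_measurable M" "Y' t \<in> borel_measurable M"
    using Y Y' t by (auto intro: stable_process_measurable)
  have char_eq: "char (distr M borel (\<lambda>\<omega>. Z t \<omega> \<bullet> b)) = (\<lambda>u. complex_of_real (exp (- (c * t * \<bar>u\<bar> powr \<alpha>))))"
    if Z: "symmetric_stable_process M \<alpha> c Z" for Z :: "real \<Rightarrow> 'w \<Rightarrow> 'a"
  proof
    fix u
    have [measurable]: "Z t \<in> borel_measurable M" using Z t by (rule stable_process_measurable)
    show "char (distr M borel (\<lambda>\<omega>. Z t \<omega> \<bullet> b)) u = complex_of_real (exp (- (c * t * \<bar>u\<bar> powr \<alpha>)))"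
      unfolding char_def stable_characteristic[OF Z t b(1), symmetric] by (rule integral_distr) measurable
  qed
  have eq: "distr M borel (\<lambda>\<omega>. Y t \<omega> \<bullet> b) = distr M borel (\<lambda>\<omega>. Y' t \<omega> \<bullet> b)"
    by (rule Levy_uniqueness)
       (auto simp: char_eq[OF Y] char_eq[OF Y'] intro!: real_distribution_distr)
  have rep: "distr M borel (Z t) = distr (distr M borel (\<lambda>\<omega>. Z t \<omega> \<bullet> b)) borel (\<lambda>s. s *\<^sub>R b)"
    if [measurable]: "Z t \<in> borel_measurable M" for Z :: "real \<Rightarrow> 'w \<Rightarrow> 'a"
    by (subst distr_distr) (auto simp: o_def b(2)[symmetric])
  have "distr M borel (Y t) = distr (distr M borel (\<lambda>\<omega>. Y t \<omega> \<bullet> b)) borel (\<lambda>s. s *\<^sub>R b)"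
    by (rule rep) measurable
  also have "\<dots> = distr (distr M borel (\<lambda>\<omega>. Y' t \<omega> \<bullet> b)) borel (\<lambda>s. s *\<^sub>R b)"
    unfolding eq ..
  also have "\<dots> = distr M borel (Y' t)"
    by (rule rep[symmetric]) measurable
  finally show ?thesis .
qed

section \<open>Occupation times of a single particle\<close>

lemma nn_integral_cube:
  fixes f :: "'s \<Rightarrow> 'q \<Rightarrow> ennreal"
  assumes "sigma_finite_measure S" "sigma_finite_measure Q"
    and f: "(\<lambda>p. f (fst p) (snd p)) \<in> borel_measurable (S \<Otimes>\<^sub>M Q)"
  shows "(\<integral>\<^sup>+z. (\<integral>\<^sup>+s. f s z \<partial>S) ^ 3 \<partial>Q)
    = (\<integral>\<^sup>+s. \<integral>\<^sup>+t. \<integral>\<^sup>+v. \<integral>\<^sup>+z. f s z * f t z * f v z \<partial>Q \<partial>S \<partial>S \<partial>S)"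
proof -
  interpret S: sigma_finite_measure S by fact
  interpret Q: sigma_finite_measure Q by fact
  interpret SQ: pair_sigma_finite S Q ..
  have f_comp: "(\<lambda>p. f (a p) (b p)) \<in> borel_measurable N"
    if "a \<in> measurable N S" "b \<in> measurable N Q" for N :: "'n measure" and a b
    using measurable_compose[OF measurable_Pair[OF that] f] by simp
  have [measurable]: "z \<in> space Q \<Longrightarrow> (\<lambda>s. f s z) \<in> borel_measurable S" for z
    by (rule f_comp) auto
  have "(\<integral>\<^sup>+z. (\<integral>\<^sup>+s. f s z \<partial>S) ^ 3 \<partial>Q) = (\<integral>\<^sup>+z. \<integral>\<^sup>+s. \<integral>\<^sup>+t. \<integral>\<^sup>+v. f s z * f t z * f v z \<partial>S \<partial>S \<partial>S \<partial>Q)"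
    by (rule nn_integral_cong)
       (simp add: nn_integral_cmult nn_integral_multc power3_eq_cube mult.assoc)
  also have "\<dots> = (\<integral>\<^sup>+s. \<integral>\<^sup>+z. \<integral>\<^sup>+t. \<integral>\<^sup>+v. f s z * f t z * f v z \<partial>S \<partial>S \<partial>Q \<partial>S)"
  proof (rule SQ.Fubini')
    show "(\<lambda>(s, z). \<integral>\<^sup>+t. \<integral>\<^sup>+v. f s z * f t z * f v z \<partial>S \<partial>S) \<in> borel_measurable (S \<Otimes>\<^sub>M Q)"
      unfolding case_prod_beta
      by (intro S.borel_measurable_nn_integral)
         (unfold case_prod_beta, intro S.borel_measurable_nn_integral,
           unfold case_prod_beta, intro borel_measurable_times_ennreal f_comp, measurable)
  qed
  also have "\<dots> = (\<integral>\<^sup>+s. \<integral>\<^sup>+t. \<integral>\<^sup>+z. \<integral>\<^sup>+v. f s z * f t z * f v z \<partial>S \<partial>Q \<partial>S \<partial>S)"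
  proof (rule nn_integral_cong)
    fix s assume s: "s \<in> space S"
    show "(\<integral>\<^sup>+z. \<integral>\<^sup>+t. \<integral>\<^sup>+v. f s z * f t z * f v z \<partial>S \<partial>S \<partial>Q) = (\<integral>\<^sup>+t. \<integral>\<^sup>+z. \<integral>\<^sup>+v. f s z * f t z * f v z \<partial>S \<partial>Q \<partial>S)"
    proof (rule SQ.Fubini'[of "\<lambda>t z. \<integral>\<^sup>+v. f s z * f t z * f v z \<partial>S"])
      show "(\<lambda>(t, z). \<integral>\<^sup>+v. f s z * f t z * f v z \<partial>S) \<in> borel_measurable (S \<Otimes>\<^sub>M Q)"
        unfolding case_prod_beta
        by (intro S.borel_measurable_nn_integral)
           (unfold case_prod_beta, intro borel_measurable_times_ennreal f_comp,
             use s in simp_all)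
    qed
  qed
  also have "\<dots> = (\<integral>\<^sup>+s. \<integral>\<^sup>+t. \<integral>\<^sup>+v. \<integral>\<^sup>+z. f s z * f t z * f v z \<partial>Q \<partial>S \<partial>S \<partial>S)"
  proof (intro nn_integral_cong)
    fix s t assume s: "s \<in> space S" "t \<in> space S"
    show "(\<integral>\<^sup>+z. \<integral>\<^sup>+v. f s z * f t z * f v z \<partial>S \<partial>Q) = (\<integral>\<^sup>+v. \<integral>\<^sup>+z. f s z * f t z * f v z \<partial>Q \<partial>S)"
    proof (rule SQ.Fubini'[of "\<lambda>v z. f s z * f t z * f v z"])
      show "(\<lambda>(v, z). f s z * f t z * f v z) \<in> borel_measurable (S \<Otimes>\<^sub>M Q)"
        unfolding case_prod_beta
        by (intro borel_measurable_times_ennreal f_comp) (use s in simp_all)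
    qed
  qed
  finally show ?thesis .
qed

lemma nn_integral_abs_powr:
  assumes \<beta>: "0 < \<beta>" and r: "0 \<le> r"
  shows "(\<integral>\<^sup>+v. ennreal (\<bar>v\<bar> powr (\<beta> - 1)) * indicator {-r..r} v \<partial>lborel) \<le> ennreal (2 * (r powr \<beta> / \<beta>))"
proof -
  define h where "h v = v powr (\<beta> - 1) * indicator {0..r} v" for v :: real
  have [measurable]: "h \<in> borel_measurable borel"
    unfolding h_def[abs_def] by measurable
  have "h = (\<lambda>v. if v \<in> {0..r} then v powr (\<beta> - 1) else 0)"
    by (auto simp: h_def fun_eq_iff)
  then have hi: "(h has_integral (r powr \<beta> / \<beta>)) UNIV"
    using has_integral_powr_from_0[of "\<beta> - 1" r] \<beta> r by (simp only: has_integral_restrict_UNIV) simp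
  have h: "(\<integral>\<^sup>+v. ennreal (h v) \<partial>lborel) = ennreal (r powr \<beta> / \<beta>)"
    by (rule nn_integral_has_integral_lborel[OF _ _ hi]) (auto simp: h_def[of x for x])
  have h': "(\<integral>\<^sup>+v. ennreal (h (- v)) \<partial>lborel) = ennreal (r powr \<beta> / \<beta>)"
    using nn_integral_real_affine[of "\<lambda>v. ennreal (h v)" "- 1" 0] h by simp
  have "(\<integral>\<^sup>+v. ennreal (\<bar>v\<bar> powr (\<beta> - 1)) * indicator {-r..r} v \<partial>lborel) \<le> (\<integral>\<^sup>+v. ennreal (h v) + ennreal (h (- v)) \<partial>lborel)"
    by (rule nn_integral_mono) (auto simp: h_def indicator_def abs_if)
  also have "\<dots> = ennreal (2 * (r powr \<beta> / \<beta>))"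
    using h h' \<beta> by (simp add: nn_integral_add flip: ennreal_plus)
  finally show ?thesis .
qed

definition path_occupation :: "('a::euclidean_space \<Rightarrow> real) \<Rightarrow> real \<Rightarrow> 'a \<times> (real \<Rightarrow> 'a) \<Rightarrow> ennreal" where
  "path_occupation \<psi> r z = (\<integral>\<^sup>+t. ennreal (\<psi> (fst z + path_eval (snd z) t)) * indicator {0..r} t \<partial>lborel)"

lemma measurable_path_eval_pair:
  assumes "f \<in> measurable N path_space" "g \<in> borel_measurable N"
  shows "(\<lambda>x. path_eval (f x) (g x)) \<in> borel_measurable N"
  using measurable_compose[OF measurable_Pair[OF assms] measurable_path_eval] by simp

lemma measurable_path_occupation:
  assumes [measurable]: "\<psi> \<in> borel_measurable borel"
  shows "path_occupation \<psi> r \<in> borel_measurable (borel \<Otimes>\<^sub>M path_space)"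
  unfolding path_occupation_def[abs_def]
proof (rule lborel.borel_measurable_nn_integral)
  have [measurable]: "(\<lambda>p. path_eval (snd (fst p)) (snd p)) \<in> borel_measurable ((borel \<Otimes>\<^sub>M path_space) \<Otimes>\<^sub>M lborel)"
    by (rule measurable_path_eval_pair) measurable
  show "(\<lambda>(z, t). ennreal (\<psi> (fst z + path_eval (snd z) t)) * indicator {0..r} t)
      \<in> borel_measurable ((borel \<Otimes>\<^sub>M path_space) \<Otimes>\<^sub>M lborel)"
    unfolding case_prod_beta by measurable
qed

lemma nn_integral_lborel_shift:
  fixes f :: "'a::euclidean_space \<Rightarrow> ennreal"
  assumes [measurable]: "f \<in> borel_measurable borel"
  shows "(\<integral>\<^sup>+x. f (x + y) \<partial>lborel) = (\<integral>\<^sup>+x. f x \<partial>lborel)"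
proof -
  have "(\<integral>\<^sup>+x. f x \<partial>lborel) = (\<integral>\<^sup>+x. f x \<partial>distr lborel borel ((+) y))"
    by (simp only: lborel_distr_plus)
  then show ?thesis by (simp add: nn_integral_distr add.commute)
qed

text \<open>One particle with displacement \<open>Y\<close>. In the moments below its starting point ranges over Lebesgue
  measure, which up to constant factors is the intensity of the points.\<close>

locale stable_particle = prob_space M
  for M :: "'w measure" +
  fixes Y :: "real \<Rightarrow> 'w \<Rightarrow> 'a::euclidean_space" and \<alpha> c :: real and \<psi> :: "'a \<Rightarrow> real" and B K :: real
  assumes stable: "symmetric_stable_process M \<alpha> c Y" and dim: "DIM('a) = 1"
    and \<alpha>: "1 < \<alpha>" "\<alpha> \<le> 2"
    and \<psi> [measurable]: "\<psi> \<in> borel_measurable borel"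
    and \<psi>_bounds: "\<And>x. 0 \<le> \<psi> x" "\<And>x. \<psi> x \<le> B"
    and \<psi>_support: "\<And>x. \<psi> x \<noteq> 0 \<Longrightarrow> norm x \<le> K" and K: "0 < K"
begin

lemma levy: "levy_process M Y" and c_pos: "0 < c"
  using stable by (simp_all add: symmetric_stable_process_def)

lemma measurable_Y: "0 \<le> t \<Longrightarrow> Y t \<in> borel_measurable M"
  using stable by (rule stable_process_measurable)

lemma path_eval_Y: "\<omega> \<in> space M \<Longrightarrow> 0 \<le> t \<Longrightarrow> path_eval (path_of Y \<omega>) t = Y t \<omega>"
  using levy path_eval_cadlag[of "\<lambda>t. Y t \<omega>" t] by (simp add: levy_process_def)

lemma measurable_path_Y [measurable]: "path_of Y \<in> measurable M path_space"
  by (rule measurable_path_of) (rule measurable_Y)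

text \<open>\<open>occ r (x, \<omega>)\<close> is the integral of \<open>\<psi>\<close> up to time \<open>r\<close> along the path started from \<open>x\<close>, and
  \<open>hit r t\<close> is its integrand.\<close>

definition occ :: "real \<Rightarrow> 'a \<times> 'w \<Rightarrow> ennreal" where
  "occ r z = path_occupation \<psi> r (fst z, path_of Y (snd z))"

definition hit :: "real \<Rightarrow> real \<Rightarrow> 'a \<times> 'w \<Rightarrow> ennreal" where
  "hit r t z = ennreal (\<psi> (fst z + path_eval (path_of Y (snd z)) t)) * indicator {0..r} t"

lemma occ_eq: "occ r z = (\<integral>\<^sup>+t. hit r t z \<partial>lborel)"
  by (simp add: occ_def hit_def path_occupation_def)

lemma measurable_occ [measurable]: "occ r \<in> borel_measurable (borel \<Otimes>\<^sub>M M)"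
  unfolding occ_def[abs_def]
  by (rule measurable_compose[OF _ measurable_path_occupation[OF \<psi>]])
     (intro measurable_Pair measurable_fst measurable_compose[OF measurable_snd measurable_path_Y])

lemma measurable_hit: "(\<lambda>p. hit r (fst p) (snd p)) \<in> borel_measurable (lborel \<Otimes>\<^sub>M (borel \<Otimes>\<^sub>M M))"
proof -
  have [measurable]: "(\<lambda>p. path_eval (path_of Y (snd (snd p))) (fst p)) \<in> borel_measurable (lborel \<Otimes>\<^sub>M (borel \<Otimes>\<^sub>M M))"
    by (rule measurable_path_eval_pair) (auto intro!: measurable_compose[OF _ measurable_path_Y])
  show ?thesis
    unfolding hit_def[abs_def] by measurable
qed

abbreviation Q :: "('a \<times> 'w) measure" where
  "Q \<equiv> lborel \<Otimes>\<^sub>M M"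

sublocale LM: pair_sigma_finite "lborel :: 'a measure" M ..

lemma measurable_hit_section: "hit r t \<in> borel_measurable Q"
  using measurable_compose[OF measurable_Pair1'[of t lborel] measurable_hit[of r]]
  by (simp cong: measurable_cong_sets sets_pair_measure_cong)

abbreviation close :: "real \<Rightarrow> real" where
  "close t \<equiv> measure M {\<omega> \<in> space M. norm (Y t \<omega>) \<le> 2 * K}"

lemma increment_close_product:
  assumes "0 \<le> s" "s \<le> t" "t \<le> v"
  shows "(\<integral>\<^sup>+\<omega>. indicator (cball 0 (2 * K)) (Y t \<omega> - Y s \<omega>) * indicator (cball 0 (2 * K)) (Y v \<omega> - Y t \<omega>) \<partial>M)
    = ennreal (close (t - s)) * ennreal (close (v - t))"
proof -
  define \<tau> where "\<tau> j = (if j = 0 then s else if j = 1 then t else v)" for j :: nat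
  have "mono \<tau>" using assms by (auto simp: mono_def \<tau>_def)
  then have "indep_vars (\<lambda>_. borel) (\<lambda>j \<omega>. Y (\<tau> (Suc j)) \<omega> - Y (\<tau> j) \<omega>) UNIV"
    using levy assms by (auto simp: levy_process_def \<tau>_def)
  then have "indep_vars (\<lambda>_. borel) (\<lambda>j \<omega>. Y (\<tau> (Suc j)) \<omega> - Y (\<tau> j) \<omega>) {0, 1}"
    by (rule indep_vars_subset) simp
  then have "indep_vars (\<lambda>_. borel) (\<lambda>j \<omega>. indicator (cball 0 (2 * K)) (Y (\<tau> (Suc j)) \<omega> - Y (\<tau> j) \<omega>) :: ennreal) {0, 1}"
    by (rule indep_vars_compose2[where Y = "\<lambda>_. indicator (cball 0 (2 * K))"])
       (intro borel_measurable_indicator borel_closed closed_cball)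
  from indep_vars_nn_integral[OF _ this]
  have "(\<integral>\<^sup>+\<omega>. indicator (cball 0 (2 * K)) (Y t \<omega> - Y s \<omega>) * indicator (cball 0 (2 * K)) (Y v \<omega> - Y t \<omega>) \<partial>M)
    = (\<integral>\<^sup>+\<omega>. indicator (cball 0 (2 * K)) (Y t \<omega> - Y s \<omega>) \<partial>M) * (\<integral>\<^sup>+\<omega>. indicator (cball 0 (2 * K)) (Y v \<omega> - Y t \<omega>) \<partial>M)"
    by (simp add: \<tau>_def)
  moreover have "(\<integral>\<^sup>+\<omega>. indicator (cball 0 (2 * K)) (Y t \<omega> - Y s \<omega>) \<partial>M) = ennreal (close (t - s))"
    if "0 \<le> s" "s \<le> t" for s t
  proof -
    have [measurable]: "Y s \<in> borel_measurable M" "Y t \<in> borel_measurable M" "Y (t - s) \<in> borel_measurable M"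
      using that by (auto intro: measurable_Y)
    have "(\<integral>\<^sup>+\<omega>. indicator (cball 0 (2 * K)) (Y t \<omega> - Y s \<omega>) \<partial>M)
        = (\<integral>\<^sup>+x. indicator (cball 0 (2 * K)) x \<partial>distr M borel (\<lambda>\<omega>. Y t \<omega> - Y s \<omega>))"
      by (rule nn_integral_distr[symmetric]) (auto intro!: borel_measurable_indicator)
    also have "distr M borel (\<lambda>\<omega>. Y t \<omega> - Y s \<omega>) = distr M borel (Y (t - s))"
      using levy that by (simp add: levy_process_def)
    also have "(\<integral>\<^sup>+x. indicator (cball 0 (2 * K)) x \<partial>distr M borel (Y (t - s))) = emeasure M (Y (t - s) -` cball 0 (2 * K) \<inter> space M)"
      by (simp add: emeasure_distr)
    also have "Y (t - s) -` cball 0 (2 * K) \<inter> space M = {\<omega> \<in> space M. norm (Y (t - s) \<omega>) \<le> 2 * K}"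
      by auto
    finally show ?thesis by (simp add: emeasure_eq_measure)
  qed
  ultimately show ?thesis using assms by simp
qed

text \<open>If the path is in the support of \<open>\<psi>\<close> at three successive times, both increments have norm at
  most \<open>2 * K\<close>. The increments are independent, and the integral over the starting point only sees
  the remaining factor \<open>\<psi>\<close>.\<close>

lemma hit_triple_ordered:
  assumes r: "0 \<le> s" "s \<le> t" "t \<le> v" "v \<le> r"
  shows "(\<integral>\<^sup>+z. hit r s z * hit r t z * hit r v z \<partial>Q)
    \<le> ennreal (B\<^sup>2) * (\<integral>\<^sup>+x. ennreal (\<psi> x) \<partial>lborel) * (ennreal (close (t - s)) * ennreal (close (v - t)))"
proof -
  define D where "D = (indicator (cball 0 (2 * K)) :: 'a \<Rightarrow> ennreal)"
  have [measurable]: "D \<in> borel_measurable borel"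
    unfolding D_def by (intro borel_measurable_indicator borel_closed closed_cball)
  have B: "0 \<le> B" using \<psi>_bounds[of 0] by simp
  have [measurable]: "Y s \<in> borel_measurable M" "Y t \<in> borel_measurable M" "Y v \<in> borel_measurable M"
    using r by (auto intro: measurable_Y)
  have pointwise: "hit r s (x, \<omega>) * hit r t (x, \<omega>) * hit r v (x, \<omega>)
      \<le> ennreal (\<psi> (x + Y s \<omega>)) * (ennreal (B\<^sup>2) * (D (Y t \<omega> - Y s \<omega>) * D (Y v \<omega> - Y t \<omega>)))"
    if \<omega>: "\<omega> \<in> space M" for x \<omega>
  proof (cases "\<psi> (x + Y s \<omega>) \<noteq> 0 \<and> \<psi> (x + Y t \<omega>) \<noteq> 0 \<and> \<psi> (x + Y v \<omega>) \<noteq> 0")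
    case True
    then have *: "norm (x + Y s \<omega>) \<le> K" "norm (x + Y t \<omega>) \<le> K" "norm (x + Y v \<omega>) \<le> K"
      using \<psi>_support by auto
    have "norm (Y t \<omega> - Y s \<omega>) \<le> 2 * K" "norm (Y v \<omega> - Y t \<omega>) \<le> 2 * K"
      using norm_triangle_ineq4[of "x + Y t \<omega>" "x + Y s \<omega>"] norm_triangle_ineq4[of "x + Y v \<omega>" "x + Y t \<omega>"] * by auto
    moreover have "\<psi> (x + Y s \<omega>) * \<psi> (x + Y t \<omega>) * \<psi> (x + Y v \<omega>) \<le> \<psi> (x + Y s \<omega>) * B\<^sup>2"
      unfolding power2_eq_square mult.assoc using \<psi>_bounds B by (intro mult_left_mono mult_mono) auto
    ultimately show ?thesis
      using r \<psi>_bounds B \<omega> by (simp add: D_def hit_def path_eval_Y flip: ennreal_mult)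
  next
    case False
    then have "hit r s (x, \<omega>) * hit r t (x, \<omega>) * hit r v (x, \<omega>) = 0"
      using r \<omega> by (auto simp: hit_def path_eval_Y)
    then show ?thesis by (rule ord_eq_le_trans) (rule zero_le)
  qed
  have "(\<integral>\<^sup>+z. hit r s z * hit r t z * hit r v z \<partial>Q)
      \<le> (\<integral>\<^sup>+z. ennreal (\<psi> (fst z + Y s (snd z))) * (ennreal (B\<^sup>2) * (D (Y t (snd z) - Y s (snd z)) * D (Y v (snd z) - Y t (snd z)))) \<partial>Q)"
    by (rule nn_integral_mono) (use pointwise in \<open>auto simp: space_pair_measure\<close>)
  also have "\<dots> = (\<integral>\<^sup>+\<omega>. \<integral>\<^sup>+x. ennreal (\<psi> (x + Y s \<omega>)) * (ennreal (B\<^sup>2) * (D (Y t \<omega> - Y s \<omega>) * D (Y v \<omega> - Y t \<omega>))) \<partial>lborel \<partial>M)"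
  proof -
    define G where "G z = ennreal (\<psi> (fst z + Y s (snd z))) * (ennreal (B\<^sup>2) * (D (Y t (snd z) - Y s (snd z)) * D (Y v (snd z) - Y t (snd z))))" for z
    have "G \<in> borel_measurable Q"
      unfolding G_def[abs_def] by measurable
    from LM.nn_integral_snd[OF this] show ?thesis by (simp add: G_def[abs_def])
  qed
  also have "\<dots> = (\<integral>\<^sup>+\<omega>. (\<integral>\<^sup>+x. ennreal (\<psi> x) \<partial>lborel) * (ennreal (B\<^sup>2) * (D (Y t \<omega> - Y s \<omega>) * D (Y v \<omega> - Y t \<omega>))) \<partial>M)"
    by (rule nn_integral_cong)
       (simp add: nn_integral_multc nn_integral_lborel_shift[of "\<lambda>x. ennreal (\<psi> x)"])
  also have "\<dots> = (\<integral>\<^sup>+x. ennreal (\<psi> x) \<partial>lborel) * (ennreal (B\<^sup>2) * (ennreal (close (t - s)) * ennreal (close (v - t))))"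
    using increment_close_product[OF r(1-3), folded D_def] by (simp add: nn_integral_cmult)
  finally show ?thesis by (simp add: mult_ac)
qed

lemma integral_\<psi>_finite: "(\<integral>\<^sup>+x. ennreal (\<psi> x) \<partial>lborel) < \<infinity>"
proof -
  have "(\<integral>\<^sup>+x. ennreal (\<psi> x) \<partial>lborel) \<le> (\<integral>\<^sup>+x. ennreal B * indicator (cball (0::'a) K) x \<partial>lborel)"
    using \<psi>_bounds \<psi>_support by (intro nn_integral_mono) (auto simp: indicator_def intro!: ennreal_leI)
  also have "\<dots> = ennreal B * emeasure lborel (cball (0::'a) K)"
    by (simp add: nn_integral_cmult_indicator)
  also have "\<dots> < \<infinity>"
    using emeasure_lborel_cball_finite[of "0::'a" K] by (simp add: ennreal_mult_less_top)
  finally show ?thesis .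
qed

lemma mean_occ:
  assumes r: "0 \<le> r"
  shows "(\<integral>\<^sup>+z. occ r z \<partial>Q) = ennreal r * (\<integral>\<^sup>+x. ennreal (\<psi> x) \<partial>lborel)"
proof -
  interpret T: pair_sigma_finite "lborel :: real measure" Q
    using LM.sigma_finite_measure_axioms by (intro pair_sigma_finite.intro) (auto intro: sigma_finite_lborel)
  have [measurable]: "(\<lambda>p. hit r (fst p) (snd p)) \<in> borel_measurable (lborel \<Otimes>\<^sub>M Q)"
    using measurable_hit by (simp cong: measurable_cong_sets sets_pair_measure_cong)
  have "(\<integral>\<^sup>+z. occ r z \<partial>Q) = (\<integral>\<^sup>+t. \<integral>\<^sup>+z. hit r t z \<partial>Q \<partial>lborel)"
    unfolding occ_eq by (rule T.Fubini') (simp add: case_prod_beta)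
  also have "\<dots> = (\<integral>\<^sup>+t. (\<integral>\<^sup>+x. ennreal (\<psi> x) \<partial>lborel) * indicator {0..r} t \<partial>lborel)"
  proof (rule nn_integral_cong)
    fix t
    show "(\<integral>\<^sup>+z. hit r t z \<partial>Q) = (\<integral>\<^sup>+x. ennreal (\<psi> x) \<partial>lborel) * indicator {0..r} t"
    proof (cases "t \<in> {0..r}")
      case True
      have "(\<integral>\<^sup>+z. hit r t z \<partial>Q) = (\<integral>\<^sup>+\<omega>. \<integral>\<^sup>+x. hit r t (x, \<omega>) \<partial>lborel \<partial>M)"
        by (rule LM.nn_integral_snd[symmetric]) (simp add: measurable_hit_section)
      also have "\<dots> = (\<integral>\<^sup>+\<omega>. (\<integral>\<^sup>+x. ennreal (\<psi> x) \<partial>lborel) \<partial>M)"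
        by (rule nn_integral_cong)
          (use True in \<open>simp add: hit_def nn_integral_lborel_shift[of "\<lambda>x. ennreal (\<psi> x)"]\<close>)
      finally show ?thesis using True by (simp add: emeasure_space_1)
    qed (simp add: hit_def)
  qed
  also have "\<dots> = ennreal r * (\<integral>\<^sup>+x. ennreal (\<psi> x) \<partial>lborel)"
    using r by (subst nn_integral_cmult_indicator) (auto simp: mult.commute)
  finally show ?thesis .
qed

lemma occ_bounded:
  assumes r: "0 \<le> r"
  shows "occ r z \<le> ennreal (B * r)"
proof -
  have B: "0 \<le> B" using \<psi>_bounds[of 0] by simp
  have "occ r z \<le> (\<integral>\<^sup>+t. ennreal B * indicator {0..r} t \<partial>lborel)"
    unfolding occ_eq hit_def using \<psi>_bounds by (intro nn_integral_mono mult_right_mono ennreal_leI) auto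
  also have "\<dots> = ennreal (B * r)"
    using r B by (simp add: nn_integral_cmult_indicator ennreal_mult)
  finally show ?thesis .
qed

end

context stable_particle
begin

text \<open>The third power of the occupation time is a triple integral over times. For ordered times the
  mean of the integrand is at most a constant times \<open>g (s - t) * g (t - v)\<close>, where \<open>g u\<close> is of order
  \<open>\<bar>u\<bar> powr (- 1 / \<alpha>)\<close>. The symmetric kernel \<open>G\<close> bounds it for every order of the times, and the
  triple integral of \<open>G\<close> is of order \<open>r * (r powr (1 - 1 / \<alpha>))\<^sup>2\<close>.\<close>

theorem third_moment_occ:
  obtains C where "0 < C" and
    "\<And>r. 0 < r \<Longrightarrow> (\<integral>\<^sup>+z. occ r z ^ 3 \<partial>Q) \<le> ennreal (C * r powr (3 - 2 / \<alpha>))"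
proof -
  define \<beta> where "\<beta> = 1 - 1 / \<alpha>"
  have \<beta>: "0 < \<beta>" using \<alpha> by (simp add: \<beta>_def)
  obtain C where C: "0 < C" "\<And>t. 0 < t \<Longrightarrow> close t \<le> C * t powr (\<beta> - 1)"
    using stable_concentration[OF prob_space_axioms stable dim, of "2 * K"] \<alpha> K by (auto simp: \<beta>_def)
  define g where "g u = (if u = 0 then 1 else ennreal C * ennreal (\<bar>u\<bar> powr (\<beta> - 1)))" for u :: real
  have [measurable]: "g \<in> borel_measurable borel"
    unfolding g_def[abs_def] by measurable
  have g_even: "g (u - v) = g (v - u)" for u v
    by (simp add: g_def abs_minus_commute)
  have close_g: "ennreal (close (t - s)) \<le> g (s - t)" if "s \<le> t" for s t
    using C(2)[of "t - s"] C(1) that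
    by (auto simp: g_def abs_minus_commute simp flip: ennreal_mult intro!: ennreal_leI)
  obtain P where P: "(\<integral>\<^sup>+x. ennreal (\<psi> x) \<partial>lborel) = ennreal P" "0 \<le> P"
    using integral_\<psi>_finite by (cases "\<integral>\<^sup>+x. ennreal (\<psi> x) \<partial>lborel") auto
  define W where "W = ennreal (B\<^sup>2) * ennreal P"
  define G where "G s t v = g (s - t) * g (t - v) + g (s - t) * g (s - v) + g (s - v) * g (t - v)" for s t v
  have bound: "(\<integral>\<^sup>+z. occ r z ^ 3 \<partial>Q) \<le> ennreal (3 * B\<^sup>2 * P * (2 * C / \<beta>)\<^sup>2 * r powr (3 - 2 / \<alpha>))"
    if r: "0 < r" for r
  proof -
    define J where "J = ennreal (2 * C * (r powr \<beta> / \<beta>))"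
    let ?i = "indicator {0..r} :: real \<Rightarrow> ennreal"
    let ?I = "\<lambda>F. \<integral>\<^sup>+s. \<integral>\<^sup>+t. \<integral>\<^sup>+v. F s t v \<partial>lborel \<partial>lborel \<partial>lborel"
    let ?H = "\<lambda>s t v. \<integral>\<^sup>+z. hit r s z * hit r t z * hit r v z \<partial>Q"
    \<comment> \<open>the integral of \<open>g\<close> over a window of length \<open>2 * r\<close> around 0\<close>
    have time: "?i t * (\<integral>\<^sup>+s. g (t - s) * ?i s \<partial>lborel) \<le> ?i t * J" for t
    proof (cases "t \<in> {0..r}")
      case True
      have "(\<integral>\<^sup>+s. g (t - s) * ?i s \<partial>lborel) \<le> (\<integral>\<^sup>+s. g (t - s) * indicator {-r..r} (t - s) \<partial>lborel)"
        using True by (intro nn_integral_mono mult_left_mono) (auto simp: indicator_def)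
      also have "\<dots> = (\<integral>\<^sup>+u. g u * indicator {-r..r} u \<partial>lborel)"
        using nn_integral_real_affine[of "\<lambda>u. g u * indicator {-r..r} u" "- 1" t] by simp
      also have "\<dots> = (\<integral>\<^sup>+u. ennreal C * (ennreal (\<bar>u\<bar> powr (\<beta> - 1)) * indicator {-r..r} u) \<partial>lborel)"
      proof (rule nn_integral_cong_AE)
        show "AE u in lborel. g u * indicator {-r..r} u = ennreal C * (ennreal (\<bar>u\<bar> powr (\<beta> - 1)) * indicator {-r..r} u)"
          using AE_lborel_singleton[of "0::real"] by eventually_elim (simp add: g_def mult.assoc)
      qed
      also have "\<dots> \<le> ennreal C * ennreal (2 * (r powr \<beta> / \<beta>))"
        using nn_integral_abs_powr[OF \<beta>, of r] r by (subst nn_integral_cmult) (auto intro!: mult_left_mono)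
      also have "\<dots> = J"
        using C(1) \<beta> by (simp add: J_def mult_ac flip: ennreal_mult)
      finally show ?thesis by (rule mult_left_mono) simp
    qed simp
    have ordered: "?H s t v \<le> W * (g (s - t) * g (t - v))"
      if "0 \<le> s" "s \<le> t" "t \<le> v" "v \<le> r" for s t v
    proof -
      have "?H s t v
          \<le> W * (ennreal (close (t - s)) * ennreal (close (v - t)))"
        using hit_triple_ordered[OF that] by (simp add: W_def P)
      also have "\<dots> \<le> W * (g (s - t) * g (t - v))"
        using that by (intro mult_left_mono mult_mono close_g) auto
      finally show ?thesis .
    qed
    have triple: "?H s t v \<le> W * (G s t v * (?i s * ?i t * ?i v))" for s t v
    proof (cases "s \<in> {0..r} \<and> t \<in> {0..r} \<and> v \<in> {0..r}")
      case False
      then have "hit r s z * hit r t z * hit r v z = 0" for z by (auto simp: hit_def)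
      then have "?H s t v = (\<integral>\<^sup>+z. 0 \<partial>Q)"
        by (intro nn_integral_cong)
      then show ?thesis by (simp only: nn_integral_const mult_zero_left zero_le)
    next
      case True
      have le_G: "W * (g (s - t) * g (t - v)) \<le> W * G s t v" "W * (g (s - t) * g (s - v)) \<le> W * G s t v"
        "W * (g (s - v) * g (t - v)) \<le> W * G s t v"
        unfolding G_def by (intro mult_left_mono; simp add: add_increasing add_increasing2)+
      have "?H s t v \<le> W * G s t v"
      proof -
        consider "s \<le> t" "t \<le> v" | "v \<le> t" "t \<le> s" | "t \<le> s" "s \<le> v" | "v \<le> s" "s \<le> t"
          | "s \<le> v" "v \<le> t" | "t \<le> v" "v \<le> s" by linarith
        then show ?thesis
        proof cases
          case 1
          then show ?thesis using ordered[of s t v] True le_G(1) by (auto intro: order_trans)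
        next
          case 2
          then show ?thesis using ordered[of v t s] True le_G(1)
            by (auto intro: order_trans simp: mult_ac g_even[of v t] g_even[of t s])
        next
          case 3
          then show ?thesis using ordered[of t s v] True le_G(2)
            by (auto intro: order_trans simp: mult_ac g_even[of t s])
        next
          case 4
          then show ?thesis using ordered[of v s t] True le_G(2)
            by (auto intro: order_trans simp: mult_ac g_even[of v s])
        next
          case 5
          then show ?thesis using ordered[of s v t] True le_G(3)
            by (auto intro: order_trans simp: mult_ac g_even[of v t])
        next
          case 6
          then show ?thesis using ordered[of t v s] True le_G(3)
            by (auto intro: order_trans simp: mult_ac g_even[of v s])
        qed
      qed
      then show ?thesis using True by simp
    qed
    have inner: "?i t * (\<integral>\<^sup>+v. g (t - v) * ?i v \<partial>lborel) \<le> ?i t * J"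
      "(\<integral>\<^sup>+v. g (v - t) * ?i v \<partial>lborel) * ?i t \<le> ?i t * J" for t
      using time[of t] by (simp_all add: g_even[of _ t] mult.commute)
    \<comment> \<open>the two products in \<open>G\<close> in which \<open>v\<close> occurs only once; \<open>q\<close> picks its partner\<close>
    have T: "(?I (\<lambda>s t v. g (s - t) * ?i t * ?i s * (g (q s t - v) * ?i v))) \<le> ennreal r * J\<^sup>2"
      if q: "q = (\<lambda>s t. t) \<or> q = (\<lambda>s t. s)" for q :: "real \<Rightarrow> real \<Rightarrow> real"
    proof -
      have "(?I (\<lambda>s t v. g (s - t) * ?i t * ?i s * (g (q s t - v) * ?i v)))
          = (\<integral>\<^sup>+s. \<integral>\<^sup>+t. g (s - t) * (?i t * ?i s) * (\<integral>\<^sup>+v. g (q s t - v) * ?i v \<partial>lborel) \<partial>lborel \<partial>lborel)"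
        by (intro nn_integral_cong) (simp add: nn_integral_cmult mult.assoc)
      also have "\<dots> \<le> (\<integral>\<^sup>+s. \<integral>\<^sup>+t. (?i s * J) * (g (s - t) * ?i t) \<partial>lborel \<partial>lborel)"
      proof (intro nn_integral_mono)
        fix s t
        have "?i t * ?i s * (\<integral>\<^sup>+v. g (q s t - v) * ?i v \<partial>lborel) \<le> ?i t * ?i s * J"
          using q inner(1)[of s] inner(1)[of t] by (auto simp: indicator_def)
        then have "g (s - t) * (?i t * ?i s * (\<integral>\<^sup>+v. g (q s t - v) * ?i v \<partial>lborel)) \<le> g (s - t) * (?i t * ?i s * J)"
          by (rule mult_left_mono) simp
        then show "g (s - t) * (?i t * ?i s) * (\<integral>\<^sup>+v. g (q s t - v) * ?i v \<partial>lborel) \<le> (?i s * J) * (g (s - t) * ?i t)"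
          by (simp add: mult_ac)
      qed
      also have "\<dots> = (\<integral>\<^sup>+s. J * (?i s * (\<integral>\<^sup>+t. g (s - t) * ?i t \<partial>lborel)) \<partial>lborel)"
      proof (rule nn_integral_cong)
        fix s
        have "(\<integral>\<^sup>+t. (?i s * J) * (g (s - t) * ?i t) \<partial>lborel) = (?i s * J) * (\<integral>\<^sup>+t. g (s - t) * ?i t \<partial>lborel)"
          by (rule nn_integral_cmult) measurable
        then show "(\<integral>\<^sup>+t. (?i s * J) * (g (s - t) * ?i t) \<partial>lborel) = J * (?i s * (\<integral>\<^sup>+t. g (s - t) * ?i t \<partial>lborel))"
          by (simp only: mult_ac)
      qed
      also have "\<dots> \<le> (\<integral>\<^sup>+s. (J * J) * ?i s \<partial>lborel)"
      proof (intro nn_integral_mono)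
        fix s show "J * (?i s * (\<integral>\<^sup>+t. g (s - t) * ?i t \<partial>lborel)) \<le> (J * J) * ?i s"
          using mult_left_mono[OF inner(1)[of s], of J] by (simp add: mult_ac)
      qed
      also have "\<dots> = ennreal r * J\<^sup>2"
        using r by (subst nn_integral_cmult_indicator) (auto simp: power2_eq_square mult_ac)
      finally show ?thesis .
    qed
    \<comment> \<open>the third product has this form after interchanging \<open>t\<close> and \<open>v\<close>\<close>
    have T3: "(?I (\<lambda>s t v. g (s - v) * ?i v * ?i s * (g (t - v) * ?i t))) \<le> ennreal r * J\<^sup>2"
    proof -
      have "(?I (\<lambda>s t v. g (s - v) * ?i v * ?i s * (g (t - v) * ?i t)))
          = (\<integral>\<^sup>+s. \<integral>\<^sup>+v. \<integral>\<^sup>+t. g (s - v) * ?i v * ?i s * (g (t - v) * ?i t) \<partial>lborel \<partial>lborel \<partial>lborel)"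
      proof (rule nn_integral_cong)
        fix s
        show "(\<integral>\<^sup>+t. \<integral>\<^sup>+v. g (s - v) * ?i v * ?i s * (g (t - v) * ?i t) \<partial>lborel \<partial>lborel)
            = (\<integral>\<^sup>+v. \<integral>\<^sup>+t. g (s - v) * ?i v * ?i s * (g (t - v) * ?i t) \<partial>lborel \<partial>lborel)"
          by (rule lborel_pair.Fubini'[of "\<lambda>v t. g (s - v) * ?i v * ?i s * (g (t - v) * ?i t)"]) measurable
      qed
      also have "\<dots> = (?I (\<lambda>s t v. g (s - t) * ?i t * ?i s * (g (t - v) * ?i v)))"
        by (simp only: g_even[of _ t for t])
      also have "\<dots> \<le> ennreal r * J\<^sup>2"
        using T[of "\<lambda>s t. t"] by simp
      finally show ?thesis .
    qed
    have "(\<integral>\<^sup>+z. occ r z ^ 3 \<partial>Q)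
        = (?I (\<lambda>s t v. \<integral>\<^sup>+z. hit r s z * hit r t z * hit r v z \<partial>Q))"
      unfolding occ_eq
      by (rule nn_integral_cube[OF sigma_finite_lborel LM.sigma_finite_measure_axioms])
         (use measurable_hit in \<open>simp cong: measurable_cong_sets sets_pair_measure_cong\<close>)
    also have "\<dots> \<le> (?I (\<lambda>s t v. W * (G s t v * (?i s * ?i t * ?i v))))"
      by (intro nn_integral_mono triple)
    also have "\<dots> = (\<integral>\<^sup>+s. \<integral>\<^sup>+t. \<integral>\<^sup>+v. W * (g (s - t) * ?i t * ?i s * (g (t - v) * ?i v)
        + g (s - t) * ?i t * ?i s * (g (s - v) * ?i v) + g (s - v) * ?i v * ?i s * (g (t - v) * ?i t)) \<partial>lborel \<partial>lborel \<partial>lborel)"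
      by (intro nn_integral_cong) (simp add: G_def distrib_left distrib_right mult_ac)
    also have "\<dots> = W * ((?I (\<lambda>s t v. g (s - t) * ?i t * ?i s * (g (t - v) * ?i v)))
        + (?I (\<lambda>s t v. g (s - t) * ?i t * ?i s * (g (s - v) * ?i v)))
        + (?I (\<lambda>s t v. g (s - v) * ?i v * ?i s * (g (t - v) * ?i t))))"
      by (simp add: nn_integral_cmult nn_integral_add)
    also have "\<dots> \<le> W * (ennreal r * J\<^sup>2 + ennreal r * J\<^sup>2 + ennreal r * J\<^sup>2)"
      using T[of "\<lambda>s t. t"] T[of "\<lambda>s t. s"] T3 by (intro mult_left_mono add_mono) auto
    also have "\<dots> = ennreal (B\<^sup>2 * P * (3 * (r * (2 * C * (r powr \<beta> / \<beta>))\<^sup>2)))"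
      using P r C(1) \<beta> by (simp add: W_def J_def ennreal_power flip: ennreal_mult ennreal_plus)
    also have "B\<^sup>2 * P * (3 * (r * (2 * C * (r powr \<beta> / \<beta>))\<^sup>2)) = 3 * B\<^sup>2 * P * (2 * C / \<beta>)\<^sup>2 * r powr (3 - 2 / \<alpha>)"
    proof -
      have "r powr (3 - 2 / \<alpha>) = r powr (1 + \<beta> + \<beta>)" by (simp add: \<beta>_def)
      also have "\<dots> = r * (r powr \<beta>)\<^sup>2"
        using r by (simp only: powr_add) (simp add: power2_eq_square)
      finally show ?thesis by (simp add: power_mult_distrib power_divide)
    qed
    finally show ?thesis .
  qed
  show ?thesis
  proof (rule that)
    show "0 < 3 * B\<^sup>2 * P * (2 * C / \<beta>)\<^sup>2 + 1" using P by (intro add_nonneg_pos) auto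
    show "(\<integral>\<^sup>+z. occ r z ^ 3 \<partial>Q) \<le> ennreal ((3 * B\<^sup>2 * P * (2 * C / \<beta>)\<^sup>2 + 1) * r powr (3 - 2 / \<alpha>))"
      if "0 < r" for r
      using bound[OF that] by (rule order_trans) (auto intro!: ennreal_leI mult_right_mono)
  qed
qed

text \<open>Up to time \<open>r\<close> the path stays within distance \<open>R\<close>, of order \<open>r powr (1 / \<alpha>)\<close>, with probability
  at least one half at each single time. Hence the starting points in a ball of radius \<open>K + R\<close> already
  account for half of the mean occupation time, which is proportional to \<open>r\<close>. By the Cauchy-Schwarz
  inequality the second moment is at least the square of this divided by the volume of the ball, of
  order \<open>r powr (2 - 1 / \<alpha>)\<close>.\<close>

theorem second_moment_occ:
  assumes pos: "(\<integral>\<^sup>+x. ennreal (\<psi> x) \<partial>lborel) \<noteq> 0"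
  obtains C where "0 < C" and
    "\<And>r. 1 \<le> r \<Longrightarrow> ennreal (C * r powr (2 - 1 / \<alpha>)) \<le> (\<integral>\<^sup>+z. (occ r z)\<^sup>2 \<partial>Q)"
proof -
  obtain P where P: "(\<integral>\<^sup>+x. ennreal (\<psi> x) \<partial>lborel) = ennreal P" "0 < P"
    using integral_\<psi>_finite pos by (cases "\<integral>\<^sup>+x. ennreal (\<psi> x) \<partial>lborel") (auto simp: less_le)
  define V where "V = unit_ball_vol 1"
  have V: "0 < V" by (simp add: V_def)
  define D where "D = K + (12 * c) powr (1 / \<alpha>)"
  have D: "0 < D" using K by (simp add: D_def add_pos_nonneg)
  interpret T: pair_sigma_finite "lborel :: real measure" Q
    using LM.sigma_finite_measure_axioms by (intro pair_sigma_finite.intro) (auto intro: sigma_finite_lborel)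
  have lower: "ennreal (P\<^sup>2 / (4 * V * D) * r powr (2 - 1 / \<alpha>)) \<le> (\<integral>\<^sup>+z. (occ r z)\<^sup>2 \<partial>Q)"
    if r: "1 \<le> r" for r
  proof -
    \<comment> \<open>with this radius the tail bound \<open>6 * c * t * R powr (- \<alpha>)\<close> is 1/2 at time \<open>r\<close>\<close>
    define R where "R = (12 * c * r) powr (1 / \<alpha>)"
    have R: "0 < R" using r c_pos by (simp add: R_def)
    have R_powr: "R powr (- \<alpha>) = 1 / (12 * c * r)"
      using r c_pos \<alpha> by (simp add: R_def powr_powr powr_minus_divide)
    have stay: "1 / 2 \<le> prob {\<omega> \<in> space M. norm (Y t \<omega>) \<le> R}" if t: "0 \<le> t" "t \<le> r" for t
    proof -
      have [measurable]: "Y t \<in> borel_measurable M" using t by (intro measurable_Y)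
      have "prob {\<omega> \<in> space M. R < norm (Y t \<omega>)} \<le> 6 * c * t * R powr (- \<alpha>)"
        using \<alpha> t R by (intro stable_tail[OF prob_space_axioms stable dim]) auto
      also have "\<dots> \<le> 1 / 2"
        using t r c_pos by (simp add: R_powr field_simps)
      also have "prob {\<omega> \<in> space M. R < norm (Y t \<omega>)} = 1 - prob {\<omega> \<in> space M. norm (Y t \<omega>) \<le> R}"
        by (subst prob_compl[symmetric]) (auto intro!: arg_cong[where f = prob])
      finally show ?thesis by simp
    qed
    let ?E = "\<lambda>z :: 'a \<times> 'w. indicator (cball 0 (K + R)) (fst z) :: ennreal"
    have E_meas [measurable]: "?E \<in> borel_measurable Q"
      by (rule measurable_compose[OF measurable_fst]) (auto intro!: borel_measurable_indicator)
    have hit_E: "ennreal (P / 2) * indicator {0..r} t \<le> (\<integral>\<^sup>+z. hit r t z * ?E z \<partial>Q)" for t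
    proof (cases "t \<in> {0..r}")
      case True
      then have [measurable]: "Y t \<in> borel_measurable M" by (intro measurable_Y) simp
      have "ennreal (P / 2) \<le> ennreal P * emeasure M {\<omega> \<in> space M. norm (Y t \<omega>) \<le> R}"
        using stay[of t] True P mult_left_mono[OF stay[of t], of P] by (simp add: emeasure_eq_measure flip: ennreal_mult)
      also have "\<dots> = (\<integral>\<^sup>+\<omega>. ennreal P * indicator {\<omega> \<in> space M. norm (Y t \<omega>) \<le> R} \<omega> \<partial>M)"
        by (simp add: nn_integral_cmult_indicator)
      also have "\<dots> = (\<integral>\<^sup>+\<omega>. \<integral>\<^sup>+x. ennreal (\<psi> (x + Y t \<omega>)) * indicator {\<omega> \<in> space M. norm (Y t \<omega>) \<le> R} \<omega> \<partial>lborel \<partial>M)"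
        by (rule nn_integral_cong)
           (simp add: nn_integral_multc nn_integral_lborel_shift[of "\<lambda>x. ennreal (\<psi> x)"] P)
      also have "\<dots> \<le> (\<integral>\<^sup>+\<omega>. \<integral>\<^sup>+x. hit r t (x, \<omega>) * ?E (x, \<omega>) \<partial>lborel \<partial>M)"
      proof (intro nn_integral_mono)
        fix \<omega> and x :: 'a assume \<omega>: "\<omega> \<in> space M"
        have "norm x \<le> K + R" if "\<psi> (x + Y t \<omega>) \<noteq> 0" "norm (Y t \<omega>) \<le> R"
          using \<psi>_support[OF that(1)] that(2) norm_triangle_ineq4[of "x + Y t \<omega>" "Y t \<omega>"] by simp
        then show "ennreal (\<psi> (x + Y t \<omega>)) * indicator {\<omega> \<in> space M. norm (Y t \<omega>) \<le> R} \<omega> \<le> hit r t (x, \<omega>) * ?E (x, \<omega>)"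
          using True \<omega> by (cases "\<psi> (x + Y t \<omega>) = 0") (auto simp: hit_def path_eval_Y indicator_def)
      qed
      also have "\<dots> = (\<integral>\<^sup>+z. hit r t z * ?E z \<partial>Q)"
        by (rule LM.nn_integral_snd[of "\<lambda>z. hit r t z * ?E z"])
           (intro borel_measurable_times_ennreal measurable_hit_section E_meas)
      finally show ?thesis using True by simp
    qed simp
    have "ennreal (r * P / 2) = (\<integral>\<^sup>+t. ennreal (P / 2) * indicator {0..r} t \<partial>lborel)"
      using r P by (subst nn_integral_cmult_indicator) (auto simp: mult.commute simp flip: ennreal_mult)
    also have "\<dots> \<le> (\<integral>\<^sup>+t. \<integral>\<^sup>+z. hit r t z * ?E z \<partial>Q \<partial>lborel)"
      by (intro nn_integral_mono hit_E)
    also have "\<dots> = (\<integral>\<^sup>+z. \<integral>\<^sup>+t. hit r t z * ?E z \<partial>lborel \<partial>Q)"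
    proof (rule T.Fubini'[of "\<lambda>t z. hit r t z * ?E z", symmetric])
      have [measurable]: "(\<lambda>p. hit r (fst p) (snd p)) \<in> borel_measurable (lborel \<Otimes>\<^sub>M Q)"
        using measurable_hit by (simp cong: measurable_cong_sets sets_pair_measure_cong)
      show "(\<lambda>(t, z). hit r t z * ?E z) \<in> borel_measurable (lborel \<Otimes>\<^sub>M Q)"
        unfolding case_prod_beta
        by (intro borel_measurable_times_ennreal measurable_compose[OF measurable_snd E_meas]) measurable
    qed
    also have "\<dots> = (\<integral>\<^sup>+z. occ r z * ?E z \<partial>Q)"
    proof (rule nn_integral_cong)
      fix z assume "z \<in> space Q"
      then have "(\<lambda>t. hit r t z) \<in> borel_measurable lborel"
        using measurable_compose[OF measurable_Pair2'[of z "borel \<Otimes>\<^sub>M M" lborel] measurable_hit[of r]]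
        by (simp add: space_pair_measure)
      then show "(\<integral>\<^sup>+t. hit r t z * ?E z \<partial>lborel) = occ r z * ?E z"
        by (simp add: occ_eq nn_integral_multc)
    qed
    finally have "(ennreal (r * P / 2))\<^sup>2 \<le> (\<integral>\<^sup>+z. occ r z * ?E z \<partial>Q)\<^sup>2"
      by (rule power_mono) simp
    also have "\<dots> \<le> (\<integral>\<^sup>+z. (occ r z)\<^sup>2 \<partial>Q) * (\<integral>\<^sup>+z. (?E z)\<^sup>2 \<partial>Q)"
      by (rule Cauchy_Schwarz_nn_integral) (use measurable_occ[of r] E_meas in \<open>simp_all cong: measurable_cong_sets sets_pair_measure_cong\<close>)
    also have "(\<integral>\<^sup>+z. (?E z)\<^sup>2 \<partial>Q) = ennreal (V * (K + R))"
    proof -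
      have "(\<integral>\<^sup>+z. (?E z)\<^sup>2 \<partial>Q) = (\<integral>\<^sup>+\<omega>. \<integral>\<^sup>+x. (?E (x, \<omega>))\<^sup>2 \<partial>lborel \<partial>M)"
        by (rule LM.nn_integral_snd[of "\<lambda>z. (?E z)\<^sup>2", symmetric]) (unfold power2_eq_square, intro borel_measurable_times_ennreal E_meas)
      also have "\<dots> = (\<integral>\<^sup>+\<omega>. emeasure lborel (cball (0 :: 'a) (K + R)) \<partial>M)"
      proof (rule nn_integral_cong)
        fix \<omega>
        have "(?E (x, \<omega>))\<^sup>2 = indicator (cball 0 (K + R)) x" for x by (simp add: indicator_def)
        then show "(\<integral>\<^sup>+x. (?E (x, \<omega>))\<^sup>2 \<partial>lborel) = emeasure lborel (cball (0 :: 'a) (K + R))"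
          by (simp only:) simp
      qed
      also have "\<dots> = ennreal (V * (K + R))"
        using K R dim by (simp add: emeasure_cball V_def emeasure_space_1)
      finally show ?thesis .
    qed
    finally have CS: "(ennreal (r * P / 2))\<^sup>2 \<le> (\<integral>\<^sup>+z. (occ r z)\<^sup>2 \<partial>Q) * ennreal (V * (K + R))" .
    have "K + R \<le> D * r powr (1 / \<alpha>)"
    proof -
      have "1 \<le> r powr (1 / \<alpha>)" using r \<alpha> by (intro ge_one_powr_ge_zero) auto
      then have "K \<le> K * r powr (1 / \<alpha>)" using K by simp
      moreover have "R = (12 * c) powr (1 / \<alpha>) * r powr (1 / \<alpha>)"
        using c_pos r by (simp add: R_def powr_mult)
      ultimately show ?thesis by (simp add: D_def distrib_right)
    qed
    then have VR: "V * (K + R) \<le> V * (D * r powr (1 / \<alpha>))" using V by simp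
    show ?thesis
    proof (cases "\<integral>\<^sup>+z. (occ r z)\<^sup>2 \<partial>Q")
      case (real q)
      have "(r * P / 2)\<^sup>2 \<le> q * (V * (K + R))"
        using CS real r P V K R by (simp add: ennreal_power flip: ennreal_mult)
      also have "\<dots> \<le> q * (V * (D * r powr (1 / \<alpha>)))"
        using VR real(1) by (rule mult_left_mono)
      finally have "P\<^sup>2 / (4 * V * D) * (r\<^sup>2 / r powr (1 / \<alpha>)) \<le> q"
        using V D r by (simp add: field_simps power_mult_distrib)
      moreover have "r\<^sup>2 / r powr (1 / \<alpha>) = r powr (2 - 1 / \<alpha>)"
        using r by (simp add: powr_diff)
      ultimately show ?thesis using real by (simp add: ennreal_leI)
    qed simp
  qed
  show ?thesis
    by (rule that[OF _ lower]) (use P V D in auto)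
qed

end

section \<open>The occupation functional as a sum over the points\<close>

text \<open>The particle measure is the image of the weights \<open>a i\<close> on the pairs of a point and a particle
  label; \<open>w\<close> extends these weights by 0 to all labels.\<close>

lemma nn_integral_particle_measure:
  fixes \<eta> :: "'w \<Rightarrow> 'a::euclidean_space measure" and \<psi> :: "'a \<Rightarrow> ennreal"
  assumes \<eta>: "\<eta> \<omega> = distr (count_space UNIV) borel x" and \<psi>: "\<psi> \<in> borel_measurable borel"
  shows "(\<integral>\<^sup>+y. \<psi> y \<partial>particle_measure a m X \<eta> t \<omega>) = (\<Sum>k. \<Sum>i\<in>{1..m}. ennreal (a i) * \<psi> (X i (x k) t \<omega>))"
    and "sets (particle_measure a m X \<eta> t \<omega>) = sets borel"
proof -
  define w where "w p = (if snd p \<in> {1..m} then ennreal (a (snd p)) else 0)" for p :: "nat \<times> nat"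
  define T where "T p = X (snd p) (x (fst p)) t \<omega>" for p
  define \<rho> where "\<rho> = distr (density (count_space UNIV) w) borel T"
  have int_\<rho>: "(\<integral>\<^sup>+y. \<phi> y \<partial>\<rho>) = (\<Sum>k. \<Sum>i\<in>{1..m}. ennreal (a i) * \<phi> (X i (x k) t \<omega>))"
    if \<phi>: "\<phi> \<in> borel_measurable borel" for \<phi> :: "'a \<Rightarrow> ennreal"
  proof -
    have "(\<integral>\<^sup>+y. \<phi> y \<partial>\<rho>) = (\<integral>\<^sup>+p. w p * \<phi> (T p) \<partial>count_space UNIV)"
      unfolding \<rho>_def using \<phi> by (simp add: nn_integral_distr nn_integral_density)
    also have "\<dots> = (\<integral>\<^sup>+k. \<integral>\<^sup>+i. w (k, i) * \<phi> (T (k, i)) \<partial>count_space UNIV \<partial>count_space UNIV)"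
      by (rule nn_integral_fst_count_space[symmetric])
    also have "\<dots> = (\<Sum>k. \<integral>\<^sup>+i. w (k, i) * \<phi> (T (k, i)) \<partial>count_space UNIV)"
      by (rule nn_integral_count_space_nat)
    also have "\<dots> = (\<Sum>k. \<Sum>i\<in>{1..m}. ennreal (a i) * \<phi> (X i (x k) t \<omega>))"
    proof (rule suminf_cong)
      fix k
      have "(\<integral>\<^sup>+i. w (k, i) * \<phi> (T (k, i)) \<partial>count_space UNIV) = (\<Sum>i\<in>{1..m}. w (k, i) * \<phi> (T (k, i)))"
        by (rule nn_integral_count_space') (auto simp: w_def)
      then show "(\<integral>\<^sup>+i. w (k, i) * \<phi> (T (k, i)) \<partial>count_space UNIV) = (\<Sum>i\<in>{1..m}. ennreal (a i) * \<phi> (X i (x k) t \<omega>))"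
        by (simp add: w_def T_def)
    qed
    finally show ?thesis .
  qed
  have cluster: "emeasure (cluster_measure a m X t y \<omega>) A = (\<Sum>i\<in>{1..m}. ennreal (a i) * indicator A (X i y t \<omega>))"
    if A: "A \<in> sets borel" for A y
  proof -
    let ?V = "{i \<in> {1..m}. X i y t \<omega> \<in> A}"
    have "emeasure (cluster_measure a m X t y \<omega>) A = emeasure (point_measure {1..m} (\<lambda>i. ennreal (a i))) ?V"
      unfolding cluster_measure_def using A
      by (subst emeasure_distr) (auto simp: space_point_measure intro!: arg_cong2[where f = emeasure])
    also have "\<dots> = (\<Sum>i\<in>?V. ennreal (a i))"
      by (rule emeasure_point_measure_finite) auto
    also have "\<dots> = (\<Sum>i\<in>{1..m}. ennreal (a i) * indicator A (X i y t \<omega>))"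
      by (rule sum.mono_neutral_cong_left) (auto simp: indicator_def)
    finally show ?thesis .
  qed
  have "particle_measure a m X \<eta> t \<omega> = measure_of (space \<rho>) (sets \<rho>) (emeasure \<rho>)"
    unfolding particle_measure_def
  proof -
    have sp: "space \<rho> = UNIV" "sets \<rho> = sets borel" by (simp_all add: \<rho>_def)
    show "measure_of UNIV (sets borel) (\<lambda>B. \<integral>\<^sup>+y. emeasure (cluster_measure a m X t y \<omega>) B \<partial>\<eta> \<omega>)
      = measure_of (space \<rho>) (sets \<rho>) (emeasure \<rho>)"
      unfolding sp
    proof (rule measure_of_eq)
      fix A :: "'a set" assume "A \<in> sigma_sets UNIV (sets borel)"
      then have A: "A \<in> sets borel" using sets.sigma_sets_eq[of "borel :: 'a measure"] by simp
      have "(\<integral>\<^sup>+y. emeasure (cluster_measure a m X t y \<omega>) A \<partial>\<eta> \<omega>)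
          = (\<Sum>k. \<Sum>i\<in>{1..m}. ennreal (a i) * indicator A (X i (x k) t \<omega>))"
        unfolding \<eta> nn_integral_atoms cluster[OF A] ..
      also have "\<dots> = emeasure \<rho> A"
        using int_\<rho>[of "indicator A"] A sp by simp
      finally show "(\<integral>\<^sup>+y. emeasure (cluster_measure a m X t y \<omega>) A \<partial>\<eta> \<omega>) = emeasure \<rho> A" .
    qed simp
  qed
  then have eq: "particle_measure a m X \<eta> t \<omega> = \<rho>"
    by (simp only: measure_of_of_measure)
  show "(\<integral>\<^sup>+y. \<psi> y \<partial>particle_measure a m X \<eta> t \<omega>) = (\<Sum>k. \<Sum>i\<in>{1..m}. ennreal (a i) * \<psi> (X i (x k) t \<omega>))"
    unfolding eq by (rule int_\<rho>[OF \<psi>])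
  show "sets (particle_measure a m X \<eta> t \<omega>) = sets borel"
    unfolding eq by (simp add: \<rho>_def)
qed

text \<open>The occupation functional is built from real-valued integrals, which are 0 when they diverge.
  If the extended sum is finite, the inner integral diverges for a null set of times only.\<close>

lemma occupation_eq_sum:
  fixes \<eta> :: "'w \<Rightarrow> 'a::euclidean_space measure" and \<psi> :: "'a \<Rightarrow> real" and x :: "nat \<Rightarrow> 'a"
  assumes \<eta>: "\<eta> \<omega> = distr (count_space UNIV) borel x"
    and \<psi> [measurable]: "\<psi> \<in> borel_measurable borel" and nonneg: "\<And>y. 0 \<le> \<psi> y"
    and path: "\<And>i k. i \<in> {1..m} \<Longrightarrow> w i k \<in> space path_space"
    and eval: "\<And>i k t. i \<in> {1..m} \<Longrightarrow> 0 \<le> t \<Longrightarrow> X i (x k) t \<omega> = x k + path_eval (w i k) t"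
    and finite: "(\<Sum>k. \<Sum>i\<in>{1..m}. ennreal (a i) * path_occupation \<psi> r (x k, w i k)) < \<top>"
  shows "occupation a m X \<eta> \<psi> r \<omega> = enn2real (\<Sum>k. \<Sum>i\<in>{1..m}. ennreal (a i) * path_occupation \<psi> r (x k, w i k))"
proof -
  let ?h = "\<lambda>i k t. ennreal (a i) * (ennreal (\<psi> (x k + path_eval (w i k) t)) * indicator {0..r} t)"
  let ?total = "\<Sum>k. \<Sum>i\<in>{1..m}. ennreal (a i) * path_occupation \<psi> r (x k, w i k)"
  define S where "S t = (\<Sum>k. \<Sum>i\<in>{1..m}. ?h i k t)" for t
  have path_meas: "(\<lambda>t. path_eval (w i k) t) \<in> borel_measurable borel" if "i \<in> {1..m}" for i k
    by (rule measurable_path_eval_pair) (use path[OF that] in auto)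
  have term_meas: "(\<lambda>t. ?h i k t) \<in> borel_measurable borel"
    if "i \<in> {1..m}" for i k
    using path_meas[OF that, of k] by measurable
  have sum_meas [measurable]: "(\<lambda>t. \<Sum>i\<in>{1..m}. ?h i k t) \<in> borel_measurable borel" for k
    by (intro borel_measurable_sum term_meas)
  have S_meas [measurable]: "S \<in> borel_measurable borel"
    unfolding S_def[abs_def] by measurable
  have int_S: "(\<integral>\<^sup>+t. S t \<partial>lborel) = ?total"
  proof -
    have "(\<integral>\<^sup>+t. S t \<partial>lborel) = (\<Sum>k. \<integral>\<^sup>+t. (\<Sum>i\<in>{1..m}. ?h i k t) \<partial>lborel)"
      unfolding S_def by (rule nn_integral_suminf) (unfold measurable_lborel2, rule sum_meas)
    also have "\<dots> = ?total"
    proof (rule suminf_cong)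
      fix k
      have "(\<integral>\<^sup>+t. (\<Sum>i\<in>{1..m}. ?h i k t) \<partial>lborel)
         = (\<Sum>i\<in>{1..m}. \<integral>\<^sup>+t. ?h i k t \<partial>lborel)"
        by (rule nn_integral_sum) (use term_meas in simp)
      also have "\<dots> = (\<Sum>i\<in>{1..m}. ennreal (a i) * path_occupation \<psi> r (x k, w i k))"
      proof (rule sum.cong[OF refl])
        fix i assume i: "i \<in> {1..m}"
        note path_meas[OF i, of k, measurable]
        show "(\<integral>\<^sup>+t. ?h i k t \<partial>lborel)
            = ennreal (a i) * path_occupation \<psi> r (x k, w i k)"
          unfolding path_occupation_def by (subst nn_integral_cmult) simp_all
      qed
      finally show "(\<integral>\<^sup>+t. (\<Sum>i\<in>{1..m}. ?h i k t) \<partial>lborel)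
         = (\<Sum>i\<in>{1..m}. ennreal (a i) * path_occupation \<psi> r (x k, w i k))" .
    qed
    finally show ?thesis .
  qed
  have inner: "indicator {0..r} t *\<^sub>R (LINT y|particle_measure a m X \<eta> t \<omega>. \<psi> y) = enn2real (S t)" for t
  proof (cases "t \<in> {0..r}")
    case True
    note particle = nn_integral_particle_measure[of \<eta> \<omega> x "\<lambda>y. ennreal (\<psi> y)" a m X t, OF \<eta>]
    have "(LINT y|particle_measure a m X \<eta> t \<omega>. \<psi> y) = enn2real (\<integral>\<^sup>+y. ennreal (\<psi> y) \<partial>particle_measure a m X \<eta> t \<omega>)"
      using nonneg particle(2) by (intro integral_eq_nn_integral) (auto cong: measurable_cong_sets)
    also have "\<dots> = enn2real (S t)"
      unfolding S_def using True eval by (subst particle(1)) auto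
    finally show ?thesis using True by simp
  next
    case False
    then show ?thesis by (simp add: S_def)
  qed
  have "AE t in lborel. S t \<noteq> \<infinity>"
    by (rule nn_integral_noteq_infinite) (use finite int_S in auto)
  then have "AE t in lborel. ennreal (enn2real (S t)) = S t"
    by eventually_elim (simp add: less_top)
  then have "(\<integral>\<^sup>+t. ennreal (enn2real (S t)) \<partial>lborel) = (\<integral>\<^sup>+t. S t \<partial>lborel)"
    by (rule nn_integral_cong_AE)
  moreover have "occupation a m X \<eta> \<psi> r \<omega> = enn2real (\<integral>\<^sup>+t. ennreal (enn2real (S t)) \<partial>lborel)"
    unfolding occupation_def set_lebesgue_integral_def inner
    by (rule integral_eq_nn_integral) auto
  ultimately show ?thesis by (simp only: int_S)
qed

section \<open>The rate of convergence\<close>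

lemma sum_power3_le_ennreal:
  fixes x :: "'i \<Rightarrow> ennreal"
  assumes I: "finite I"
  shows "(\<Sum>i\<in>I. x i) ^ 3 \<le> of_nat (card I) ^ 3 * (\<Sum>i\<in>I. x i ^ 3)"
proof (cases "I = {}")
  case False
  obtain j where j: "j \<in> I" "x j = Max (x ` I)"
    using Max_in[of "x ` I"] I False by fastforce
  have "(\<Sum>i\<in>I. x i) \<le> of_nat (card I) * x j"
    using I j by (intro sum_bounded_above) auto
  then have "(\<Sum>i\<in>I. x i) ^ 3 \<le> (of_nat (card I) * x j) ^ 3"
    by (rule power_mono) simp
  also have "\<dots> = of_nat (card I) ^ 3 * x j ^ 3"
    by (rule power_mult_distrib)
  also have "\<dots> \<le> of_nat (card I) ^ 3 * (\<Sum>i\<in>I. x i ^ 3)"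
    using j I by (intro mult_left_mono member_le_sum) auto
  finally show ?thesis .
qed simp

text \<open>The particle system in terms of the enumerated points \<open>\<xi> k\<close> and displacements \<open>D i k\<close>. The
  density \<open>f\<close> of the intensity takes values between \<open>l\<close> and \<open>u\<close>.\<close>

locale stable_cluster_system = marked_points M \<nu> \<eta> m \<xi> D
  for M :: "'w measure" and \<nu> :: "'a::euclidean_space measure" and \<eta> :: "'w \<Rightarrow> 'a measure"
    and m :: nat and \<xi> :: "nat \<Rightarrow> 'w \<Rightarrow> 'a" and D :: "nat \<Rightarrow> nat \<Rightarrow> real \<Rightarrow> 'w \<Rightarrow> 'a" +
  fixes \<alpha> :: real and a c :: "nat \<Rightarrow> real" and X :: "nat \<Rightarrow> 'a \<Rightarrow> real \<Rightarrow> 'w \<Rightarrow> 'a"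
    and \<psi> :: "'a \<Rightarrow> real" and B K :: real and f :: "'a \<Rightarrow> real" and l u :: real
  assumes dim: "DIM('a) = 1" and \<alpha>: "1 < \<alpha>" "\<alpha> \<le> 2" and a: "\<And>i. i \<in> {1..m} \<Longrightarrow> 0 < a i"
    and D_eq: "\<And>i k t \<omega>. D i k t \<omega> = X i (\<xi> k \<omega>) t \<omega> - \<xi> k \<omega>"
    and stable: "\<And>i k. i \<in> {1..m} \<Longrightarrow> symmetric_stable_process M \<alpha> (c i) (D i k)"
    and \<psi> [measurable]: "\<psi> \<in> borel_measurable borel"
    and \<psi>_bounds: "\<And>x. 0 \<le> \<psi> x" "\<And>x. \<psi> x \<le> B"
    and \<psi>_support: "\<And>x. \<psi> x \<noteq> 0 \<Longrightarrow> norm x \<le> K" and K: "0 < K"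
    and f [measurable]: "f \<in> borel_measurable borel" and f_bounds: "0 < l" "\<And>x. l \<le> f x" "\<And>x. f x \<le> u"
    and \<nu>: "\<nu> = density lborel (\<lambda>x. ennreal (f x))"
begin

lemma particle: "i \<in> {1..m} \<Longrightarrow> stable_particle M (D i k) \<alpha> (c i) \<psi> B K"
  using stable dim \<alpha> \<psi>_bounds \<psi>_support K
  by (intro stable_particle.intro stable_particle_axioms.intro prob_space_axioms) auto

sublocale NM: pair_sigma_finite \<nu> M
proof (rule pair_sigma_finite.intro)
  show "sigma_finite_measure \<nu>"
    unfolding \<nu> by (subst sigma_finite_measure.sigma_finite_iff_density_finite[OF sigma_finite_lborel]) auto
qed (rule sigma_finite_measure_axioms)

abbreviation N :: "('a \<times> 'w) measure" where
  "N \<equiv> \<nu> \<Otimes>\<^sub>M M"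

abbreviation Q :: "('a \<times> 'w) measure" where
  "Q \<equiv> lborel \<Otimes>\<^sub>M M"

lemma nn_integral_intensity_bounds:
  assumes F: "F \<in> borel_measurable (borel \<Otimes>\<^sub>M M)"
  shows "(\<integral>\<^sup>+z. F z \<partial>N) \<le> ennreal u * (\<integral>\<^sup>+z. F z \<partial>Q)"
    and "ennreal l * (\<integral>\<^sup>+z. F z \<partial>Q) \<le> (\<integral>\<^sup>+z. F z \<partial>N)"
proof -
  have F_lb: "F \<in> borel_measurable Q" and F_\<nu>: "F \<in> borel_measurable N"
    using F by (simp_all add: \<nu> cong: measurable_cong_sets sets_pair_measure_cong)
  have sec [measurable]: "(\<lambda>x. \<integral>\<^sup>+\<omega>. F (x, \<omega>) \<partial>M) \<in> borel_measurable borel"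
    using F by (intro borel_measurable_nn_integral) (simp add: case_prod_beta)
  have "(\<integral>\<^sup>+z. F z \<partial>N) = (\<integral>\<^sup>+x. \<integral>\<^sup>+\<omega>. F (x, \<omega>) \<partial>M \<partial>\<nu>)"
    by (rule nn_integral_fst[OF F_\<nu>, symmetric])
  also have "\<dots> = (\<integral>\<^sup>+x. ennreal (f x) * (\<integral>\<^sup>+\<omega>. F (x, \<omega>) \<partial>M) \<partial>lborel)"
    unfolding \<nu> by (rule nn_integral_density) auto
  finally have \<nu>_eq: "(\<integral>\<^sup>+z. F z \<partial>N) = \<dots>" .
  have const: "(\<integral>\<^sup>+x. ennreal d * (\<integral>\<^sup>+\<omega>. F (x, \<omega>) \<partial>M) \<partial>lborel) = ennreal d * (\<integral>\<^sup>+z. F z \<partial>Q)" for d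
    by (subst nn_integral_cmult) (simp_all add: nn_integral_fst[OF F_lb])
  show "(\<integral>\<^sup>+z. F z \<partial>N) \<le> ennreal u * (\<integral>\<^sup>+z. F z \<partial>Q)"
    unfolding \<nu>_eq const[symmetric] using f_bounds by (intro nn_integral_mono mult_right_mono ennreal_leI) auto
  show "ennreal l * (\<integral>\<^sup>+z. F z \<partial>Q) \<le> (\<integral>\<^sup>+z. F z \<partial>N)"
    unfolding \<nu>_eq const[symmetric] using f_bounds by (intro nn_integral_mono mult_right_mono ennreal_leI) auto
qed

definition particle_occ :: "nat \<Rightarrow> real \<Rightarrow> 'a \<times> 'w \<Rightarrow> ennreal" where
  "particle_occ i r z = path_occupation \<psi> r (fst z, path_of (D i 0) (snd z))"

definition cluster_occ :: "real \<Rightarrow> 'a \<times> 'w \<Rightarrow> ennreal" where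
  "cluster_occ r z = (\<Sum>i\<in>{1..m}. ennreal (a i) * particle_occ i r z)"

lemma particle_occ_eq: "i \<in> {1..m} \<Longrightarrow> particle_occ i r = stable_particle.occ (D i 0) \<psi> r"
  by (simp add: fun_eq_iff particle_occ_def stable_particle.occ_def[OF particle])

lemma measurable_particle_occ: "i \<in> {1..m} \<Longrightarrow> particle_occ i r \<in> borel_measurable (borel \<Otimes>\<^sub>M M)"
  using stable_particle.measurable_occ[OF particle] by (simp add: particle_occ_eq)

lemma measurable_cluster_occ: "cluster_occ r \<in> borel_measurable (borel \<Otimes>\<^sub>M M)"
  unfolding cluster_occ_def[abs_def]
  by (intro borel_measurable_sum borel_measurable_times_ennreal measurable_particle_occ borel_measurable_const)

lemma measurable_cluster_occ_intensity [measurable]: "cluster_occ r \<in> borel_measurable N"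
  using measurable_cluster_occ by (simp add: \<nu> cong: measurable_cong_sets sets_pair_measure_cong)

lemma cluster_occ_bounded:
  assumes r: "0 \<le> r"
  shows "cluster_occ r z \<le> ennreal (\<Sum>i\<in>{1..m}. a i * (B * r))"
proof -
  have B: "0 \<le> B" using \<psi>_bounds[of 0] by simp
  have "cluster_occ r z \<le> (\<Sum>i\<in>{1..m}. ennreal (a i) * ennreal (B * r))"
    unfolding cluster_occ_def using stable_particle.occ_bounded[OF particle r, of _ 0 z]
    by (intro sum_mono mult_left_mono) (auto simp: particle_occ_eq)
  also have "\<dots> = ennreal (\<Sum>i\<in>{1..m}. a i * (B * r))"
    using a r B by (subst sum_ennreal[symmetric]) (auto simp: ennreal_mult less_imp_le)
  finally show ?thesis .
qed

lemma mean_cluster_occ: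
  assumes r: "0 \<le> r"
  shows "(\<integral>\<^sup>+z. cluster_occ r z \<partial>N)
    \<le> ennreal u * ((\<Sum>i\<in>{1..m}. ennreal (a i)) * (ennreal r * (\<integral>\<^sup>+x. ennreal (\<psi> x) \<partial>lborel)))"
proof -
  have "(\<integral>\<^sup>+z. cluster_occ r z \<partial>Q)
      = (\<Sum>i\<in>{1..m}. \<integral>\<^sup>+z. ennreal (a i) * particle_occ i r z \<partial>Q)"
    unfolding cluster_occ_def using measurable_particle_occ
    by (intro nn_integral_sum borel_measurable_times_ennreal) (auto cong: measurable_cong_sets sets_pair_measure_cong)
  also have "\<dots> = (\<Sum>i\<in>{1..m}. ennreal (a i) * (ennreal r * (\<integral>\<^sup>+x. ennreal (\<psi> x) \<partial>lborel)))"
  proof (rule sum.cong[OF refl])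
    fix i assume i: "i \<in> {1..m}"
    have "(\<integral>\<^sup>+z. ennreal (a i) * particle_occ i r z \<partial>Q) = ennreal (a i) * (\<integral>\<^sup>+z. particle_occ i r z \<partial>Q)"
      using measurable_particle_occ[OF i] by (intro nn_integral_cmult) (simp cong: measurable_cong_sets sets_pair_measure_cong)
    then show "(\<integral>\<^sup>+z. ennreal (a i) * particle_occ i r z \<partial>Q) = ennreal (a i) * (ennreal r * (\<integral>\<^sup>+x. ennreal (\<psi> x) \<partial>lborel))"
      using stable_particle.mean_occ[OF particle[OF i] r, of 0] by (simp add: particle_occ_eq[OF i])
  qed
  finally show ?thesis
    using nn_integral_intensity_bounds(1)[OF measurable_cluster_occ[of r]] by (simp add: sum_distrib_right)
qed

lemma third_moment_cluster_occ:
  obtains C where "0 < C" and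
    "\<And>r. 0 < r \<Longrightarrow> (\<integral>\<^sup>+z. cluster_occ r z ^ 3 \<partial>N) \<le> ennreal (C * r powr (3 - 2 / \<alpha>))"
proof -
  have "\<exists>C. 0 < C \<and> (\<forall>r>0. (\<integral>\<^sup>+z. particle_occ i r z ^ 3 \<partial>Q) \<le> ennreal (C * r powr (3 - 2 / \<alpha>)))"
    if "i \<in> {1..m}" for i
    using stable_particle.third_moment_occ[OF particle[OF that, of 0]] particle_occ_eq[OF that] by metis
  then obtain C where C: "\<And>i. i \<in> {1..m} \<Longrightarrow> 0 < C i"
    "\<And>i r. i \<in> {1..m} \<Longrightarrow> 0 < r \<Longrightarrow> (\<integral>\<^sup>+z. particle_occ i r z ^ 3 \<partial>Q) \<le> ennreal (C i * r powr (3 - 2 / \<alpha>))"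
    by metis
  define E where "E = u * (real m ^ 3 * (\<Sum>i\<in>{1..m}. a i ^ 3 * C i))"
  have u: "0 < u" using f_bounds(1) f_bounds(2,3)[of 0] by linarith
  have E: "0 \<le> E"
    using u a C(1) by (auto simp: E_def less_imp_le intro!: mult_nonneg_nonneg sum_nonneg)
  have bound: "(\<integral>\<^sup>+z. cluster_occ r z ^ 3 \<partial>N) \<le> ennreal (E * r powr (3 - 2 / \<alpha>))" if r: "0 < r" for r
  proof -
    have meas3: "(\<lambda>z. particle_occ i r z ^ 3) \<in> borel_measurable Q" if "i \<in> {1..m}" for i
      unfolding power3_eq_cube using measurable_particle_occ[OF that, of r]
      by (intro borel_measurable_times_ennreal) (simp_all cong: measurable_cong_sets sets_pair_measure_cong)
    have "(\<integral>\<^sup>+z. cluster_occ r z ^ 3 \<partial>N) \<le> ennreal u * (\<integral>\<^sup>+z. cluster_occ r z ^ 3 \<partial>Q)"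
      unfolding power3_eq_cube
      by (intro nn_integral_intensity_bounds borel_measurable_times_ennreal measurable_cluster_occ)
    also have "(\<integral>\<^sup>+z. cluster_occ r z ^ 3 \<partial>Q)
        \<le> (\<integral>\<^sup>+z. of_nat m ^ 3 * (\<Sum>i\<in>{1..m}. ennreal (a i ^ 3) * particle_occ i r z ^ 3) \<partial>Q)"
    proof (rule nn_integral_mono)
      fix z
      have "cluster_occ r z ^ 3 \<le> of_nat (card {1..m}) ^ 3 * (\<Sum>i\<in>{1..m}. (ennreal (a i) * particle_occ i r z) ^ 3)"
        unfolding cluster_occ_def by (rule sum_power3_le_ennreal) simp
      also have "(\<Sum>i\<in>{1..m}. (ennreal (a i) * particle_occ i r z) ^ 3) = (\<Sum>i\<in>{1..m}. ennreal (a i ^ 3) * particle_occ i r z ^ 3)"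
        using a by (intro sum.cong refl) (simp add: power_mult_distrib ennreal_power less_imp_le)
      finally show "cluster_occ r z ^ 3 \<le> of_nat m ^ 3 * (\<Sum>i\<in>{1..m}. ennreal (a i ^ 3) * particle_occ i r z ^ 3)"
        by simp
    qed
    also have "\<dots> = of_nat m ^ 3 * (\<Sum>i\<in>{1..m}. ennreal (a i ^ 3) * (\<integral>\<^sup>+z. particle_occ i r z ^ 3 \<partial>Q))"
    proof -
      have "(\<integral>\<^sup>+z. (\<Sum>i\<in>{1..m}. ennreal (a i ^ 3) * particle_occ i r z ^ 3) \<partial>Q)
          = (\<Sum>i\<in>{1..m}. \<integral>\<^sup>+z. ennreal (a i ^ 3) * particle_occ i r z ^ 3 \<partial>Q)"
        by (intro nn_integral_sum borel_measurable_times_ennreal meas3 borel_measurable_const)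
      also have "\<dots> = (\<Sum>i\<in>{1..m}. ennreal (a i ^ 3) * (\<integral>\<^sup>+z. particle_occ i r z ^ 3 \<partial>Q))"
        by (intro sum.cong refl nn_integral_cmult meas3)
      finally show ?thesis
        by (subst nn_integral_cmult)
           (auto intro!: borel_measurable_sum borel_measurable_times_ennreal meas3)
    qed
    also have "\<dots> \<le> of_nat m ^ 3 * (\<Sum>i\<in>{1..m}. ennreal (a i ^ 3) * ennreal (C i * r powr (3 - 2 / \<alpha>)))"
      using r by (intro mult_left_mono sum_mono C(2)) auto
    also have "(\<Sum>i\<in>{1..m}. ennreal (a i ^ 3) * ennreal (C i * r powr (3 - 2 / \<alpha>)))
        = ennreal (\<Sum>i\<in>{1..m}. a i ^ 3 * (C i * r powr (3 - 2 / \<alpha>)))"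
      using a C(1) by (subst sum_ennreal[symmetric]) (auto simp: ennreal_mult less_imp_le intro!: sum.cong)
    also have "ennreal u * (of_nat m ^ 3 * ennreal (\<Sum>i\<in>{1..m}. a i ^ 3 * (C i * r powr (3 - 2 / \<alpha>))))
        = ennreal (u * (real m ^ 3 * (\<Sum>i\<in>{1..m}. a i ^ 3 * (C i * r powr (3 - 2 / \<alpha>)))))"
    proof -
      have "0 \<le> (\<Sum>i\<in>{1..m}. a i ^ 3 * (C i * r powr (3 - 2 / \<alpha>)))"
        using a C(1) by (intro sum_nonneg) (simp add: less_imp_le)
      then show ?thesis
        using u by (simp add: ennreal_power ennreal_of_nat_eq_real_of_nat ennreal_mult)
    qed
    also have "u * (real m ^ 3 * (\<Sum>i\<in>{1..m}. a i ^ 3 * (C i * r powr (3 - 2 / \<alpha>)))) = E * r powr (3 - 2 / \<alpha>)"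
      by (simp add: E_def sum_distrib_right mult.assoc)
    finally show ?thesis by (simp add: mult_left_mono)
  qed
  show ?thesis
  proof (rule that)
    show "0 < E + 1" using E by simp
    show "(\<integral>\<^sup>+z. cluster_occ r z ^ 3 \<partial>N) \<le> ennreal ((E + 1) * r powr (3 - 2 / \<alpha>))" if "0 < r" for r
      using bound[OF that] by (rule order_trans) (auto intro!: ennreal_leI mult_right_mono)
  qed
qed

lemma second_moment_cluster_occ:
  assumes m: "1 \<le> m" and pos: "(\<integral>\<^sup>+x. ennreal (\<psi> x) \<partial>lborel) \<noteq> 0"
  obtains C where "0 < C" and
    "\<And>r. 1 \<le> r \<Longrightarrow> ennreal (C * r powr (2 - 1 / \<alpha>)) \<le> (\<integral>\<^sup>+z. (cluster_occ r z)\<^sup>2 \<partial>N)"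
proof -
  have one: "1 \<in> {1..m}" using m by simp
  obtain C where C: "0 < C"
    "\<And>r. 1 \<le> r \<Longrightarrow> ennreal (C * r powr (2 - 1 / \<alpha>)) \<le> (\<integral>\<^sup>+z. (particle_occ 1 r z)\<^sup>2 \<partial>Q)"
    using stable_particle.second_moment_occ[OF particle[OF one, of 0] pos] particle_occ_eq[OF one] by metis
  have lower: "ennreal (l * (a 1)\<^sup>2 * C * r powr (2 - 1 / \<alpha>)) \<le> (\<integral>\<^sup>+z. (cluster_occ r z)\<^sup>2 \<partial>N)" if r: "1 \<le> r" for r
  proof -
    have meas: "(\<lambda>z. (particle_occ 1 r z)\<^sup>2) \<in> borel_measurable Q"
      unfolding power2_eq_square using measurable_particle_occ[OF one, of r]
      by (intro borel_measurable_times_ennreal) (simp_all cong: measurable_cong_sets sets_pair_measure_cong)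
    have "ennreal (l * (a 1)\<^sup>2 * C * r powr (2 - 1 / \<alpha>)) = ennreal l * (ennreal ((a 1)\<^sup>2) * ennreal (C * r powr (2 - 1 / \<alpha>)))"
      using f_bounds(1) C(1) by (simp add: mult.assoc flip: ennreal_mult)
    also have "\<dots> \<le> ennreal l * (ennreal ((a 1)\<^sup>2) * (\<integral>\<^sup>+z. (particle_occ 1 r z)\<^sup>2 \<partial>Q))"
      by (intro mult_left_mono C(2) r) auto
    also have "\<dots> = ennreal l * (\<integral>\<^sup>+z. (ennreal (a 1) * particle_occ 1 r z)\<^sup>2 \<partial>Q)"
    proof -
      have "(ennreal (a 1) * particle_occ 1 r z)\<^sup>2 = ennreal ((a 1)\<^sup>2) * (particle_occ 1 r z)\<^sup>2" for z
        using a[OF one] by (simp add: power_mult_distrib ennreal_power less_imp_le)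
      then show ?thesis by (simp only: nn_integral_cmult[OF meas])
    qed
    also have "\<dots> \<le> ennreal l * (\<integral>\<^sup>+z. (cluster_occ r z)\<^sup>2 \<partial>Q)"
      unfolding cluster_occ_def using one by (intro mult_left_mono nn_integral_mono power_mono member_le_sum) auto
    also have "\<dots> \<le> (\<integral>\<^sup>+z. (cluster_occ r z)\<^sup>2 \<partial>N)"
      unfolding power2_eq_square
      by (intro nn_integral_intensity_bounds borel_measurable_times_ennreal measurable_cluster_occ)
    finally show ?thesis .
  qed
  show ?thesis
    by (rule that[OF _ lower]) (use f_bounds(1) a[OF one] C(1) in auto)
qed

abbreviation Y :: "real \<Rightarrow> 'a \<times> 'w \<Rightarrow> real" where
  "Y r z \<equiv> enn2real (cluster_occ r z)"

lemma ennreal_Y: "0 \<le> r \<Longrightarrow> ennreal (Y r z) = cluster_occ r z"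
  using le_less_trans[OF cluster_occ_bounded[of r z] ennreal_less_top] by simp

lemma mean_cluster_occ_finite:
  assumes r: "0 \<le> r"
  shows "(\<integral>\<^sup>+z. cluster_occ r z \<partial>N) < \<infinity>"
proof (cases "m = 0")
  case True
  then show ?thesis unfolding cluster_occ_def by simp
next
  case False
  then have "1 \<in> {1..m}" by simp
  from stable_particle.integral_\<psi>_finite[OF particle[OF this, of 0]]
  have "ennreal u * ((\<Sum>i\<in>{1..m}. ennreal (a i)) * (ennreal r * (\<integral>\<^sup>+x. ennreal (\<psi> x) \<partial>lborel))) < \<infinity>"
    by (auto simp: ennreal_mult_less_top)
  with mean_cluster_occ[OF r] show ?thesis by (rule le_less_trans)
qed

lemma integrable_Y:
  assumes r: "0 \<le> r"
  shows "integrable N (Y r)"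
  by (rule integrableI_nonneg) (use mean_cluster_occ_finite[OF r] in \<open>auto simp: ennreal_Y[OF r]\<close>)

lemma integrable_Y_power:
  assumes r: "0 \<le> r" and n: "1 \<le> n"
  shows "integrable N (\<lambda>z. Y r z ^ n)"
proof (rule Bochner_Integration.integrable_bound)
  define b where "b = (\<Sum>i\<in>{1..m}. a i * (B * r))"
  have "0 \<le> B" using \<psi>_bounds[of 0] by simp
  then have b: "0 \<le> b" using a r by (auto simp: b_def less_imp_le intro!: sum_nonneg mult_nonneg_nonneg)
  have Yb: "Y r z \<le> b" for z
    using cluster_occ_bounded[OF r, of z] b by (intro enn2real_leI) (auto simp: b_def)
  show "integrable N (\<lambda>z. b ^ (n - 1) * Y r z)"
    using integrable_Y[OF r] by simp
  show "AE z in N. norm (Y r z ^ n) \<le> norm (b ^ (n - 1) * Y r z)"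
  proof (rule AE_I2)
    fix z
    have "Y r z ^ n = Y r z ^ (n - 1) * Y r z" using n by (cases n) auto
    also have "\<dots> \<le> b ^ (n - 1) * Y r z"
      using Yb[of z] by (intro mult_right_mono power_mono) auto
    finally show "norm (Y r z ^ n) \<le> norm (b ^ (n - 1) * Y r z)" using b by simp
  qed
qed simp

lemma integral_Y_power:
  assumes r: "0 \<le> r" and n: "1 \<le> n"
  shows "ennreal (LINT z|N. Y r z ^ n) = (\<integral>\<^sup>+z. cluster_occ r z ^ n \<partial>N)"
  by (subst nn_integral_eq_integral[symmetric, OF integrable_Y_power[OF r n]])
     (auto simp: ennreal_Y[OF r] simp flip: ennreal_power)

definition total_occ :: "real \<Rightarrow> 'w \<Rightarrow> ennreal" where
  "total_occ r \<omega> = (\<Sum>k. \<Sum>i\<in>{1..m}. ennreal (a i) * path_occupation \<psi> r (\<xi> k \<omega>, path_of (D i k) \<omega>))"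

lemma measurable_total_occ [measurable]: "total_occ r \<in> borel_measurable M"
  unfolding total_occ_def[abs_def]
proof (intro borel_measurable_suminf_order borel_measurable_sum borel_measurable_times_ennreal borel_measurable_const)
  fix k i assume "i \<in> {1..m}"
  then have "(\<lambda>\<omega>. (\<xi> k \<omega>, path_of (D i k) \<omega>)) \<in> measurable M (borel \<Otimes>\<^sub>M path_space)"
    by (intro measurable_Pair measurable_\<xi> measurable_path)
  from measurable_compose[OF this measurable_path_occupation[OF \<psi>]]
  show "(\<lambda>\<omega>. path_occupation \<psi> r (\<xi> k \<omega>, path_of (D i k) \<omega>)) \<in> borel_measurable M" .
qed

text \<open>A cluster is a mark with intensity measure \<open>\<nu> \<Otimes> M\<close>: the space \<open>M\<close> carries the law of the
  displacements.\<close>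

lemma laplace_total_occ:
  "(LINT \<omega>|M. lexp (s * total_occ r \<omega>)) = lexp (\<integral>\<^sup>+z. ennreal (1 - lexp (s * cluster_occ r z)) \<partial>N)"
proof -
  define \<Psi> where "\<Psi> i z = ennreal (a i) * path_occupation \<psi> r z" for i z
  have \<Psi>: "\<Psi> i \<in> borel_measurable (borel \<Otimes>\<^sub>M path_space)" for i
    unfolding \<Psi>_def[abs_def] using measurable_path_occupation[OF \<psi>] by simp
  have "(\<integral>\<^sup>+z. ennreal (1 - lexp (s * cluster_occ r z)) \<partial>N)
      = (\<integral>\<^sup>+x. \<integral>\<^sup>+\<omega>. ennreal (1 - lexp (s * cluster_occ r (x, \<omega>))) \<partial>M \<partial>\<nu>)"
    by (rule nn_integral_fst[symmetric]) measurable
  then show ?thesis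
    using laplace_marked_points_scaled[of \<Psi> s, OF \<Psi>]
    by (simp add: mark_sum_def \<Psi>_def total_occ_def cluster_occ_def particle_occ_def)
qed

text \<open>As \<open>s\<close> tends to 0, the Laplace transform of the sum tends to the probability that the sum is
  finite, while its explicit form tends to 1 because the clusters have finite mean.\<close>

lemma total_occ_finite:
  assumes r: "0 \<le> r"
  shows "AE \<omega> in M. total_occ r \<omega> < \<top>"
proof -
  let ?F = "{\<omega> \<in> space M. total_occ r \<omega> < \<top>}"
  obtain I where I: "(\<integral>\<^sup>+z. cluster_occ r z \<partial>N) = ennreal I" "0 \<le> I"
    using mean_cluster_occ_finite[OF r] by (cases "\<integral>\<^sup>+z. cluster_occ r z \<partial>N") auto
  have "exp (- (I / real (Suc n))) \<le> prob ?F" for n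
  proof -
    define s where "s = ennreal (1 / real (Suc n))"
    have s: "s \<noteq> 0" by (simp add: s_def ennreal_eq_0_iff not_le)
    have "(\<integral>\<^sup>+z. ennreal (1 - lexp (s * cluster_occ r z)) \<partial>N) \<le> (\<integral>\<^sup>+z. s * cluster_occ r z \<partial>N)"
      by (intro nn_integral_mono one_minus_lexp_le)
    also have "\<dots> = ennreal (I / real (Suc n))"
      using I by (simp add: nn_integral_cmult s_def flip: ennreal_mult)
    finally have "lexp (ennreal (I / real (Suc n))) \<le> (LINT \<omega>|M. lexp (s * total_occ r \<omega>))"
      unfolding laplace_total_occ by (rule lexp_antimono)
    also have "\<dots> \<le> (LINT \<omega>|M. indicator ?F \<omega>)"
    proof (rule integral_mono)
      show "integrable M (\<lambda>\<omega>. lexp (s * total_occ r \<omega>))"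
        by (rule integrable_const_bound[where B = 1]) auto
      show "integrable M (indicator ?F :: 'w \<Rightarrow> real)"
        by (rule integrable_const_bound[where B = 1]) (auto simp: indicator_def)
      fix \<omega> assume "\<omega> \<in> space M"
      then show "lexp (s * total_occ r \<omega>) \<le> indicator ?F \<omega>"
        using s by (cases "total_occ r \<omega> = \<top>") (auto simp: ennreal_mult_top less_top indicator_def)
    qed
    finally show ?thesis using I by (simp add: lexp_ennreal)
  qed
  moreover have "(\<lambda>n. exp (- (I / real (Suc n)))) \<longlonglongrightarrow> exp (- 0)"
    by (intro tendsto_exp tendsto_minus LIMSEQ_Suc[OF lim_const_over_n])
  ultimately have "exp (- 0) \<le> prob ?F"
    by (intro LIMSEQ_le_const2) auto
  then have "prob ?F = 1" using prob_le_1[of ?F] by simp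
  then show ?thesis by (auto dest: AE_prob_1)
qed

abbreviation A :: "real \<Rightarrow> 'w \<Rightarrow> real" where
  "A \<equiv> occupation a m X \<eta> \<psi>"

lemma occupation_eq_total_occ:
  assumes r: "0 \<le> r"
  shows "AE \<omega> in M. ennreal (A r \<omega>) = total_occ r \<omega>"
proof -
  have "AE \<omega> in M. \<omega> \<in> space M \<and> total_occ r \<omega> < \<top>"
    using total_occ_finite[OF r] by simp
  then show ?thesis
  proof eventually_elim
    case (elim \<omega>)
    then have \<omega>: "\<omega> \<in> space M" and finite: "total_occ r \<omega> < \<top>" by auto
    have "A r \<omega> = enn2real (total_occ r \<omega>)"
      unfolding total_occ_def
    proof (rule occupation_eq_sum[where x = "\<lambda>k. \<xi> k \<omega>" and w = "\<lambda>i k. path_of (D i k) \<omega>"])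
      show "\<eta> \<omega> = distr (count_space UNIV) borel (\<lambda>k. \<xi> k \<omega>)" by (rule enumeration[OF \<omega>])
      show "path_of (D i k) \<omega> \<in> space path_space" if "i \<in> {1..m}" for i k
        using measurable_space[OF measurable_path[OF that] \<omega>] .
      show "X i (\<xi> k \<omega>) t \<omega> = \<xi> k \<omega> + path_eval (path_of (D i k) \<omega>) t" if "i \<in> {1..m}" "0 \<le> t" for i k t
        using stable_particle.path_eval_Y[OF particle[OF that(1)] \<omega> that(2), of k] by (simp add: D_eq)
    qed (use \<psi>_bounds finite in \<open>auto simp: total_occ_def\<close>)
    then show ?case using finite by simp
  qed
qed

lemma A_nonneg: "0 \<le> A r \<omega>"
  unfolding occupation_def set_lebesgue_integral_def using \<psi>_bounds
  by (intro Bochner_Integration.integral_nonneg) (auto intro!: mult_nonneg_nonneg Bochner_Integration.integral_nonneg)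

lemma integrable_A:
  assumes A2: "integrable M (\<lambda>\<omega>. (A r \<omega>)\<^sup>2)"
  shows "integrable M (A r)"
proof (rule Bochner_Integration.integrable_bound)
  show "integrable M (\<lambda>\<omega>. 1 + (A r \<omega>)\<^sup>2)" using A2 by simp
  have "(\<lambda>\<omega>. sqrt ((A r \<omega>)\<^sup>2)) \<in> borel_measurable M"
    using A2 by measurable
  then show "A r \<in> borel_measurable M" using A_nonneg by simp
  show "AE \<omega> in M. norm (A r \<omega>) \<le> norm (1 + (A r \<omega>)\<^sup>2)"
  proof (rule AE_I2)
    fix \<omega>
    have "A r \<omega> \<le> 1 + (A r \<omega>)\<^sup>2"
      using zero_le_power2[of "A r \<omega> - 1"] A_nonneg[of r \<omega>] by (simp add: power2_diff)
    then show "norm (A r \<omega>) \<le> norm (1 + (A r \<omega>)\<^sup>2)" using A_nonneg[of r \<omega>] by simp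
  qed
qed

lemma occupation_law:
  assumes r: "0 < r" and A2: "integrable M (\<lambda>\<omega>. (A r \<omega>)\<^sup>2)"
  shows "poisson_integral_law M N (A r) (Y r)"
proof (intro poisson_integral_law.intro poisson_integral_law_axioms.intro)
  have r0: "0 \<le> r" using r by simp
  show "prob_space M" by (rule prob_space_axioms)
  show "sigma_finite_measure N" by (rule NM.sigma_finite_measure_axioms)
  show "0 \<le> A r \<omega>" for \<omega> by (rule A_nonneg)
  show "integrable M (A r)" by (rule integrable_A[OF A2])
  then have [measurable]: "A r \<in> borel_measurable M" by simp
  show "0 \<le> Y r z" for z by simp
  show "integrable N (Y r)" by (rule integrable_Y[OF r0])
  fix s :: real assume s: "0 \<le> s"
  have int: "integrable N (\<lambda>z. 1 - exp (- s * Y r z))"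
  proof (rule Bochner_Integration.integrable_bound)
    show "integrable N (\<lambda>z. s * Y r z)" using integrable_Y[OF r0] by simp
    show "AE z in N. norm (1 - exp (- s * Y r z)) \<le> norm (s * Y r z)"
      using exp_neg_diff_le[of "Y r _" 0 s] s by (intro AE_I2) simp
  qed simp
  have lexp_scaled: "0 \<le> y \<longrightarrow> lexp (ennreal s * ennreal y) = exp (- s * y)" for y
    using s by (simp add: lexp_ennreal flip: ennreal_mult)
  have "(LINT \<omega>|M. exp (- s * A r \<omega>)) = (LINT \<omega>|M. lexp (ennreal s * total_occ r \<omega>))"
  proof (rule integral_cong_AE)
    show "AE \<omega> in M. exp (- s * A r \<omega>) = lexp (ennreal s * total_occ r \<omega>)"
      using occupation_eq_total_occ[OF r0]
    proof eventually_elim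
      case (elim \<omega>)
      show ?case
        unfolding elim[symmetric] using lexp_scaled[of "A r \<omega>"] A_nonneg by simp
    qed
  qed auto
  also have "\<dots> = lexp (\<integral>\<^sup>+z. ennreal (1 - lexp (ennreal s * cluster_occ r z)) \<partial>N)"
    by (rule laplace_total_occ)
  also have "(\<lambda>z. ennreal (1 - lexp (ennreal s * cluster_occ r z))) = (\<lambda>z. ennreal (1 - exp (- s * Y r z)))"
  proof
    fix z
    show "ennreal (1 - lexp (ennreal s * cluster_occ r z)) = ennreal (1 - exp (- s * Y r z))"
      using lexp_scaled[of "Y r z"] by (simp only: ennreal_Y[OF r0] enn2real_nonneg simp_thms)
  qed
  also have "(\<integral>\<^sup>+z. ennreal (1 - exp (- s * Y r z)) \<partial>N) = ennreal (LINT z|N. 1 - exp (- s * Y r z))"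
    by (rule nn_integral_eq_integral[OF int]) (use s in auto)
  also have "lexp \<dots> = exp (- (LINT z|N. 1 - exp (- s * Y r z)))"
    using s by (intro lexp_ennreal Bochner_Integration.integral_nonneg) auto
  finally show "(LINT \<omega>|M. exp (- s * A r \<omega>)) = exp (- (LINT z|N. 1 - exp (- s * Y r z)))" .
qed

text \<open>For \<open>r \<ge> 1\<close> the bound of Stein's method has a third moment of order \<open>r powr (3 - 2 / \<alpha>)\<close> in the
  numerator and \<open>\<sigma> ^ 3\<close>, at least of order \<open>r powr (3 - 3 / (2 * \<alpha>))\<close>, in the denominator. For \<open>r < 1\<close> the
  trivial bound 2 is enough as soon as the constant is at least 2. That the variance is positive excludes \<open>m = 0\<close>
  and test functions that vanish almost everywhere.\<close>

theorem wasserstein_rate: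
  assumes A2: "\<And>r. 0 < r \<Longrightarrow> integrable M (\<lambda>\<omega>. (A r \<omega>)\<^sup>2)" and pos: "\<And>r. 0 < r \<Longrightarrow> 0 < std_dev M (A r)"
  shows "\<exists>C>0. \<forall>r>0. wasserstein (distr M borel (standardize M (A r))) std_normal_distribution
    \<le> ennreal (C * r powr (- 1 / (2 * \<alpha>)))"
proof -
  have variance: "(std_dev M (A r))\<^sup>2 = (LINT z|N. (Y r z)\<^sup>2)" if r: "0 < r" for r
  proof -
    interpret P: poisson_integral_law M N "A r" "Y r"
      by (rule occupation_law[OF r A2[OF r]])
    show ?thesis
      unfolding std_dev_def using P.variance_eq_second_moment[OF A2[OF r] integrable_Y_power[of r 2]] r
      by (simp add: real_sqrt_pow2)
  qed
  have nontrivial: "(\<integral>\<^sup>+z. cluster_occ 1 z \<partial>N) \<noteq> 0"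
  proof
    assume "(\<integral>\<^sup>+z. cluster_occ 1 z \<partial>N) = 0"
    then have "AE z in N. cluster_occ 1 z = 0"
      by (subst (asm) nn_integral_0_iff_AE) auto
    then have "AE z in N. (Y 1 z)\<^sup>2 = 0"
      by eventually_elim simp
    then have "(LINT z|N. (Y 1 z)\<^sup>2) = (LINT z|N. 0)"
      by (intro integral_cong_AE) auto
    then show False using variance[of 1] pos[of 1] by simp
  qed
  have m: "1 \<le> m"
  proof (rule ccontr)
    assume "\<not> 1 \<le> m"
    then have "(\<integral>\<^sup>+z. cluster_occ 1 z \<partial>N) = 0" unfolding cluster_occ_def by simp
    with nontrivial show False by simp
  qed
  have \<psi>_pos: "(\<integral>\<^sup>+x. ennreal (\<psi> x) \<partial>lborel) \<noteq> 0"
    using nontrivial mean_cluster_occ[of 1] by auto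
  obtain C3 where C3: "0 < C3"
    "\<And>r. 0 < r \<Longrightarrow> (\<integral>\<^sup>+z. cluster_occ r z ^ 3 \<partial>N) \<le> ennreal (C3 * r powr (3 - 2 / \<alpha>))"
    using third_moment_cluster_occ by metis
  obtain C2 where C2: "0 < C2"
    "\<And>r. 1 \<le> r \<Longrightarrow> ennreal (C2 * r powr (2 - 1 / \<alpha>)) \<le> (\<integral>\<^sup>+z. (cluster_occ r z)\<^sup>2 \<partial>N)"
    using second_moment_cluster_occ[OF m \<psi>_pos] by metis
  define C where "C = max 2 (9 * C3 / sqrt C2 ^ 3)"
  have large: "wasserstein (distr M borel (standardize M (A r))) std_normal_distribution \<le> ennreal (C * r powr (- 1 / (2 * \<alpha>)))"
    if r: "1 \<le> r" for r
  proof -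
    have r0: "0 < r" "0 \<le> r" using r by auto
    interpret P: poisson_integral_law M N "A r" "Y r"
      by (rule occupation_law[OF r0(1) A2[OF r0(1)]])
    let ?\<sigma> = "std_dev M (A r)" and ?T = "LINT z|N. Y r z ^ 3"
    have T: "?T \<le> C3 * r powr (3 - 2 / \<alpha>)"
      using C3(2)[OF r0(1)] C3(1) by (subst (asm) integral_Y_power[OF r0(2), of 3, symmetric]) (auto simp: ennreal_le_iff)
    have "C2 * r powr (2 - 1 / \<alpha>) \<le> ?\<sigma>\<^sup>2"
    proof -
      have "ennreal (C2 * r powr (2 - 1 / \<alpha>)) \<le> ennreal (?\<sigma>\<^sup>2)"
        using C2(2)[OF r] integral_Y_power[OF r0(2), of 2] by (simp only: variance[OF r0(1)])
      then show ?thesis by (subst (asm) ennreal_le_iff) auto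
    qed
    then have "sqrt (C2 * r powr (2 - 1 / \<alpha>)) \<le> ?\<sigma>"
      using pos[OF r0(1)] by (intro real_le_lsqrt) auto
    moreover have "sqrt (C2 * r powr (2 - 1 / \<alpha>)) = sqrt C2 * r powr (1 - 1 / (2 * \<alpha>))"
    proof -
      have "r powr (2 - 1 / \<alpha>) = (r powr (1 - 1 / (2 * \<alpha>)))\<^sup>2"
        using r0 by (simp add: power2_eq_square flip: powr_add)
      then show ?thesis by (simp add: real_sqrt_mult)
    qed
    ultimately have \<sigma>_lower: "sqrt C2 * r powr (1 - 1 / (2 * \<alpha>)) \<le> ?\<sigma>" by simp
    have "9 * ?T / ?\<sigma> ^ 3 \<le> 9 * (C3 * r powr (3 - 2 / \<alpha>)) / (sqrt C2 * r powr (1 - 1 / (2 * \<alpha>))) ^ 3"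
      using T \<sigma>_lower C2(1) C3(1) r0 by (intro frac_le power_mono mult_left_mono) auto
    also have "\<dots> = 9 * C3 / sqrt C2 ^ 3 * (r powr (3 - 2 / \<alpha>) / (r powr (1 - 1 / (2 * \<alpha>))) ^ 3)"
      by (simp add: power_mult_distrib)
    also have "r powr (3 - 2 / \<alpha>) / (r powr (1 - 1 / (2 * \<alpha>))) ^ 3 = r powr (- 1 / (2 * \<alpha>))"
    proof -
      have "(r powr (1 - 1 / (2 * \<alpha>))) ^ 3 = r powr (3 * (1 - 1 / (2 * \<alpha>)))"
        using r0 by (simp add: powr_power mult.commute)
      moreover have "3 - 2 / \<alpha> - 3 * (1 - 1 / (2 * \<alpha>)) = - 1 / (2 * \<alpha>)"
        using \<alpha> by (simp add: field_simps)
      ultimately show ?thesis by (simp flip: powr_diff)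
    qed
    also have "9 * C3 / sqrt C2 ^ 3 * r powr (- 1 / (2 * \<alpha>)) \<le> C * r powr (- 1 / (2 * \<alpha>))"
      by (intro mult_right_mono) (auto simp: C_def)
    finally have bound: "9 * ?T / ?\<sigma> ^ 3 \<le> C * r powr (- 1 / (2 * \<alpha>))" .
    have "wasserstein (distr M borel (standardize M (A r))) std_normal_distribution \<le> ennreal (9 * ?T / ?\<sigma> ^ 3)"
      by (rule P.wasserstein_normal_bound[OF A2[OF r0(1)] integrable_Y_power integrable_Y_power pos[OF r0(1)]])
         (use r0 in auto)
    also have "\<dots> \<le> ennreal (C * r powr (- 1 / (2 * \<alpha>)))"
      using bound by (rule ennreal_leI)
    finally show ?thesis .
  qed
  have small: "wasserstein (distr M borel (standardize M (A r))) std_normal_distribution \<le> ennreal (C * r powr (- 1 / (2 * \<alpha>)))"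
    if r: "0 < r" "r < 1" for r
  proof -
    have "wasserstein (distr M borel (standardize M (A r))) std_normal_distribution \<le> 2"
      by (rule wasserstein_standardized_le_two[OF prob_space_axioms integrable_A[OF A2] A2 pos]) (use r in auto)
    also have "(2::ennreal) \<le> ennreal (C * r powr (- 1 / (2 * \<alpha>)))"
    proof -
      have "1 \<le> r powr (- 1 / (2 * \<alpha>))"
        using powr_mono'[of "- 1 / (2 * \<alpha>)" 0 r] r \<alpha> by simp
      then have "2 * 1 \<le> C * r powr (- 1 / (2 * \<alpha>))"
        by (intro mult_mono) (auto simp: C_def)
      from ennreal_leI[OF this] show ?thesis by simp
    qed
    finally show ?thesis .
  qed
  show ?thesis
  proof (intro exI[of _ C] conjI allI impI)
    show "0 < C" by (simp add: C_def)
    show "wasserstein (distr M borel (standardize M (A r))) std_normal_distribution \<le> ennreal (C * r powr (- 1 / (2 * \<alpha>)))"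
      if "0 < r" for r
      using large[of r] small[of r] that by (cases "1 \<le> r") auto
  qed
qed

end

theorem proposition5p1:
  fixes M :: "'w measure"
    and \<nu> :: "'a::euclidean_space measure"
    and \<eta> :: "'w \<Rightarrow> 'a measure"
    and \<alpha> :: real and m :: nat and a c :: "nat \<Rightarrow> real"
    and X :: "nat \<Rightarrow> 'a \<Rightarrow> real \<Rightarrow> 'w \<Rightarrow> 'a"
    and \<psi> :: "'a \<Rightarrow> real"
  assumes "prob_space M"
    and "bounded_density_intensity \<nu>"
    and "poisson_random_measure M \<nu> \<eta>"
    and "0 < \<alpha>" and "\<alpha> \<le> 2"
    and "\<And>i. i \<in> {1..m} \<Longrightarrow> 0 < a i"
    and "stable_clusters M \<alpha> m c \<eta> X"
    and "\<psi> \<in> borel_measurable borel" and "bounded (range \<psi>)"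
    and "compact (closure {x. \<psi> x \<noteq> 0})"
    and "\<And>r. 0 < r \<Longrightarrow> integrable M (\<lambda>\<omega>. (occupation a m X \<eta> \<psi> r \<omega>)\<^sup>2)"
    and "\<And>r. 0 < r \<Longrightarrow> 0 < std_dev M (occupation a m X \<eta> \<psi> r)"
    and "DIM('a) = 1"
    and "\<And>x. 0 \<le> \<psi> x"
    and "real DIM('a) / \<alpha> < 1"
  shows "\<exists>C>0. \<forall>r>0.
           wasserstein (distr M borel (standardize M (occupation a m X \<eta> \<psi> r))) std_normal_distribution
             \<le> ennreal (C * r powr (- 1 / (2 * \<alpha>)))"
proof -
  interpret prob_space M by fact
  obtain f l u where f: "f \<in> borel_measurable borel" "0 < l" "\<And>x. l \<le> f x \<and> f x \<le> u"
    and \<nu>: "\<nu> = density lborel (\<lambda>x. ennreal (f x))"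
    using \<open>bounded_density_intensity \<nu>\<close> unfolding bounded_density_intensity_def by blast
  obtain \<xi> :: "nat \<Rightarrow> 'w \<Rightarrow> 'a" where \<xi>:
    "\<And>k. \<xi> k \<in> borel_measurable M"
    "\<And>\<omega>. \<omega> \<in> space M \<Longrightarrow> \<eta> \<omega> = distr (count_space UNIV) borel (\<lambda>k. \<xi> k \<omega>)"
    and stable: "\<And>i k. i \<in> {1..m} \<Longrightarrow>
      symmetric_stable_process M \<alpha> (c i) (\<lambda>t \<omega>. X i (\<xi> k \<omega>) t \<omega> - \<xi> k \<omega>)"
    and indep: "indep_vars (\<lambda>_. PiM {0..} (\<lambda>_. borel))
      (\<lambda>(i, k) \<omega>. \<lambda>t\<in>{0..}. X i (\<xi> k \<omega>) t \<omega> - \<xi> k \<omega>) ({1..m} \<times> UNIV)"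
      "indep_set
          (sets (vimage_algebra (space M) (\<lambda>\<omega>. \<lambda>k. \<xi> k \<omega>) (PiM UNIV (\<lambda>_. borel))))
          (sets (vimage_algebra (space M)
             (\<lambda>\<omega>. restrict (\<lambda>(i, k, t). X i (\<xi> k \<omega>) t \<omega> - \<xi> k \<omega>) ({1..m} \<times> UNIV \<times> {0..}))
             (PiM ({1..m} \<times> UNIV \<times> {0..}) (\<lambda>_. borel))))"
    using \<open>stable_clusters M \<alpha> m c \<eta> X\<close> unfolding stable_clusters_def Let_def by blast
  define D where "D = (\<lambda>i k t \<omega>. X i (\<xi> k \<omega>) t \<omega> - \<xi> k \<omega>)"
  obtain B where B: "\<And>x. \<psi> x \<le> B"
    using \<open>bounded (range \<psi>)\<close> unfolding bounded_iff by (auto simp: abs_le_iff)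
  have "bounded {x. \<psi> x \<noteq> 0}"
    using \<open>compact (closure {x. \<psi> x \<noteq> 0})\<close> closure_subset by (rule bounded_subset[OF compact_imp_bounded])
  then obtain K where K: "0 < K" "\<And>x. \<psi> x \<noteq> 0 \<Longrightarrow> norm x \<le> K"
    unfolding bounded_pos by auto
  have \<alpha>: "1 < \<alpha>"
    using \<open>0 < \<alpha>\<close> \<open>real DIM('a) / \<alpha> < 1\<close> \<open>DIM('a) = 1\<close> by (simp add: field_simps)
  have stable_D: "symmetric_stable_process M \<alpha> (c i) (D i k)" if "i \<in> {1..m}" for i k
    using stable[OF that, of k] by (simp add: D_def)
  interpret stable_cluster_system M \<nu> \<eta> m \<xi> D \<alpha> a c X \<psi> B K f l u
  proof
    show "poisson_random_measure M \<nu> \<eta>" by fact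
    show "sets \<nu> = sets borel" by (simp add: \<nu>)
    show "distr M path_space (path_of (D i k)) = distr M path_space (path_of (D i 0))" if i: "i \<in> {1..m}" for i k
    proof (rule levy_path_law_unique[OF \<open>prob_space M\<close>])
      show "levy_process M (D i k)" "levy_process M (D i 0)"
        using stable_D[OF i] by (simp_all add: symmetric_stable_process_def)
      show "distr M borel (D i k t) = distr M borel (D i 0 t)" if "0 \<le> t" for t
        by (rule stable_marginal_law_unique[OF \<open>prob_space M\<close> stable_D[OF i] stable_D[OF i] that \<open>DIM('a) = 1\<close>])
    qed
    show "indep_vars (\<lambda>_. path_space) (\<lambda>(i, k). path_of (D i k)) ({1..m} \<times> UNIV)"
      using indep(1) by (simp add: D_def)
    show "indep_set
          (sets (vimage_algebra (space M) (\<lambda>\<omega>. \<lambda>k. \<xi> k \<omega>) (PiM UNIV (\<lambda>_. borel))))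
          (sets (vimage_algebra (space M)
             (\<lambda>\<omega>. restrict (\<lambda>(i, k, t). D i k t \<omega>) ({1..m} \<times> UNIV \<times> {0..}))
             (PiM ({1..m} \<times> UNIV \<times> {0..}) (\<lambda>_. borel))))"
      using indep(2) by (simp add: D_def)
    show "D i k t \<in> borel_measurable M" if "i \<in> {1..m}" "0 \<le> t" for i k t
      using stable_D[OF that(1)] that(2) by (rule stable_process_measurable)
  qed (use assms \<xi> f \<nu> B K \<alpha> stable_D in \<open>auto simp: D_def\<close>)
  show ?thesis
    by (rule wasserstein_rate) (use assms in auto)
qed

end
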